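(* For each $N\in\{1,2,\dots\}$ let $\{Y^{(N)}_i(t)\mid t\ge 0,\ i=1,\dots,N\}$ be the scaled stochastic ranking process of $N$ particles with jump rates $w^{(N)}_i>0$ and scaled initial positions $y^{(N)}_{i,0}$ (defined in the context). Assume: (i) for each $0\le y<1$ there is a probability measure $\mu_{y,0}(dw)$ on $\mathbb{R}_+=[0,\infty)$ such that for every bounded continuous $g:\mathbb{R}_+\to\mathbb{R}$ the function $y\mapsto\int_0^\infty g(w)\,\mu_{y,0}(dw)$ is Lebesgue measurable and $$\lim_{N\to\infty}\ \sup_{y\in[0,1)}\left|\frac1N\sum_{i=1}^N g(w^{(N)}_i)\,\chi_{y^{(N)}_{i,0}\le y}-\int_0^y\left(\int_0^\infty g(w)\,\mu_{z,0}(dw)\right)dz\right|=0;$$ (ii) with $\lambda(dw)=\int_0^1\mu_{y,0}(dw)\,dy$, we have $\int_{[0,\infty)} w\,\lambda(dw)<\infty$; (iii) $\lambda(\{0\})=0$. Then for each $t\ge0$ the joint empirical distribution of particle types and positions at time $t$, $$\mu^{(N)}_t(dw,dy)=\frac1N\sum_{i=1}^N\delta(w-w^{(N)}_i)\,\delta(y-Y^{(N)}_i(t))\,dw\,dy,$$ converges as $N\to\infty$ to a distribution $\mu_{y,t}(dw)\,dy$ on $\mathbb{R}_+\times[0,1)$, in the sense that for every bounded continuous function $f:\mathbb{R}_+\times[0,1)\to\mathbb{R}$, $$\lim_{N\to\infty}\frac1N\sum_{i=1}^N f\bigl(w^{(N)}_i,Y^{(N)}_i(t)\bigr)=\int_0^1\left(\int_0^\infty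 f(w,y)\,\mu_{y,t}(dw)\right)dy\quad\text{in probability.}$$ The limit distribution is absolutely continuous with respect to the Lebesgue measure in $y\in[0,1)$, and its density $\mu_{y,t}(dw)$ with respect to $y$ is given by $$\mu_{y,t}(dw)=\begin{cases}\dfrac{w e^{-w t_0(y)}\,\lambda(dw)}{\int_0^\infty w e^{-w t_0(y)}\,\lambda(dw)}, & y<y_C(t),\\[3ex] \dfrac{e^{-wt}\,\mu_{\hat y(y,t),0}(dw)}{\int_0^\infty e^{-wt}\,\mu_{\hat y(y,t),0}(dw)}, & y>y_C(t),\end{cases}$$ where $y_C(t)$, $t_0(y)$ and $\hat y(y,t)$ are the functions defined in the context.
   Context: Notation: $\chi_A$ is $1$ if $A$ is true and $0$ if $A$ is false; $\sharp A$ is the number of elements of a set $A$. Stochastic ranking process. On a probability space $(\Omega,\mathcal{B},\mathrm{P})$, for each $N$ let jump rates $w^{(N)}_i>0$ and a permutation $x^{(N)}_{1,0},\dots,x^{(N)}_{N,0}$ of $1,\dots,N$ be given (deterministic). For each $i=1,\dots,N$ let $\tau^{(N)}_{i,j}$, $j=0,1,2,\dots$, be random jump times with $\tau^{(N)}_{i,0}=0$, such that the increments $\tau^{(N)}_{i,j+1}-\tau^{(N)}_{i,j}$, $j=0,1,2,\dots$, are i.i.d. with $\mathrm{P}[\tau^{(N)}_{i,1}\le t]=1-e^{-w^{(N)}_i t}$ for $t\ge0$, and such that the sequences $\{\tau^{(N)}_{i,j}\mid j\ge0\}$, $i=1,\dots,N$, are independent. Almost surely each sequence is strictly increasing and $\tau^{(N)}_{i,j}\ne\tau^{(N)}_{i',j'}$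 for $i\neq i'$ and $j,j'\ge1$. The ranking $X^{(N)}_i(t)$ of particle $i$ at time $t$ is defined by $$X^{(N)}_i(t)=x^{(N)}_{i,0}+\sharp\{i'\in\{1,\dots,N\}\mid x^{(N)}_{i',0}>x^{(N)}_{i,0},\ \tau^{(N)}_{i',1}\le t\},\quad 0\le t<\tau^{(N)}_{i,1},$$ and for $j=1,2,3,\dots$ by $X^{(N)}_i(\tau^{(N)}_{i,j})=1$ and $$X^{(N)}_i(t)=1+\sharp\{i'\in\{1,\dots,N\}\mid \exists j'\ge1:\ \tau^{(N)}_{i,j}<\tau^{(N)}_{i',j'}\le t\},\quad \tau^{(N)}_{i,j}<t<\tau^{(N)}_{i,j+1}.$$ (That is, each particle jumps to rank $1$ at its jump times, and its rank is increased by one each time a particle of larger rank jumps.) The scaled quantities are $Y^{(N)}_i(t)=\frac1N(X^{(N)}_i(t)-1)\in[0,1)$ and $y^{(N)}_{i,0}=\frac1N(x^{(N)}_{i,0}-1)$. Deterministic functions. $y_C(t)=1-\int_{[0,\infty)}e^{-wt}\,\lambda(dw)$ for $t\ge0$. Under $\lambda(\{0\})=0$, $y_C:[0,\infty)\to[0,1)$ is a continuous strictly increasing bijection, and $t_0:[0,1)\to[0,\infty)$ denotes its inverse, so $y_C(t_0(y))=y$. For $t\ge0$ and $0\le y<1$, $$y_C(y,t)=1-\int_y^1\int_0^\infty e^{-wt}\,\mu_{z,0}(dw)\,dz ,$$ so that $y_C(0,t)=y_C(t)$. For each $t$, $y\mapsto y_C(y,t)$ is a continuous strictly increasing bijection $[0,1)\to[y_C(t),1)$,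 and $\hat y(\cdot,t):[y_C(t),1)\to[0,1)$ denotes its inverse. *)

theory Defs
  imports "HOL-Probability.Probability"
begin

text \<open>
  \<open>T i j\<close> is the \<open>j\<close>-th jump time of particle \<open>i\<close> (with \<open>T i 0 = 0\<close>) and \<open>x i\<close> its initial rank.
  The index \<open>j\<close> below is the one with \<open>T i j \<le> t < T i (Suc j)\<close>; at \<open>t = T i j\<close>, \<open>j \<ge> 1\<close>, the set
  in the last line is empty, so the rank is \<open>1\<close>.  The lemmas after the definition recover the usual
  three-case description.  \<open>LEAST\<close> makes the rank a measurable function of the jump times also on
  the null event where the jump times are not strictly increasing or do not exceed \<open>t\<close>.
\<close>

definition ranking :: "nat \<Rightarrow> (nat \<Rightarrow> nat) \<Rightarrow> (nat \<Rightarrow> nat \<Rightarrow> real) \<Rightarrow> nat \<Rightarrow> real \<Rightarrow> nat" where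
  "ranking N x T i t =
     (let j = (LEAST j. t < T i (Suc j)) in
      if j = 0
      then x i + card {i' \<in> {1..N}. x i' > x i \<and> T i' 1 \<le> t}
      else 1 + card {i' \<in> {1..N}. \<exists>j'\<ge>1. T i j < T i' j' \<and> T i' j' \<le> t})"

lemma ranking_before_first_jump:
  assumes "t < T i 1"
  shows "ranking N x T i t = x i + card {i' \<in> {1..N}. x i' > x i \<and> T i' 1 \<le> t}"
proof -
  have "(LEAST j. t < T i (Suc j)) = 0"
    using assms by (intro Least_equality) auto
  then show ?thesis by (simp add: ranking_def)
qed

lemma ranking_after_jump:
  assumes "strict_mono (T i)" "1 \<le> j" "T i j \<le> t" "t < T i (Suc j)"
  shows "ranking N x T i t = 1 + card {i' \<in> {1..N}. \<exists>j'\<ge>1. T i j < T i' j' \<and> T i' j' \<le> t}"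
proof -
  have "(LEAST k. t < T i (Suc k)) = j"
  proof (rule Least_equality)
    fix k assume "t < T i (Suc k)"
    with assms have "T i j < T i (Suc k)" by linarith
    with assms(1) show "j \<le> k" by (simp add: strict_mono_less)
  qed (fact assms)
  with assms(2) show ?thesis by (simp add: ranking_def)
qed

lemma ranking_at_jump:
  assumes "strict_mono (T i)" "1 \<le> j"
  shows "ranking N x T i (T i j) = 1"
proof -
  have "{i' \<in> {1..N}. \<exists>j'\<ge>1. T i j < T i' j' \<and> T i' j' \<le> T i j} = {}" by auto
  with ranking_after_jump[of T i j "T i j" N x] assms show ?thesis
    by (simp add: strict_mono_less)
qed

definition scaled_ranking ::
  "nat \<Rightarrow> (nat \<Rightarrow> nat) \<Rightarrow> (nat \<Rightarrow> nat \<Rightarrow> real) \<Rightarrow> nat \<Rightarrow> real \<Rightarrow> real" where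
  "scaled_ranking N x T i t = (real (ranking N x T i t) - 1) / real N"

definition scaled_initial :: "nat \<Rightarrow> (nat \<Rightarrow> nat) \<Rightarrow> nat \<Rightarrow> real" where
  "scaled_initial N x i = (real (x i) - 1) / real N"

text \<open>
  \<open>w N i\<close>, \<open>x0 N i\<close> and \<open>\<tau> N i j\<close> are the jump rate, initial rank and \<open>j\<close>-th jump time of the
  \<open>i\<close>-th of \<open>N\<close> particles.  All \<open>N\<close> share one probability space; nothing is assumed about the
  joint law for different \<open>N\<close>.
\<close>

locale stochastic_ranking_process = prob_space M for M :: "'a measure" +
  fixes w :: "nat \<Rightarrow> nat \<Rightarrow> real"
    and x0 :: "nat \<Rightarrow> nat \<Rightarrow> nat"
    and \<tau> :: "nat \<Rightarrow> nat \<Rightarrow> nat \<Rightarrow> 'a \<Rightarrow> real"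
  assumes rate_pos: "i \<in> {1..N} \<Longrightarrow> 0 < w N i"
    and initial_perm: "bij_betw (x0 N) {1..N} {1..N}"
    and jump_0: "i \<in> {1..N} \<Longrightarrow> \<omega> \<in> space M \<Longrightarrow> \<tau> N i 0 \<omega> = 0"
    and increments_indep:
      "i \<in> {1..N} \<Longrightarrow> indep_vars (\<lambda>_. borel) (\<lambda>j \<omega>. \<tau> N i (Suc j) \<omega> - \<tau> N i j \<omega>) UNIV"
    and increments_identically_distributed:
      "i \<in> {1..N} \<Longrightarrow> distr M borel (\<lambda>\<omega>. \<tau> N i (Suc j) \<omega> - \<tau> N i j \<omega>)
                      = distr M borel (\<lambda>\<omega>. \<tau> N i 1 \<omega> - \<tau> N i 0 \<omega>)"
    and first_jump_exponential:
      "i \<in> {1..N} \<Longrightarrow> 0 \<le> t \<Longrightarrow> prob {\<omega> \<in> space M. \<tau> N i 1 \<omega> \<le> t} = 1 - exp (- (w N i * t))"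
    and particles_indep:
      "indep_vars (\<lambda>_. Pi\<^sub>M UNIV (\<lambda>_. borel)) (\<lambda>i \<omega> j. \<tau> N i j \<omega>) {1..N}"

definition tendsto_in_probability :: "'a measure \<Rightarrow> (nat \<Rightarrow> 'a \<Rightarrow> real) \<Rightarrow> real \<Rightarrow> bool" where
  "tendsto_in_probability M Z c \<longleftrightarrow>
     (\<forall>N. Z N \<in> borel_measurable M) \<and>
     (\<forall>\<epsilon>>0. (\<lambda>N. measure M {\<omega> \<in> space M. \<bar>Z N \<omega> - c\<bar> > \<epsilon>}) \<longlonglongrightarrow> 0)"

abbreviation borel_nonneg :: "real measure" where
  "borel_nonneg \<equiv> restrict_space borel {0..}"

abbreviation borel_unit :: "real measure" where
  "borel_unit \<equiv> restrict_space borel {0..<1}"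

text \<open>
  \<open>\<lambda>(A) = \<integral>\<^sub>0\<^sup>1 \<mu>\<^bsub>y,0\<^esub>(A) dy\<close>.  Throughout, integrals over the position \<open>y\<close> are taken with
  respect to \<open>lebesgue\<close>, not \<open>lborel\<close>, because the kernel \<open>\<mu>\<^bsub>y,0\<^esub>\<close> is only Lebesgue measurable in \<open>y\<close>.
\<close>

definition rate_dist :: "(real \<Rightarrow> real measure) \<Rightarrow> real measure" where
  "rate_dist \<mu>0 = Giry_Monad.bind (lebesgue_on {0..<1}) \<mu>0"

definition y_C :: "(real \<Rightarrow> real measure) \<Rightarrow> real \<Rightarrow> real" where
  "y_C \<mu>0 t = 1 - (LINT v|rate_dist \<mu>0. exp (- (v * t)))"

definition t_0 :: "(real \<Rightarrow> real measure) \<Rightarrow> real \<Rightarrow> real" where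
  "t_0 \<mu>0 = the_inv_into {0..} (y_C \<mu>0)"

definition y_C2 :: "(real \<Rightarrow> real measure) \<Rightarrow> real \<Rightarrow> real \<Rightarrow> real" where
  "y_C2 \<mu>0 y t = 1 - (LINT z|lebesgue_on {y..<1}. LINT v|\<mu>0 z. exp (- (v * t)))"

definition y_hat :: "(real \<Rightarrow> real measure) \<Rightarrow> real \<Rightarrow> real \<Rightarrow> real" where
  "y_hat \<mu>0 y t = the_inv_into {0..<1} (\<lambda>z. y_C2 \<mu>0 z t) y"

text \<open>The measure \<open>\<mu>\<^bsub>y,t\<^esub>\<close>; it is left unspecified at the single point \<open>y = y_C(t)\<close>.\<close>

definition limit_density :: "(real \<Rightarrow> real measure) \<Rightarrow> real \<Rightarrow> real \<Rightarrow> real measure" where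
  "limit_density \<mu>0 y t =
     (if y < y_C \<mu>0 t then
        density (rate_dist \<mu>0)
          (\<lambda>v. ennreal (v * exp (- (v * t_0 \<mu>0 y)) /
                        (LINT u|rate_dist \<mu>0. u * exp (- (u * t_0 \<mu>0 y)))))
      else if y > y_C \<mu>0 t then
        density (\<mu>0 (y_hat \<mu>0 y t))
          (\<lambda>v. ennreal (exp (- (v * t)) /
                        (LINT u|\<mu>0 (y_hat \<mu>0 y t). exp (- (u * t)))))
      else undefined)"

end

(*
  Let J be the time of the last jump of a particle before t (0 if there is none).  The renewal
  assumption gives P(J <= r) = exp(-w(t - r)) for 0 <= r <= t, and the J of different particles are
  independent.  The ranking at time t is the lexicographic order by (decreasing J, initial rank), so
  each of the sets {J > t - s} and {J > 0 or initial position <= z} is an initial segment of the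
  ranking: it occupies exactly the positions below its own proportion.  Membership in a segment is
  independent over the particles, so the law of large numbers and hypothesis (i) yield the asymptotic
  proportions y_C(s) and y_C(z,t) of the segments and the asymptotic distribution of the jump rates
  within them; a step function approximation in the position then handles a general test function.
  That the limit has the stated density is a change of variables along s |-> y_C(s) and z |-> y_C(z,t).
*)

theory Submission
  imports Defs
begin

section \<open>Last jump times\<close>

text \<open>The positions are dependent, since each rank counts all other particles. A segment,
  however, is defined through the jump times and the initial rank of a single particle and a
  deterministic threshold; dependence enters only through the size of the segment, and that size
  concentrates. A test function of the position is therefore replaced by a combination of
  differences of segment indicators, and every error is measured in L1, where a second moment bound
  suffices; Markov's inequality does the rest. Two obstacles shape the proof. The strip is not
  compact, so a test function is uniformly continuous only after cutting off large rates and
  positions near 1; the limit law pays for both cut-offs. And \<open>\<mu>0\<close> is measurable in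
  the position only for Lebesgue sets, while the limit density composes it with the inverse of
  \<open>y_C2\<close>; this is safe only if the inverse pulls Lebesgue sets back to Lebesgue sets.
  The finite mean makes \<open>y_C\<close> Lipschitz, and the absence of mass at 0 makes it strictly
  increasing.\<close>

text \<open>For j > 0, \<open>T j\<close> is a sum of j exponential increments, hence Erlang, and
  independent of the next increment. Integrating the survival probability of that increment against
  the Erlang density leaves a monomial times exp(-(l*t)). The results are the Poisson weights of
  parameter l*s, times exp(-(l*(t-s))).\<close>

lemma (in prob_space) exponential_renewal_interval:
  fixes T :: "nat \<Rightarrow> 'a \<Rightarrow> real"
  assumes l: "0 < l" and T0: "\<And>\<omega>. \<omega> \<in> space M \<Longrightarrow> T 0 \<omega> = 0"
    and indep: "indep_vars (\<lambda>_. borel) (\<lambda>j \<omega>. T (Suc j) \<omega> - T j \<omega>) UNIV"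
    and expo: "\<And>j. distributed M lborel (\<lambda>\<omega>. T (Suc j) \<omega> - T j \<omega>) (exponential_density l)"
    and s: "0 \<le> s" "s \<le> t"
  shows "prob {\<omega> \<in> space M. T j \<omega> \<le> s \<and> t < T (Suc j) \<omega>} = exp (- (l * t)) * ((l * s) ^ j / fact j)"
proof (cases j)
  case 0
  have "{\<omega> \<in> space M. T j \<omega> \<le> s \<and> t < T (Suc j) \<omega>} = {\<omega> \<in> space M. t < T (Suc 0) \<omega> - T 0 \<omega>}"
    using T0 s 0 by auto
  with exponential_distributedD_gt[OF expo[of 0], of t] s l 0 show ?thesis
    by (simp add: mult.commute)
next
  case (Suc k)
  define X where "X \<omega> = (\<Sum>i\<in>{..k}. T (Suc i) \<omega> - T i \<omega>)" for \<omega>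
  define Y where "Y \<omega> = T (Suc (Suc k)) \<omega> - T (Suc k) \<omega>" for \<omega>
  have X: "X \<omega> = T (Suc k) \<omega>" if "\<omega> \<in> space M" for \<omega>
    using T0[OF that] sum_telescope[of "\<lambda>i. - T i \<omega>" k] by (simp add: X_def)
  \<comment> \<open>\<open>erlang_density k\<close> is the law of a sum of \<open>Suc k\<close>
    exponentials, matching the index set {..k}.\<close>
  have dX: "distributed M lborel X (erlang_density k l)"
    using exponential_distributed_sum[of "{..k}" l "\<lambda>j \<omega>. T (Suc j) \<omega> - T j \<omega>"] l
      indep_vars_subset[OF indep, of "{..k}"] expo
    by (simp add: X_def[abs_def])
  have dY: "distributed M lborel Y (exponential_density l)"
    unfolding Y_def[abs_def] by (rule expo)
  have iYX: "indep_var borel Y borel X"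
    unfolding X_def[abs_def] Y_def[abs_def]
    by (rule indep_vars_sum) (auto intro: indep_vars_subset[OF indep])
  have rv[measurable]: "random_variable borel X" "random_variable borel Y"
    using iYX by (auto simp: indep_var_eq)
  have D: "distr M borel X = density lborel (erlang_density k l)"
      "distr M borel Y = density lborel (exponential_density l)"
    using dX dY by (auto simp: distributed_def cong: distr_cong)
  interpret PX: prob_space "distr M borel X" by (rule prob_space_distr) simp
  interpret PY: prob_space "distr M borel Y" by (rule prob_space_distr) simp
  interpret P: pair_sigma_finite "distr M borel Y" "distr M borel X" ..
  let ?A = "{(y, x). x \<le> s \<and> t < x + y} :: (real \<times> real) set"
  have A[measurable]: "?A \<in> sets (borel \<Otimes>\<^sub>M borel)"
  proof -
    have "{p \<in> space (borel \<Otimes>\<^sub>M borel). snd p \<le> s \<and> t < snd p + fst p} \<in> sets (borel \<Otimes>\<^sub>M (borel :: real measure))"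
      by measurable
    also have "{p \<in> space (borel \<Otimes>\<^sub>M borel). snd p \<le> s \<and> t < snd p + fst p} = ?A"
      by (auto simp: space_pair_measure)
    finally show ?thesis .
  qed
  have "{\<omega> \<in> space M. T j \<omega> \<le> s \<and> t < T (Suc j) \<omega>} = (\<lambda>\<omega>. (Y \<omega>, X \<omega>)) -` ?A \<inter> space M"
    using X by (auto simp: Suc Y_def)
  then have "emeasure M {\<omega> \<in> space M. T j \<omega> \<le> s \<and> t < T (Suc j) \<omega>}
      = emeasure (distr M (borel \<Otimes>\<^sub>M borel) (\<lambda>\<omega>. (Y \<omega>, X \<omega>))) ?A"
    by (subst emeasure_distr) simp_all
  also have "distr M (borel \<Otimes>\<^sub>M borel) (\<lambda>\<omega>. (Y \<omega>, X \<omega>)) = distr M borel Y \<Otimes>\<^sub>M distr M borel X"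
    using iYX by (simp add: indep_var_distribution_eq)
  also have "emeasure \<dots> ?A = (\<integral>\<^sup>+x. emeasure (distr M borel Y) ((\<lambda>y. (y, x)) -` ?A) \<partial>distr M borel X)"
    by (rule P.emeasure_pair_measure_alt2) simp
  also have "\<dots> = (\<integral>\<^sup>+x. ennreal (erlang_density k l x) *
      emeasure (distr M borel Y) ((\<lambda>y. (y, x)) -` ?A) \<partial>lborel)"
    unfolding D(1) by (subst nn_integral_density) (use A in \<open>auto simp: l less_imp_le intro: measurable_compose[OF _ P.measurable_emeasure_Pair2]\<close>)
  also have "\<dots> = (\<integral>\<^sup>+x. ennreal (exp (- (l * t)) * (l ^ Suc k * x ^ k / fact k)) * indicator {0..s} x \<partial>lborel)"
  proof (rule nn_integral_cong)
    fix x :: real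
    show "ennreal (erlang_density k l x) * emeasure (distr M borel Y) ((\<lambda>y. (y, x)) -` ?A)
        = ennreal (exp (- (l * t)) * (l ^ Suc k * x ^ k / fact k)) * indicator {0..s} x"
    proof (cases "x \<in> {0..s}")
      case True
      have "(\<lambda>y. (y, x)) -` ?A = {t - x <..}" using True by auto
      moreover have "emeasure (distr M borel Y) {t - x <..} = ennreal (prob {\<omega> \<in> space M. t - x < Y \<omega>})"
        by (subst emeasure_distr) (auto simp: emeasure_eq_measure intro!: arg_cong[where f=prob])
      moreover have "prob {\<omega> \<in> space M. t - x < Y \<omega>} = exp (- (t - x) * l)"
        using exponential_distributedD_gt[OF dY, of "t - x"] True s l by simp
      moreover have "erlang_density k l x * exp (- (t - x) * l) = exp (- (l * t)) * (l ^ Suc k * x ^ k / fact k)"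
        using True by (simp add: erlang_density_def field_simps flip: exp_add)
      ultimately show ?thesis using True by (simp flip: ennreal_mult'')
    next
      case False
      then have "erlang_density k l x = 0 \<or> (\<lambda>y. (y, x)) -` ?A = {}"
        by (auto simp: erlang_density_def)
      with False show ?thesis by auto
    qed
  qed
  also have "\<dots> = ennreal (exp (- (l * t)) * ((l * s) ^ Suc k / fact (Suc k)) - 0)"
  \<comment> \<open>The antiderivative vanishes at 0 because the exponent \<open>Suc k\<close> is
    positive; hence the \<open>- 0\<close>.\<close>
  proof (rule nn_integral_FTC_Icc[where F="\<lambda>x. exp (- (l * t)) * ((l * x) ^ Suc k / fact (Suc k))", THEN trans])
    fix x :: real
    let ?c = "exp (- (l * t)) * l ^ Suc k / fact (Suc k)"
    have "((\<lambda>x. ?c * x ^ Suc k) has_real_derivative ?c * (real (Suc k) * x ^ k)) (at x)"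
      using DERIV_pow[of "Suc k" x UNIV] by (intro DERIV_cmult) simp
    moreover have "?c * real (Suc k) = exp (- (l * t)) * l ^ Suc k / fact k"
      by (simp del: of_nat_Suc power_Suc)
    then have "?c * (real (Suc k) * x ^ k) = exp (- (l * t)) * (l ^ Suc k * x ^ k / fact k)"
      by (simp only: mult.assoc[symmetric]) (simp only: times_divide_eq_right times_divide_eq_left mult.assoc)
    moreover have "exp (- (l * t)) * ((l * x) ^ Suc k / fact (Suc k)) = ?c * x ^ Suc k" for x
      by (simp only: power_mult_distrib times_divide_eq_right times_divide_eq_left mult.assoc)
    ultimately show "((\<lambda>x. exp (- (l * t)) * ((l * x) ^ Suc k / fact (Suc k))) has_real_derivative
        exp (- (l * t)) * (l ^ Suc k * x ^ k / fact k)) (at x)"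
      by (simp only:)
  qed (use s l in \<open>auto simp del: power_Suc\<close>)
  finally show ?thesis using s l by (simp add: emeasure_eq_measure Suc)
qed

section \<open>Trajectories and the last jump before a fixed time\<close>

definition last_jump :: "(nat \<Rightarrow> real) \<Rightarrow> real \<Rightarrow> real" where
  "last_jump T t = T (LEAST j. t < T (Suc j))"

text \<open>The event, shown below to be almost sure, on which the \<open>LEAST\<close> in
  \<open>last_jump\<close> and in \<open>ranking\<close> picks the index of the last jump up to t.
  Non-explosion is asked for only in the form that some jump exceeds the fixed t.\<close>

definition regular_jumps :: "(nat \<Rightarrow> real) \<Rightarrow> real \<Rightarrow> bool" where
  "regular_jumps T t \<longleftrightarrow> T 0 = 0 \<and> strict_mono T \<and> (\<exists>j. t < T (Suc j))"

lemma last_jump_cases: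
  assumes "regular_jumps T t" "0 \<le> t"
  obtains n where "(LEAST j. t < T (Suc j)) = n" "last_jump T t = T n" "T n \<le> t" "t < T (Suc n)"
proof -
  define n where "n = (LEAST j. t < T (Suc j))"
  have T0: "T 0 = 0" and ex: "\<exists>j. t < T (Suc j)"
    using assms by (auto simp: regular_jumps_def)
  have 1: "t < T (Suc n)"
    unfolding n_def using ex by (rule LeastI_ex)
  have 2: "T n \<le> t"
  proof (cases n)
    case 0
    then show ?thesis using T0 assms by simp
  next
    case (Suc k)
    then have "\<not> t < T (Suc k)"
      using not_less_Least[of k "\<lambda>j. t < T (Suc j)"] by (simp add: n_def)
    then show ?thesis using Suc by simp
  qed
  show ?thesis by (rule that[of n]) (use 1 2 in \<open>auto simp: n_def last_jump_def\<close>)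
qed

lemma last_jump_nonneg:
  assumes "regular_jumps T t" "0 \<le> t"
  shows "0 \<le> last_jump T t"
proof -
  from last_jump_cases[OF assms] obtain n where "last_jump T t = T n" by metis
  moreover have "T 0 \<le> T n"
    using assms strict_mono_less_eq[of T 0 n] by (simp add: regular_jumps_def)
  ultimately show ?thesis using assms by (auto simp: regular_jumps_def)
qed

text \<open>By strict monotonicity only one of the intervals from \<open>T j\<close> to
  \<open>T (Suc j)\<close> contains t. A condition on a random index thus becomes a union of the
  events whose probabilities are the Poisson weights.\<close>

lemma last_jump_le_iff:
  assumes "regular_jumps T t" "0 \<le> t" "s \<le> t"
  shows "last_jump T t \<le> s \<longleftrightarrow> (\<exists>j. T j \<le> s \<and> t < T (Suc j))"
proof -
  from last_jump_cases[OF assms(1,2)] obtain n where n: "last_jump T t = T n" "T n \<le> t" "t < T (Suc n)"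
    by metis
  have mono: "strict_mono T" using assms by (simp add: regular_jumps_def)
  have "j = n" if "T j \<le> s" "t < T (Suc j)" for j
  proof -
    have "T j < T (Suc n)" "T n < T (Suc j)" using that n assms by linarith+
    then show ?thesis using mono by (simp add: strict_mono_less)
  qed
  then show ?thesis using n by auto
qed

text \<open>The right-hand side is the condition counted in \<open>ranking\<close> for a particle
  that has already jumped, with r its own last jump; the largest \<open>T j\<close> up to t is the
  last jump itself.\<close>

lemma less_last_jump_iff:
  assumes "regular_jumps T t" "0 \<le> t" "0 \<le> r"
  shows "r < last_jump T t \<longleftrightarrow> (\<exists>j\<ge>1. r < T j \<and> T j \<le> t)"
proof -
  from last_jump_cases[OF assms(1,2)] obtain n where n: "last_jump T t = T n" "T n \<le> t" "t < T (Suc n)"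
    by metis
  have T: "strict_mono T" "T 0 = 0" using assms by (simp_all add: regular_jumps_def)
  show ?thesis
  proof
    assume r: "r < last_jump T t"
    then have "n \<noteq> 0" using T assms n by (intro notI) simp
    then show "\<exists>j\<ge>1. r < T j \<and> T j \<le> t"
      using r n by (intro exI[of _ n]) auto
  next
    assume "\<exists>j\<ge>1. r < T j \<and> T j \<le> t"
    then obtain j where j: "r < T j" "T j \<le> t" by auto
    then have "T j < T (Suc n)" using n by linarith
    then have "T j \<le> T n" using T by (simp add: strict_mono_less strict_mono_less_eq)
    then show "r < last_jump T t" using j n by linarith
  qed
qed

lemma last_jump_pos_iff:
  assumes "regular_jumps T t" "0 \<le> t"
  shows "0 < last_jump T t \<longleftrightarrow> T 1 \<le> t"
proof -
  have T: "strict_mono T" "T 0 = 0" using assms by (simp_all add: regular_jumps_def)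
  have "T 0 < T 1" using strict_mono_less[OF T(1), of 0 1] by simp
  moreover have "T 1 \<le> T j" if "1 \<le> j" for j using T that by (simp add: strict_mono_less_eq)
  ultimately show ?thesis
    unfolding less_last_jump_iff[OF assms order_refl] using T(2) by (auto intro: order_trans)
qed

text \<open>Particles are ordered by the time of their last jump, and those that never jumped by their
  initial rank.\<close>

lemma ranking_eq_card:
  assumes reg: "\<And>i'. i' \<in> {1..N} \<Longrightarrow> regular_jumps (T i') t" and t: "0 \<le> t"
    and perm: "bij_betw x {1..N} {1..N}" and i: "i \<in> {1..N}"
  shows "ranking N x T i t = Suc (card {i' \<in> {1..N}. last_jump (T i) t < last_jump (T i') t \<or>
           last_jump (T i) t = 0 \<and> x i' < x i})"
proof -
  let ?J = "\<lambda>i. last_jump (T i) t"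
  from last_jump_cases[OF reg[OF i] t] obtain n where
    n: "(LEAST j. t < T i (Suc j)) = n" "?J i = T i n" by metis
  have T: "strict_mono (T i)" "T i 0 = 0" using reg[OF i] by (simp_all add: regular_jumps_def)
  show ?thesis
  proof (cases "n = 0")
    case True
    then have J0: "?J i = 0" using n T by simp
    \<comment> \<open>A particle that never jumped has behind all particles of smaller initial rank,
      whether they jumped or not, and in addition behind those of larger initial rank that jumped.
      Splitting this way makes the union disjoint.\<close>
    let ?A = "{i' \<in> {1..N}. x i' < x i}" and ?B = "{i' \<in> {1..N}. x i' > x i \<and> 0 < ?J i'}"
    have xi: "x i \<in> {1..N}" using perm i by (auto simp: bij_betw_def)
    have "x ` ?A = {1..<x i}"
    proof -
      have "x ` ?A = x ` {1..N} \<inter> {..<x i}" by auto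
      also have "\<dots> = {1..<x i}" using perm xi by (auto simp: bij_betw_def)
      finally show ?thesis .
    qed
    moreover have "inj_on x ?A" using bij_betw_imp_inj_on[OF perm] by (rule inj_on_subset) auto
    ultimately have "card ?A = x i - 1" using card_image[of x ?A] by simp
    then have "x i = Suc (card ?A)" using xi by simp
    moreover have "ranking N x T i t = x i + card {i' \<in> {1..N}. x i' > x i \<and> T i' 1 \<le> t}"
      using n True by (simp add: ranking_def)
    moreover have "{i' \<in> {1..N}. x i' > x i \<and> T i' 1 \<le> t} = ?B"
      using last_jump_pos_iff[OF reg t] by auto
    moreover have "card (?A \<union> ?B) = card ?A + card ?B"
      by (intro card_Un_disjoint) auto
    moreover have "?A \<union> ?B = {i' \<in> {1..N}. ?J i < ?J i' \<or> ?J i = 0 \<and> x i' < x i}"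
    proof -
      \<comment> \<open>A particle that jumped is not i itself, so by injectivity the strict
        comparison of initial ranks loses nothing.\<close>
      have "x i' \<noteq> x i" if "i' \<in> {1..N}" "0 < ?J i'" for i'
        using inj_onD[OF bij_betw_imp_inj_on[OF perm], of i' i] that i J0 by auto
      then show ?thesis using J0 by (auto simp: neq_iff)
    qed
    ultimately show ?thesis by simp
  next
    case False
    then have J0: "0 < ?J i" using n T(2) strict_mono_less[OF T(1), of 0 n] by simp
    \<comment> \<open>With a positive last jump the clause on initial ranks is void, and only later
      last jumps count.\<close>
    have "ranking N x T i t = Suc (card {i' \<in> {1..N}. \<exists>j'\<ge>1. T i n < T i' j' \<and> T i' j' \<le> t})"
      using n False by (simp add: ranking_def)
    moreover have "{i' \<in> {1..N}. \<exists>j'\<ge>1. T i n < T i' j' \<and> T i' j' \<le> t}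
        = {i' \<in> {1..N}. ?J i < ?J i' \<or> ?J i = 0 \<and> x i' < x i}"
      using less_last_jump_iff[OF reg t, of _ "?J i"] J0 n by auto
    ultimately show ?thesis by simp
  qed
qed

text \<open>Summing the Poisson weights over j gives the exponential series. At s = t the total is
  1, so almost surely some j satisfies \<open>T j\<close> \<le> t < \<open>T (Suc j)\<close>:
  non-explosion comes out of the same computation as the law of the last jump.\<close>

lemma (in prob_space) last_jump_renewal:
  fixes T :: "nat \<Rightarrow> 'a \<Rightarrow> real"
  assumes l: "0 < l" and T0: "\<And>\<omega>. \<omega> \<in> space M \<Longrightarrow> T 0 \<omega> = 0"
    and rv[measurable]: "\<And>j. random_variable borel (T j)"
    and indep: "indep_vars (\<lambda>_. borel) (\<lambda>j \<omega>. T (Suc j) \<omega> - T j \<omega>) UNIV"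
    and expo: "\<And>j. distributed M lborel (\<lambda>\<omega>. T (Suc j) \<omega> - T j \<omega>) (exponential_density l)"
    and t: "0 \<le> t"
  shows AE_regular_jumps: "AE \<omega> in M. regular_jumps (\<lambda>j. T j \<omega>) t"
    and prob_last_jump_le: "0 \<le> s \<Longrightarrow> s \<le> t \<Longrightarrow>
      prob {\<omega> \<in> space M. last_jump (\<lambda>j. T j \<omega>) t \<le> s} = exp (- (l * (t - s)))"
proof -
  have pos: "AE \<omega> in M. 0 < T (Suc j) \<omega> - T j \<omega>" for j
  proof -
    have "prob {\<omega> \<in> space M. 0 < T (Suc j) \<omega> - T j \<omega>} = 1"
      using exponential_distributedD_gt[OF expo[of j], of 0] l by simp
    then show ?thesis
      using prob_Collect_eq_1[of "\<lambda>\<omega>. 0 < T (Suc j) \<omega> - T j \<omega>"] by simp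
  qed
  then have "AE \<omega> in M. \<forall>j. 0 < T (Suc j) \<omega> - T j \<omega>"
    by (simp add: AE_all_countable)
  then have mono: "AE \<omega> in M. strict_mono (\<lambda>j. T j \<omega>)"
    by eventually_elim (simp add: strict_mono_Suc_iff)
  \<comment> \<open>Monotonicity is built into the events so that they are disjoint everywhere and
    not only up to a null set.\<close>
  define E where "E s j = {\<omega> \<in> space M. T j \<omega> \<le> s \<and> t < T (Suc j) \<omega> \<and> strict_mono (\<lambda>j. T j \<omega>)}" for s j
  have [measurable]: "E s j \<in> events" for s j
    unfolding E_def strict_mono_Suc_iff by measurable
  have disj: "disjoint_family (E s)" if "s \<le> t" for s
    unfolding disjoint_family_on_def
  proof (intro ballI impI)
    fix j k :: nat assume "j \<noteq> k"
    have "j = k" if \<omega>: "\<omega> \<in> E s j" "\<omega> \<in> E s k" for \<omega>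
    proof -
      have "T j \<omega> < T (Suc k) \<omega>" "T k \<omega> < T (Suc j) \<omega>" "strict_mono (\<lambda>j. T j \<omega>)"
        using \<omega> \<open>s \<le> t\<close> by (auto simp: E_def)
      then show ?thesis using strict_mono_less[of "\<lambda>j. T j \<omega>"] by force
    qed
    then show "E s j \<inter> E s k = {}" using \<open>j \<noteq> k\<close> by auto
  qed
  have "prob (E s j) = prob {\<omega> \<in> space M. T j \<omega> \<le> s \<and> t < T (Suc j) \<omega>}" for s j
    unfolding E_def by (rule finite_measure_eq_AE) (use mono in \<open>auto simp: strict_mono_Suc_iff\<close>)
  then have E: "prob (E s j) = exp (- (l * t)) * ((l * s) ^ j / fact j)" if "0 \<le> s" "s \<le> t" for s j
    using exponential_renewal_interval[OF l T0 indep expo that] by simp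
  have prob_UN: "prob (\<Union>j. E s j) = exp (- (l * (t - s)))" if s: "0 \<le> s" "s \<le> t" for s
  proof -
    have "(\<lambda>j. prob (E s j)) sums prob (\<Union>j. E s j)"
      using disj[OF s(2)] by (intro finite_measure_UNION) auto
    moreover have "(\<lambda>j. prob (E s j)) sums (exp (- (l * t)) * exp (l * s))"
      unfolding E[OF s] using exp_converges[of "l * s"]
      by (intro sums_mult) (simp add: divide_inverse mult.commute)
    ultimately have "prob (\<Union>j. E s j) = exp (- (l * t)) * exp (l * s)"
      by (rule sums_unique2)
    then show ?thesis by (simp add: algebra_simps flip: exp_add)
  qed
  have "prob (\<Union>j. E t j) = 1" using prob_UN[of t] t by simp
  then have "AE \<omega> in M. \<omega> \<in> (\<Union>j. E t j)" by (simp add: prob_eq_1)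
  then show reg: "AE \<omega> in M. regular_jumps (\<lambda>j. T j \<omega>) t"
    by (rule AE_mp) (auto simp: regular_jumps_def T0 E_def)
  assume s: "0 \<le> s" "s \<le> t"
  have "prob {\<omega> \<in> space M. last_jump (\<lambda>j. T j \<omega>) t \<le> s} = prob (\<Union>j. E s j)"
  proof (rule finite_measure_eq_AE)
    show "AE \<omega> in M. (\<omega> \<in> {\<omega> \<in> space M. last_jump (\<lambda>j. T j \<omega>) t \<le> s}) = (\<omega> \<in> (\<Union>j. E s j))"
      using reg by (rule AE_mp) (auto simp: last_jump_le_iff[OF _ t s(2)] E_def regular_jumps_def)
    show "{\<omega> \<in> space M. last_jump (\<lambda>j. T j \<omega>) t \<le> s} \<in> events"
      unfolding last_jump_def by measurable
  qed auto
  then show "prob {\<omega> \<in> space M. last_jump (\<lambda>j. T j \<omega>) t \<le> s} = exp (- (l * (t - s)))"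
    using prob_UN[OF s] by simp
qed

text \<open>Stated on the space of whole trajectories, so that the last jumps inherit the
  independence of the trajectories.\<close>

lemma measurable_last_jump: "(\<lambda>T. last_jump T t) \<in> borel_measurable (Pi\<^sub>M UNIV (\<lambda>_. borel))"
  unfolding last_jump_def by measurable

section \<open>From initial segments to the empirical distribution\<close>

text \<open>This is nonnegativity of the variance of the absolute value.\<close>

lemma (in prob_space) expectation_abs_le_sqrt:
  fixes S :: "'a \<Rightarrow> real"
  assumes [measurable]: "random_variable borel S" and bd: "\<And>\<omega>. \<omega> \<in> space M \<Longrightarrow> \<bar>S \<omega>\<bar> \<le> B"
  shows "expectation (\<lambda>\<omega>. \<bar>S \<omega>\<bar>) \<le> sqrt (expectation (\<lambda>\<omega>. (S \<omega>)\<^sup>2))"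
proof -
  have "integrable M (\<lambda>\<omega>. \<bar>S \<omega>\<bar>)"
    by (rule integrable_const_bound[where B=B]) (use bd in auto)
  moreover have "integrable M (\<lambda>\<omega>. (\<bar>S \<omega>\<bar>)\<^sup>2)"
  proof (rule integrable_const_bound[where B="B\<^sup>2"])
    show "AE \<omega> in M. norm (\<bar>S \<omega>\<bar>\<^sup>2) \<le> B\<^sup>2"
    proof (rule AE_I2)
      fix \<omega> assume "\<omega> \<in> space M"
      then have "\<bar>S \<omega>\<bar>\<^sup>2 \<le> B\<^sup>2" using bd by (intro power_mono) auto
      then show "norm (\<bar>S \<omega>\<bar>\<^sup>2) \<le> B\<^sup>2" by simp
    qed
  qed simp
  ultimately have "(expectation (\<lambda>\<omega>. \<bar>S \<omega>\<bar>))\<^sup>2 \<le> expectation (\<lambda>\<omega>. (\<bar>S \<omega>\<bar>)\<^sup>2)"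
    using variance_eq[of "\<lambda>\<omega>. \<bar>S \<omega>\<bar>"] variance_positive[of "\<lambda>\<omega>. \<bar>S \<omega>\<bar>"] by linarith
  then show ?thesis by (intro real_le_rsqrt) simp
qed

text \<open>Centred independent summands are orthogonal, so only the diagonal of the squared sum
  survives. Centring doubles the bound B, whence the factor 2.\<close>

lemma (in prob_space) expectation_abs_sum_indep_le:
  fixes X :: "nat \<Rightarrow> 'a \<Rightarrow> real"
  assumes indep: "indep_vars (\<lambda>_. borel) X I" and fin: "finite I" and B: "0 \<le> B"
    and bd: "\<And>i \<omega>. i \<in> I \<Longrightarrow> \<omega> \<in> space M \<Longrightarrow> \<bar>X i \<omega>\<bar> \<le> B"
  shows "expectation (\<lambda>\<omega>. \<bar>(\<Sum>i\<in>I. X i \<omega>) - (\<Sum>i\<in>I. expectation (X i))\<bar>) \<le> 2 * B * sqrt (card I)"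
proof -
  define Z where "Z i \<omega> = X i \<omega> - expectation (X i)" for i \<omega>
  have X[measurable]: "random_variable borel (X i)" if "i \<in> I" for i
    using indep that by (simp add: indep_vars_def)
  have Xint[simp]: "integrable M (X i)" if "i \<in> I" for i
    by (rule integrable_const_bound[where B=B]) (use bd that in auto)
  have EX: "\<bar>expectation (X i)\<bar> \<le> B" if "i \<in> I" for i
  proof -
    have "\<bar>expectation (X i)\<bar> \<le> expectation (\<lambda>\<omega>. \<bar>X i \<omega>\<bar>)" by (rule integral_abs_bound)
    also have "\<dots> \<le> B"
      by (rule integral_le_const) (use bd that in \<open>auto intro: integrable_abs\<close>)
    finally show ?thesis .
  qed
  have Z[measurable]: "random_variable borel (Z i)" if "i \<in> I" for i
    unfolding Z_def[abs_def] using that by measurable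
  have Zbd: "\<bar>Z i \<omega>\<bar> \<le> 2 * B" if "i \<in> I" "\<omega> \<in> space M" for i \<omega>
    using bd[OF that] EX[OF that(1)] unfolding Z_def by linarith
  have Zint[simp]: "integrable M (Z i)" if "i \<in> I" for i
    by (rule integrable_const_bound[where B="2*B"]) (use Zbd that in auto)
  have ZZbd: "\<bar>Z i \<omega> * Z j \<omega>\<bar> \<le> (2 * B) * (2 * B)" if "i \<in> I" "j \<in> I" "\<omega> \<in> space M" for i j \<omega>
    unfolding abs_mult using Zbd that B by (intro mult_mono) auto
  have ZZint[simp]: "integrable M (\<lambda>\<omega>. Z i \<omega> * Z j \<omega>)" if "i \<in> I" "j \<in> I" for i j
    by (rule integrable_const_bound[where B="2*B*(2*B)"]) (use ZZbd that in auto)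
  have EZ: "expectation (Z i) = 0" if "i \<in> I" for i
    using that by (simp add: Z_def[abs_def] prob_space)
  have indepZ: "indep_vars (\<lambda>_. borel) Z I"
    unfolding Z_def by (rule indep_vars_compose2[OF indep]) simp
  have EZZ: "expectation (\<lambda>\<omega>. Z i \<omega> * Z j \<omega>) = 0" if "i \<in> I" "j \<in> I" "i \<noteq> j" for i j
  proof -
    have "expectation (\<lambda>\<omega>. \<Prod>k\<in>{i, j}. Z k \<omega>) = (\<Prod>k\<in>{i, j}. expectation (Z k))"
      by (rule indep_vars_lebesgue_integral)
        (use that in \<open>auto intro: indep_vars_subset[OF indepZ]\<close>)
    then show ?thesis using that EZ by simp
  qed
  let ?S = "\<lambda>\<omega>. \<Sum>i\<in>I. Z i \<omega>"
  have "expectation (\<lambda>\<omega>. (?S \<omega>)\<^sup>2) = (\<Sum>i\<in>I. \<Sum>j\<in>I. expectation (\<lambda>\<omega>. Z i \<omega> * Z j \<omega>))"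
    by (simp add: power2_eq_square sum_product)
  also have "\<dots> = (\<Sum>i\<in>I. expectation (\<lambda>\<omega>. Z i \<omega> * Z i \<omega>))"
  proof (rule sum.cong)
    fix i assume "i \<in> I"
    then have "(\<Sum>j\<in>I. expectation (\<lambda>\<omega>. Z i \<omega> * Z j \<omega>))
        = (\<Sum>j\<in>I. if j = i then expectation (\<lambda>\<omega>. Z i \<omega> * Z j \<omega>) else 0)"
      by (intro sum.cong) (auto simp: EZZ)
    then show "(\<Sum>j\<in>I. expectation (\<lambda>\<omega>. Z i \<omega> * Z j \<omega>)) = expectation (\<lambda>\<omega>. Z i \<omega> * Z i \<omega>)"
      using fin \<open>i \<in> I\<close> by simp
  qed simp
  also have "\<dots> \<le> (\<Sum>i\<in>I. (2 * B) * (2 * B))"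
    by (intro sum_mono integral_le_const ZZint AE_I2) (use ZZbd in \<open>auto dest: abs_le_D1\<close>)
  also have "\<dots> = (2 * B)\<^sup>2 * card I" by (simp add: power2_eq_square)
  finally have S2: "expectation (\<lambda>\<omega>. (?S \<omega>)\<^sup>2) \<le> (2 * B)\<^sup>2 * card I" .
  have "expectation (\<lambda>\<omega>. \<bar>?S \<omega>\<bar>) \<le> sqrt (expectation (\<lambda>\<omega>. (?S \<omega>)\<^sup>2))"
  proof (rule expectation_abs_le_sqrt)
    show "\<bar>?S \<omega>\<bar> \<le> (\<Sum>i\<in>I. 2 * B)" if "\<omega> \<in> space M" for \<omega>
      by (rule order_trans[OF sum_abs sum_mono]) (use Zbd that in auto)
  qed simp
  also have "\<dots> \<le> sqrt ((2 * B)\<^sup>2 * card I)" using S2 by (rule real_sqrt_le_mono)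
  also have "\<dots> = 2 * B * sqrt (card I)" using B by (simp add: real_sqrt_mult)
  finally show ?thesis by (simp add: Z_def sum_subtractf)
qed

text \<open>Uniform continuity on compact sets in a form that can be integrated: the cut-off in \<open>v\<close> pays
  for the non-compactness in the first variable.\<close>

lemma bounded_continuous_modulus:
  fixes f :: "real \<times> real \<Rightarrow> real"
  assumes f: "continuous_on ({0..} \<times> {0..<1}) f"
    and B: "\<And>p. p \<in> {0..} \<times> {0..<1} \<Longrightarrow> \<bar>f p\<bar> \<le> B"
    and \<delta>: "0 < \<delta>" "\<delta> < 1" and \<eta>: "0 < \<eta>" and R: "0 \<le> R"
  obtains C where "0 \<le> C"
    "\<And>v y y'. 0 \<le> v \<Longrightarrow> y \<in> {0..<1} \<Longrightarrow> y' \<in> {0..1 - \<delta>} \<Longrightarrow>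
       \<bar>f (v, y) - f (v, y')\<bar> \<le> \<eta> + C * \<bar>y - y'\<bar> + 2 * B * min 1 (max 0 (v - R))"
proof -
  \<comment> \<open>The compact set leaves a margin on both sides: the cut-off reaches 1 at v = R +
    1, and y' \<le> 1 - \<delta> together with a distance below \<delta> / 2 keeps y below 1 -
    \<delta> / 2.\<close>
  let ?K = "{0..R + 1} \<times> {0..1 - \<delta> / 2}"
  have "?K \<subseteq> {0..} \<times> {0..<1}" using \<delta> by auto
  then have "continuous_on ?K f" using f continuous_on_subset by blast
  moreover have "compact ?K" by (intro compact_Times) auto
  ultimately have "uniformly_continuous_on ?K f" by (simp add: compact_uniformly_continuous)
  then obtain r where r: "0 < r" "\<And>p q. p \<in> ?K \<Longrightarrow> q \<in> ?K \<Longrightarrow> dist q p < r \<Longrightarrow> dist (f q) (f p) < \<eta>"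
    unfolding uniformly_continuous_on_def using \<eta> by metis
  define \<rho> where "\<rho> = min r (\<delta> / 2)"
  have \<rho>: "0 < \<rho>" "\<rho> \<le> r" "\<rho> \<le> \<delta> / 2" using r \<delta> by (auto simp: \<rho>_def)
  have B0: "0 \<le> B" using B[of "(0, 0)"] by simp
  show ?thesis
  proof
    \<comment> \<open>With this constant the linear term alone reaches the trivial bound 2 * B as
      soon as the positions are \<rho> apart.\<close>
    show "0 \<le> 2 * B / \<rho>" using B0 \<rho> by simp
    fix v y y' :: real assume v: "0 \<le> v" and y: "y \<in> {0..<1}" and y': "y' \<in> {0..1 - \<delta>}"
    have 2: "\<bar>f (v, y) - f (v, y')\<bar> \<le> 2 * B"
      using B[of "(v, y)"] B[of "(v, y')"] v y y' \<delta> by (simp add: abs_le_iff)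
    consider "R + 1 \<le> v" | "\<rho> \<le> \<bar>y - y'\<bar>" | "v < R + 1" "\<bar>y - y'\<bar> < \<rho>" by linarith
    then show "\<bar>f (v, y) - f (v, y')\<bar> \<le> \<eta> + 2 * B / \<rho> * \<bar>y - y'\<bar> + 2 * B * min 1 (max 0 (v - R))"
    proof cases
      case 1
      then have "min 1 (max 0 (v - R)) = 1" by simp
      moreover have "0 \<le> 2 * B / \<rho> * \<bar>y - y'\<bar>" using B0 \<rho> by simp
      ultimately show ?thesis using 2 \<eta> by simp
    next
      case 2
      then have "2 * B * \<rho> \<le> 2 * B * \<bar>y - y'\<bar>" using B0 by (intro mult_left_mono) auto
      then have "2 * B \<le> 2 * B / \<rho> * \<bar>y - y'\<bar>" using \<rho> by (simp add: field_simps)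
      moreover have "0 \<le> 2 * B * min 1 (max 0 (v - R))" using B0 by simp
      ultimately show ?thesis using \<open>\<bar>f (v, y) - f (v, y')\<bar> \<le> 2 * B\<close> \<eta> by linarith
    next
      case 3
      have "(v, y) \<in> ?K" "(v, y') \<in> ?K" using 3 v y y' \<rho> \<delta> by (auto simp: abs_less_iff)
      moreover have "dist (v, y) (v, y') < r" using 3 \<rho> by (simp add: dist_Pair_Pair dist_real_def)
      ultimately have "\<bar>f (v, y) - f (v, y')\<bar> < \<eta>" using r(2) by (simp add: dist_real_def)
      moreover have "0 \<le> 2 * B / \<rho> * \<bar>y - y'\<bar>" "0 \<le> 2 * B * min 1 (max 0 (v - R))" using B0 \<rho> by auto
      ultimately show ?thesis by linarith
    qed
  qed
qed

text \<open>The flags \<open>b k\<close> switch on at most once, so the sum collapses to a single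
  value \<open>f (u j)\<close> with \<open>d j\<close> \<le> Y < \<open>d (Suc j)\<close>. The
  thresholds \<open>d\<close> need not be the grid points \<open>u\<close>: their discrepancy only
  adds to the distance from Y to \<open>u j\<close>. If no flag is on, the sum is 0 and the trivial
  bound B takes over. Used for the limit law with \<open>d\<close> equal to \<open>u\<close>, and
  for the particles with \<open>d\<close> the observed proportions.\<close>

lemma step_function_approximation:
  fixes f :: "real \<Rightarrow> real"
  assumes modulus: "\<And>k. k \<le> m \<Longrightarrow> \<bar>f Y - f (u k)\<bar> \<le> \<eta> + C * \<bar>Y - u k\<bar> + K"
    and "0 \<le> \<eta>" "0 \<le> C" "0 \<le> K" "0 \<le> h" and B: "\<bar>f Y\<bar> \<le> B"
    and u: "\<And>k. k < m \<Longrightarrow> u (Suc k) = u k + h"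
    and b: "\<And>k. k \<le> m \<Longrightarrow> b k \<longleftrightarrow> Y < d k"
    and b0: "\<not> b 0" and b_mono: "\<And>k. k < m \<Longrightarrow> b k \<Longrightarrow> b (Suc k)"
  shows "\<bar>f Y - (\<Sum>k<m. f (u k) * (of_bool (b (Suc k)) - of_bool (b k)))\<bar>
      \<le> \<eta> + C * ((\<Sum>k\<le>m. \<bar>d k - u k\<bar>) + h) + K + B * of_bool (\<not> b m)"
proof (cases "b m")
  case False
  have "\<not> b k" if "k \<le> m" for k
    using that False by (induction rule: inc_induct) (auto dest: b_mono)
  then have sum: "(\<Sum>k<m. f (u k) * (of_bool (b (Suc k)) - of_bool (b k))) = 0"
    by (intro sum.neutral) auto
  have "0 \<le> C * ((\<Sum>k\<le>m. \<bar>d k - u k\<bar>) + h)"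
    using assms(3,5) by (intro mult_nonneg_nonneg add_nonneg_nonneg sum_nonneg) auto
  then show ?thesis
    using False \<open>0 \<le> \<eta>\<close> \<open>0 \<le> K\<close> B unfolding sum by simp
next
  case True
  define n where "n = (LEAST k. b k)"
  have bn: "b n" and n: "n \<le> m" using True unfolding n_def by (auto intro: LeastI Least_le)
  then obtain j where j: "n = Suc j" using b0 by (cases n) auto
  have below: "\<not> b k" if "k \<le> j" for k
    using not_less_Least[of k b] that j n_def by simp
  have above: "b k" if "Suc j \<le> k" "k \<le> m" for k
    using that by (induction rule: dec_induct) (use bn j b_mono in auto)
  have "(\<Sum>k<m. f (u k) * (of_bool (b (Suc k)) - of_bool (b k))) = (\<Sum>k<m. if k = j then f (u k) else 0)"
  proof (intro sum.cong refl)
    fix k assume "k \<in> {..<m}"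
    then show "f (u k) * (of_bool (b (Suc k)) - of_bool (b k)) = (if k = j then f (u k) else 0)"
      using below[of k] below[of "Suc k"] above[of k] above[of "Suc k"]
      by (cases k j rule: linorder_cases) auto
  qed
  also have "\<dots> = f (u j)" using n j by simp
  finally have sum: "(\<Sum>k<m. f (u k) * (of_bool (b (Suc k)) - of_bool (b k))) = f (u j)" .
  have jm: "j < m" using n j by simp
  have "d j \<le> Y" "Y < d (Suc j)" using below[of j] above[of "Suc j"] b jm by (auto simp: not_less)
  moreover have "\<bar>d k - u k\<bar> \<le> (\<Sum>k\<le>m. \<bar>d k - u k\<bar>)" if "k \<le> m" for k
    by (rule member_le_sum) (use that in auto)
  from this[of j] this[of "Suc j"] have "\<bar>d j - u j\<bar> \<le> (\<Sum>k\<le>m. \<bar>d k - u k\<bar>)"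
      "\<bar>d (Suc j) - u (Suc j)\<bar> \<le> (\<Sum>k\<le>m. \<bar>d k - u k\<bar>)" using jm by auto
  ultimately have "\<bar>Y - u j\<bar> \<le> (\<Sum>k\<le>m. \<bar>d k - u k\<bar>) + h"
    using u[OF jm] \<open>0 \<le> h\<close> by linarith
  then have "C * \<bar>Y - u j\<bar> \<le> C * ((\<Sum>k\<le>m. \<bar>d k - u k\<bar>) + h)"
    using \<open>0 \<le> C\<close> by (rule mult_left_mono)
  then show ?thesis using modulus[of j] jm True unfolding sum by simp
qed

section \<open>Measurability on the strip and tightness of the rates\<close>

lemma space_strip: "space (borel_nonneg \<Otimes>\<^sub>M borel_unit) = {0..} \<times> {0..<1}"
  by (simp add: space_pair_measure space_restrict_space)

lemma continuous_on_strip_measurable: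
  fixes f :: "real \<times> real \<Rightarrow> real"
  assumes "continuous_on ({0..} \<times> {0..<1}) f"
  shows "f \<in> borel_measurable (borel_nonneg \<Otimes>\<^sub>M borel_unit)"
proof -
  have "f \<in> borel_measurable (restrict_space borel ({0..} \<times> {0..<1}))"
    using assms by (rule borel_measurable_continuous_on_restrict)
  moreover have "(\<lambda>p. p) \<in> borel_nonneg \<Otimes>\<^sub>M borel_unit \<rightarrow>\<^sub>M restrict_space borel ({0..} \<times> {0..<1})"
  proof (rule measurable_restrict_space2)
    have "(\<lambda>p. (fst p, snd p)) \<in> borel_nonneg \<Otimes>\<^sub>M borel_unit \<rightarrow>\<^sub>M (borel \<Otimes>\<^sub>M borel :: (real \<times> real) measure)"
      by (intro measurable_Pair measurable_fst'' measurable_snd'' measurable_restrict_space1) auto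
    then show "(\<lambda>p. p) \<in> borel_nonneg \<Otimes>\<^sub>M borel_unit \<rightarrow>\<^sub>M (borel :: (real \<times> real) measure)"
      by (simp add: borel_prod)
  qed (auto simp: space_strip)
  ultimately show ?thesis by (rule measurable_compose[rotated])
qed

lemma continuous_on_section:
  assumes "continuous_on ({0..} \<times> {0..<1}) f" "y \<in> {0..<1::real}"
  shows "continuous_on {0..} (\<lambda>v::real. f (v, y) :: real)"
  by (rule continuous_on_compose2[OF assms(1)]) (use assms(2) in \<open>auto intro!: continuous_intros\<close>)

text \<open>Tightness expressed through a bounded continuous function, so that smallness under the
  limit law carries over to the empirical rates by weak convergence.\<close>

lemma (in prob_space) cut_off_integral_tendsto_0:
  assumes [measurable]: "random_variable borel V"
  shows "((\<lambda>R::nat. expectation (\<lambda>\<omega>. min 1 (max 0 (V \<omega> - real R)))) \<longlonglongrightarrow> 0)"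
proof -
  have "(\<lambda>R::nat. expectation (\<lambda>\<omega>. min 1 (max 0 (V \<omega> - real R)))) \<longlonglongrightarrow> expectation (\<lambda>\<omega>. 0)"
  proof (rule integral_dominated_convergence[where w="\<lambda>_. 1"])
    show "AE \<omega> in M. (\<lambda>R::nat. min 1 (max 0 (V \<omega> - real R))) \<longlonglongrightarrow> 0"
    proof (rule AE_I2)
      fix \<omega>
      obtain n :: nat where "V \<omega> \<le> real n" using real_arch_simple by blast
      then have "\<forall>\<^sub>F R in sequentially. min 1 (max 0 (V \<omega> - real R)) = 0"
        by (intro eventually_sequentiallyI[of n]) auto
      then show "(\<lambda>R::nat. min 1 (max 0 (V \<omega> - real R))) \<longlonglongrightarrow> 0" by (rule tendsto_eventually)
    qed
  qed auto
  then show ?thesis by simp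
qed

text \<open>\<open>D N y i\<close> says that particle \<open>i\<close> belongs to the particles that fill up the positions below (about)
  \<open>y\<close>.  The sets of such particles are initial segments of the ranking, so that their size
  determines which positions they occupy.\<close>

lemma (in prob_space) empirical_distribution_converges_L1:
  fixes v :: "nat \<Rightarrow> nat \<Rightarrow> real" and Y :: "nat \<Rightarrow> nat \<Rightarrow> 'a \<Rightarrow> real"
    and D :: "nat \<Rightarrow> real \<Rightarrow> nat \<Rightarrow> 'a \<Rightarrow> bool" and L :: "(real \<times> real) measure"
    and f :: "real \<times> real \<Rightarrow> real"
  assumes L: "prob_space L" "sets L = sets (borel_nonneg \<Otimes>\<^sub>M borel_unit)"
    and v: "\<And>N i. i \<in> {1..N} \<Longrightarrow> 0 \<le> v N i"
    and D_meas: "\<And>N y i. i \<in> {1..N} \<Longrightarrow> y \<in> {0..<1} \<Longrightarrow> Measurable.pred M (D N y i)"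
    and D_0: "\<And>N i \<omega>. \<not> D N 0 i \<omega>"
    and D_mono: "\<And>N i y y' \<omega>. 0 \<le> y \<Longrightarrow> y \<le> y' \<Longrightarrow> y' < 1 \<Longrightarrow> D N y i \<omega> \<Longrightarrow> D N y' i \<omega>"
    and D_segment: "\<And>N. AE \<omega> in M. \<forall>i\<in>{1..N}. Y N i \<omega> \<in> {0..<1} \<and>
          (\<forall>y\<in>{0..<1}. D N y i \<omega> \<longleftrightarrow> Y N i \<omega> < (\<Sum>i=1..N. of_bool (D N y i \<omega>)) / real N)"
    and conv: "\<And>g :: real \<Rightarrow> real. \<And>y. continuous_on {0..} g \<Longrightarrow> bounded (g ` {0..}) \<Longrightarrow> y \<in> {0..<1} \<Longrightarrow>
          (\<lambda>N. expectation (\<lambda>\<omega>. \<bar>(\<Sum>i=1..N. g (v N i) * of_bool (D N y i \<omega>)) / real N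
                - (LINT p|L. g (fst p) * of_bool (snd p < y))\<bar>)) \<longlonglongrightarrow> 0"
    and total: "\<And>g :: real \<Rightarrow> real. continuous_on {0..} g \<Longrightarrow> bounded (g ` {0..}) \<Longrightarrow>
          (\<lambda>N. (\<Sum>i=1..N. g (v N i)) / real N) \<longlonglongrightarrow> (LINT p|L. g (fst p))"
    and uniform: "\<And>y. y \<in> {0..<1} \<Longrightarrow> (LINT p|L. of_bool (snd p < y)) = y"
    and f: "continuous_on ({0..} \<times> {0..<1}) f" "bounded (f ` ({0..} \<times> {0..<1}))"
    and f_meas: "\<And>N i. i \<in> {1..N} \<Longrightarrow> (\<lambda>\<omega>. f (v N i, Y N i \<omega>)) \<in> borel_measurable M"
  shows "(\<lambda>N. expectation (\<lambda>\<omega>. \<bar>(\<Sum>i=1..N. f (v N i, Y N i \<omega>)) / real N - (LINT p|L. f p)\<bar>)) \<longlonglongrightarrow> 0"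
proof (rule LIMSEQ_I)
  fix \<epsilon> :: real assume \<epsilon>: "0 < \<epsilon>"
  interpret L: prob_space L by (rule L)
  note [measurable_cong] = L(2)
  have spL: "space L = {0..} \<times> {0..<1}"
    using L(2) by (simp add: sets_eq_imp_space_eq space_strip)
  have fL[measurable]: "f \<in> borel_measurable L"
    using continuous_on_strip_measurable[OF f(1)] by (simp add: measurable_cong_sets[OF L(2) refl])
  have fst_meas[measurable]: "fst \<in> borel_measurable L" and snd_meas[measurable]: "snd \<in> borel_measurable L"
    using continuous_on_strip_measurable[OF continuous_on_fst[OF continuous_on_id]]
      continuous_on_strip_measurable[OF continuous_on_snd[OF continuous_on_id]]
    by (simp_all add: measurable_cong_sets[OF L(2) refl])
  obtain B where B: "0 < B" "\<And>p. p \<in> {0..} \<times> {0..<1} \<Longrightarrow> \<bar>f p\<bar> \<le> B"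
    using f(2) unfolding bounded_pos by auto
  \<comment> \<open>Error budget: \<open>H\<close> below has four contributions of at most
    \<epsilon> / 16, and it is incurred twice, once for the particles and once for the limit
    law.\<close>
  define \<eta> where "\<eta> = \<epsilon> / 16"
  define \<delta> where "\<delta> = min (1/2) (\<epsilon> / (16 * B))"
  have \<eta>: "0 < \<eta>" and \<delta>: "0 < \<delta>" "\<delta> < 1" "B * \<delta> \<le> \<epsilon> / 16"
    using \<epsilon> B(1) by (auto simp: \<eta>_def \<delta>_def min_def field_simps)
  \<comment> \<open>The cut-off enters with the factor 2 * B, whence the 32.\<close>
  obtain R :: nat where R: "(LINT p|L. min 1 (max 0 (fst p - real R))) < \<epsilon> / (32 * B)"
    using order_tendstoD(2)[OF L.cut_off_integral_tendsto_0[OF fst_meas], of "\<epsilon> / (32 * B)"] \<epsilon> B(1)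
    by (auto simp: eventually_sequentially)
  define cut where "cut x = min 1 (max 0 (x - real R))" for x :: real
  define Icut where "Icut = (LINT p|L. cut (fst p))"
  have Icut: "2 * B * Icut \<le> \<epsilon> / 16"
    using R B(1) by (simp add: Icut_def cut_def field_simps)
  obtain C where C: "0 \<le> C"
    "\<And>v y y'. 0 \<le> v \<Longrightarrow> y \<in> {0..<1} \<Longrightarrow> y' \<in> {0..1 - \<delta>} \<Longrightarrow>
       \<bar>f (v, y) - f (v, y')\<bar> \<le> \<eta> + C * \<bar>y - y'\<bar> + 2 * B * cut v"
    unfolding cut_def
    using bounded_continuous_modulus[OF f(1) B(2) \<delta>(1,2) \<eta>, of "real R"] by auto
  \<comment> \<open>The mesh is chosen last, because \<open>C\<close> depends on \<delta>, \<eta>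
    and \<open>R\<close>.\<close>
  obtain m :: nat where m: "16 * C / \<epsilon> < real m" using reals_Archimedean2 by blast
  then have m0: "0 < m" using C \<epsilon> by (intro gr0I) (auto simp: field_simps)
  define h where "h = (1 - \<delta>) / m"
  have h: "0 \<le> h" "C * h \<le> \<epsilon> / 16"
  proof -
    show "0 \<le> h" using \<delta> by (simp add: h_def)
    have "C * h \<le> C * (1 / m)" unfolding h_def
      using C \<delta> by (intro mult_left_mono divide_right_mono) auto
    also have "\<dots> \<le> \<epsilon> / 16" using m m0 \<epsilon> by (simp add: field_simps)
    finally show "C * h \<le> \<epsilon> / 16" .
  qed
  define u where "u k = h * real k" for k :: nat
  have um: "u m = 1 - \<delta>" using m0 by (simp add: u_def h_def)
  have u_bounds: "u k \<in> {0..1 - \<delta>}" if "k \<le> m" for k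
  proof -
    have "u k \<le> u m" unfolding u_def using that h by (intro mult_left_mono) auto
    then show ?thesis using um h by (simp add: u_def)
  qed
  then have u_unit: "u k \<in> {0..<1}" if "k \<le> m" for k using \<delta> that by fastforce
  have u0: "u 0 = 0" and uS: "u (Suc k) = u k + h" for k by (simp_all add: u_def algebra_simps)
  have u_mono: "u k \<le> u (Suc k)" for k using h by (simp add: uS)
  \<comment> \<open>k is the grid point at which the test function is evaluated and j the segment;
    only j = k and j = k + 1 occur.\<close>
  define I where "I k j = (LINT p|L. f (fst p, u k) * of_bool (snd p < u j))" for k j
  define A where "A N k j \<omega> = (\<Sum>i=1..N. f (v N i, u k) * of_bool (D N (u j) i \<omega>)) / real N" for N k j \<omega>
  define d where "d N k \<omega> = (\<Sum>i=1..N. of_bool (D N (u k) i \<omega>)) / real N" for N k \<omega>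
  define Xcut where "Xcut N = (\<Sum>i=1..N. cut (v N i)) / real N" for N
  have sec: "continuous_on {0..} (\<lambda>x. f (x, u k))" "bounded ((\<lambda>x. f (x, u k)) ` {0..})" if "k \<le> m" for k
  proof -
    show "continuous_on {0..} (\<lambda>x. f (x, u k))"
      by (rule continuous_on_section[OF f(1) u_unit[OF that]])
    show "bounded ((\<lambda>x. f (x, u k)) ` {0..})"
      by (rule bounded_subset[OF f(2)]) (use u_unit[OF that] in auto)
  qed
  have cut: "continuous_on {0..} cut" "bounded (cut ` {0..})" "0 \<le> cut x" "cut x \<le> 1" for x
    by (auto simp: cut_def[abs_def] intro!: continuous_intros boundedI[of _ 1])
  have secL[measurable]: "(\<lambda>p. f (fst p, u k)) \<in> borel_measurable L" if "k \<le> m" for k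
  proof -
    have "continuous_on ({0..} \<times> {0..<1::real}) (\<lambda>p. f (fst p, u k))"
      by (rule continuous_on_compose2[OF sec(1)[OF that]]) (auto intro!: continuous_intros)
    then show ?thesis
      using continuous_on_strip_measurable by (simp add: measurable_cong_sets[OF L(2) refl])
  qed
  define H where "H = \<eta> + C * h + 2 * B * Icut + B * \<delta>"
  have H: "2 * H < \<epsilon>" using h Icut \<delta> \<epsilon> by (simp add: H_def \<eta>_def)
  \<comment> \<open>Under \<open>L\<close> the segments are exactly the positions below
    \<open>u k\<close>, so thresholds and grid points coincide. The part beyond \<open>u m\<close>
    has mass \<delta>, since positions are uniform.\<close>
  have step_L: "\<bar>(LINT p|L. f p) - (\<Sum>k<m. I k (Suc k) - I k k)\<bar> \<le> H"
  proof -
    define \<Phi> where "\<Phi> p = (\<Sum>k<m. f (fst p, u k) * (of_bool (snd p < u (Suc k)) - of_bool (snd p < u k)))" for p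
    have int_step: "integrable L (\<lambda>p. f (fst p, u k) * of_bool (snd p < u j))" if "k \<le> m" for k j
    proof (rule L.integrable_const_bound[where B=B])
      show "AE p in L. norm (f (fst p, u k) * of_bool (snd p < u j)) \<le> B"
        using B u_unit[OF that] by (intro AE_I2) (auto simp: spL)
    qed (use that in simp)
    have int_f: "integrable L f"
      by (rule L.integrable_const_bound[where B=B]) (use B(2) in \<open>auto simp: spL\<close>)
    have int_\<Phi>: "integrable L \<Phi>"
      unfolding \<Phi>_def[abs_def] right_diff_distrib
      by (intro Bochner_Integration.integrable_sum Bochner_Integration.integrable_diff int_step) auto
    have cut_meas[measurable]: "cut \<in> borel_measurable borel" by (simp add: cut_def[abs_def])
    have int_cut: "integrable L (\<lambda>p. cut (fst p))"
      by (rule L.integrable_const_bound[where B=1]) (use cut in auto)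
    have int_u: "integrable L (\<lambda>p. of_bool (snd p < u m) :: real)"
      by (rule L.integrable_const_bound[where B=1]) auto
    have "(LINT p|L. \<Phi> p) = (\<Sum>k<m. I k (Suc k) - I k k)"
      unfolding \<Phi>_def right_diff_distrib I_def
      by (subst Bochner_Integration.integral_sum)
        (auto intro!: Bochner_Integration.integrable_diff Bochner_Integration.integral_diff sum.cong int_step)
    then have "\<bar>(LINT p|L. f p) - (\<Sum>k<m. I k (Suc k) - I k k)\<bar> = \<bar>LINT p|L. f p - \<Phi> p\<bar>"
      using int_f int_\<Phi> by simp
    also have "\<dots> \<le> (LINT p|L. \<bar>f p - \<Phi> p\<bar>)" by (rule integral_abs_bound)
    also have "\<dots> \<le> (LINT p|L. \<eta> + C * h + 2 * B * cut (fst p) + B * (1 - of_bool (snd p < u m)))"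
    proof (rule integral_mono)
      fix p assume "p \<in> space L"
      then have p: "0 \<le> fst p" "snd p \<in> {0..<1}" by (auto simp: spL)
      have "\<bar>f (fst p, snd p) - (\<Sum>k<m. f (fst p, u k) * (of_bool (snd p < u (Suc k)) - of_bool (snd p < u k)))\<bar>
          \<le> \<eta> + C * ((\<Sum>k\<le>m. \<bar>u k - u k\<bar>) + h) + 2 * B * cut (fst p) + B * of_bool (\<not> snd p < u m)"
      proof (rule step_function_approximation)
        show "\<bar>f (fst p, snd p) - f (fst p, u k)\<bar> \<le> \<eta> + C * \<bar>snd p - u k\<bar> + 2 * B * cut (fst p)" if "k \<le> m" for k
          using C(2)[OF p u_bounds[OF that]] .
        show "snd p < u k \<Longrightarrow> snd p < u (Suc k)" for k using u_mono[of k] by simp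
      qed (use \<eta> C h B p cut in \<open>auto simp: u0 uS mem_Times_iff\<close>)
      then show "\<bar>f p - \<Phi> p\<bar> \<le> \<eta> + C * h + 2 * B * cut (fst p) + B * (1 - of_bool (snd p < u m))"
        by (cases "snd p < u m") (simp_all add: \<Phi>_def)
    qed (use int_f int_\<Phi> int_cut int_u in auto)
    also have "\<dots> = \<eta> + C * h + 2 * B * Icut + B * (1 - u m)"
      using int_cut int_u uniform[OF u_unit[of m]] by (simp add: Icut_def L.prob_space)
    finally show ?thesis by (simp add: H_def um)
  qed
  \<comment> \<open>\<open>W\<close> bounds the error of both step approximations together. Its
    random part consists only of deviations of sums of segment indicators, which \<open>conv\<close>
    sends to 0 in mean, so its expectation tends to 2 * H.\<close>
  define W where "W N \<omega> = (\<eta> + C * h + 2 * B * Xcut N + B * \<delta> + H) + C * (\<Sum>k\<le>m. \<bar>d N k \<omega> - u k\<bar>)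
      + B * \<bar>d N m \<omega> - u m\<bar> + (\<Sum>k<m. \<bar>A N k (Suc k) \<omega> - I k (Suc k)\<bar> + \<bar>A N k k \<omega> - I k k\<bar>)" for N \<omega>
  have dominated: "AE \<omega> in M. \<bar>(\<Sum>i=1..N. f (v N i, Y N i \<omega>)) / real N - (LINT p|L. f p)\<bar> \<le> W N \<omega>"
    if N: "0 < N" for N
  proof (use D_segment[of N] in eventually_elim)
    case (elim \<omega>)
    define \<Phi> where "\<Phi> i = (\<Sum>k<m. f (v N i, u k) * (of_bool (D N (u (Suc k)) i \<omega>) - of_bool (D N (u k) i \<omega>)))" for i
    let ?S = "\<Sum>k\<le>m. \<bar>d N k \<omega> - u k\<bar>"
    have pointwise: "\<bar>f (v N i, Y N i \<omega>) - \<Phi> i\<bar>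
        \<le> \<eta> + C * (?S + h) + 2 * B * cut (v N i) + B * (1 - of_bool (D N (u m) i \<omega>))" if i: "i \<in> {1..N}" for i
    proof -
      have Y: "Y N i \<omega> \<in> {0..<1}" using elim i by auto
      have "\<bar>f (v N i, Y N i \<omega>) - \<Phi> i\<bar>
        \<le> \<eta> + C * (?S + h) + 2 * B * cut (v N i) + B * of_bool (\<not> D N (u m) i \<omega>)"
        unfolding \<Phi>_def
      \<comment> \<open>Here the thresholds are the observed proportions \<open>d N k\<close>, which
        decide membership exactly by \<open>D_segment\<close>.\<close>
      proof (rule step_function_approximation)
        show "\<bar>f (v N i, Y N i \<omega>) - f (v N i, u k)\<bar> \<le> \<eta> + C * \<bar>Y N i \<omega> - u k\<bar> + 2 * B * cut (v N i)" if "k \<le> m" for k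
          using C(2)[OF v[OF i] Y u_bounds[OF that]] .
        show "D N (u k) i \<omega> \<longleftrightarrow> Y N i \<omega> < d N k \<omega>" if "k \<le> m" for k
          using elim i u_unit[OF that] unfolding d_def by blast
        show "D N (u (Suc k)) i \<omega>" if "k < m" "D N (u k) i \<omega>" for k
          using D_mono[of "u k" "u (Suc k)" N i \<omega>] u_unit[of k] u_unit[of "Suc k"] u_mono[of k] that by auto
      qed (use \<eta> C h B v[OF i] Y cut in \<open>auto simp: u0 uS D_0\<close>)
      then show ?thesis by (simp add: of_bool_not_iff)
    qed
    have sum\<Phi>: "(\<Sum>i=1..N. \<Phi> i) / N = (\<Sum>k<m. A N k (Suc k) \<omega> - A N k k \<omega>)"
      unfolding \<Phi>_def A_def
      by (subst sum.swap) (simp add: sum_divide_distrib right_diff_distrib sum_subtractf diff_divide_distrib)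
    have "\<bar>(\<Sum>i=1..N. f (v N i, Y N i \<omega>)) / N - (\<Sum>k<m. A N k (Suc k) \<omega> - A N k k \<omega>)\<bar>
        = \<bar>\<Sum>i=1..N. f (v N i, Y N i \<omega>) - \<Phi> i\<bar> / N"
      unfolding sum\<Phi>[symmetric] by (simp add: sum_subtractf flip: diff_divide_distrib)
    also have "\<dots> \<le> (\<Sum>i=1..N. \<eta> + C * (?S + h) + 2 * B * cut (v N i) + B * (1 - of_bool (D N (u m) i \<omega>))) / N"
      by (intro divide_right_mono order_trans[OF sum_abs sum_mono] pointwise) auto
    also have "\<dots> = \<eta> + C * (?S + h) + 2 * B * Xcut N + B * (1 - d N m \<omega>)"
      using N by (simp add: sum.distrib sum_subtractf sum_distrib_left[symmetric] Xcut_def d_def field_simps)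
    also have "\<dots> \<le> \<eta> + C * (?S + h) + 2 * B * Xcut N + B * (\<bar>d N m \<omega> - u m\<bar> + \<delta>)"
      using B(1) by (intro add_left_mono mult_left_mono) (auto simp: um)
    finally have 1: "\<bar>(\<Sum>i=1..N. f (v N i, Y N i \<omega>)) / N - (\<Sum>k<m. A N k (Suc k) \<omega> - A N k k \<omega>)\<bar>
        \<le> \<eta> + C * (?S + h) + 2 * B * Xcut N + B * (\<bar>d N m \<omega> - u m\<bar> + \<delta>)" .
    have "\<bar>(\<Sum>k<m. A N k (Suc k) \<omega> - A N k k \<omega>) - (\<Sum>k<m. I k (Suc k) - I k k)\<bar>
        = \<bar>\<Sum>k<m. (A N k (Suc k) \<omega> - I k (Suc k)) - (A N k k \<omega> - I k k)\<bar>"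
      by (rule arg_cong[where f=abs]) (simp add: sum_subtractf)
    also have "\<dots> \<le> (\<Sum>k<m. \<bar>A N k (Suc k) \<omega> - I k (Suc k)\<bar> + \<bar>A N k k \<omega> - I k k\<bar>)"
      by (intro order_trans[OF sum_abs sum_mono] abs_triangle_ineq4)
    finally show ?case
      using 1 step_L unfolding W_def by (simp add: distrib_left)
  qed
  have EW: "(\<lambda>N. expectation (W N)) \<longlonglongrightarrow> 2 * H" and W_int: "integrable M (W N)" for N
  proof -
    have A_meas: "(\<lambda>\<omega>. \<bar>(\<Sum>i=1..N. c i * of_bool (D N y i \<omega>)) / real N - a\<bar>) \<in> borel_measurable M"
      if "y \<in> {0..<1}" for c :: "nat \<Rightarrow> real" and a N y
      using D_meas[OF _ that, of _ N] by (intro borel_measurable_abs borel_measurable_diff borel_measurable_divide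
        borel_measurable_sum borel_measurable_times) auto
    have A_int: "integrable M (\<lambda>\<omega>. \<bar>(\<Sum>i=1..N. c i * of_bool (D N y i \<omega>)) / real N - a\<bar>)"
      if "y \<in> {0..<1}" for c :: "nat \<Rightarrow> real" and a N y
    proof (rule integrable_const_bound)
      show "AE \<omega> in M. norm \<bar>(\<Sum>i=1..N. c i * of_bool (D N y i \<omega>)) / real N - a\<bar> \<le> (\<Sum>i=1..N. \<bar>c i\<bar>) / real N + \<bar>a\<bar>"
      proof (rule AE_I2)
        fix \<omega>
        have "\<bar>(\<Sum>i=1..N. c i * of_bool (D N y i \<omega>)) / real N\<bar> \<le> (\<Sum>i=1..N. \<bar>c i\<bar>) / real N"
          unfolding abs_divide abs_of_nat
          by (intro divide_right_mono order_trans[OF sum_abs sum_mono]) (auto simp: abs_mult)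
        then have "\<bar>(\<Sum>i=1..N. c i * of_bool (D N y i \<omega>)) / real N - a\<bar> \<le> (\<Sum>i=1..N. \<bar>c i\<bar>) / real N + \<bar>a\<bar>"
          by linarith
        then show "norm \<bar>(\<Sum>i=1..N. c i * of_bool (D N y i \<omega>)) / real N - a\<bar> \<le> (\<Sum>i=1..N. \<bar>c i\<bar>) / real N + \<bar>a\<bar>"
          by (simp only: real_norm_def abs_abs)
      qed
    qed (rule A_meas[OF that])
    have AI[simp]: "integrable M (\<lambda>\<omega>. \<bar>A N k j \<omega> - I k j\<bar>)" if "j \<le> m" for N k j
      unfolding A_def using A_int[OF u_unit[OF that]] .
    have dI[simp]: "integrable M (\<lambda>\<omega>. \<bar>d N k \<omega> - u k\<bar>)" if "k \<le> m" for N k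
      unfolding d_def using A_int[OF u_unit[OF that], of "\<lambda>_. 1" N] by simp
    have s1: "integrable M (\<lambda>\<omega>. \<Sum>k\<le>m. \<bar>d N k \<omega> - u k\<bar>)"
        "expectation (\<lambda>\<omega>. \<Sum>k\<le>m. \<bar>d N k \<omega> - u k\<bar>) = (\<Sum>k\<le>m. expectation (\<lambda>\<omega>. \<bar>d N k \<omega> - u k\<bar>))" for N
      by (auto intro!: Bochner_Integration.integrable_sum Bochner_Integration.integral_sum dI)
    have s2: "integrable M (\<lambda>\<omega>. \<Sum>k<m. \<bar>A N k (Suc k) \<omega> - I k (Suc k)\<bar> + \<bar>A N k k \<omega> - I k k\<bar>)" for N
      by (auto intro!: Bochner_Integration.integrable_sum Bochner_Integration.integrable_add AI)
    have s3: "expectation (\<lambda>\<omega>. \<Sum>k<m. \<bar>A N k (Suc k) \<omega> - I k (Suc k)\<bar> + \<bar>A N k k \<omega> - I k k\<bar>)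
        = (\<Sum>k<m. expectation (\<lambda>\<omega>. \<bar>A N k (Suc k) \<omega> - I k (Suc k)\<bar>) + expectation (\<lambda>\<omega>. \<bar>A N k k \<omega> - I k k\<bar>))" for N
      by (subst Bochner_Integration.integral_sum)
        (auto intro!: Bochner_Integration.integrable_add Bochner_Integration.integral_add sum.cong AI)
    show "integrable M (W N)"
      unfolding W_def[abs_def]
      by (intro Bochner_Integration.integrable_add integrable_mult_right s1 s2 dI) auto
    have E: "expectation (W N) = (\<eta> + C * h + 2 * B * Xcut N + B * \<delta> + H)
        + C * (\<Sum>k\<le>m. expectation (\<lambda>\<omega>. \<bar>d N k \<omega> - u k\<bar>)) + B * expectation (\<lambda>\<omega>. \<bar>d N m \<omega> - u m\<bar>)
        + (\<Sum>k<m. expectation (\<lambda>\<omega>. \<bar>A N k (Suc k) \<omega> - I k (Suc k)\<bar>) + expectation (\<lambda>\<omega>. \<bar>A N k k \<omega> - I k k\<bar>))" for N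
      unfolding W_def[abs_def] s1(2)[symmetric] s3[symmetric]
      using s1(1)[of N] s2[of N] dI[of m N]
      by (subst Bochner_Integration.integral_add Bochner_Integration.integral_mult_right
        | intro Bochner_Integration.integrable_add integrable_mult_right | simp add: prob_space del: Bochner_Integration.integral_sum)+
    have tA: "(\<lambda>N. expectation (\<lambda>\<omega>. \<bar>A N k j \<omega> - I k j\<bar>)) \<longlonglongrightarrow> 0" if "k \<le> m" "j \<le> m" for k j
      using conv[OF sec(1,2)[OF that(1)] u_unit[OF that(2)]] unfolding A_def I_def .
    \<comment> \<open>The test function 1 turns \<open>conv\<close> into convergence of the segment
      sizes, because positions are uniform under the limit law.\<close>
    have td: "(\<lambda>N. expectation (\<lambda>\<omega>. \<bar>d N k \<omega> - u k\<bar>)) \<longlonglongrightarrow> 0" if "k \<le> m" for k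
      using conv[OF continuous_on_const[of _ 1] _ u_unit[OF that]] uniform[OF u_unit[OF that]]
      by (simp add: d_def image_constant_conv)
    have "Xcut \<longlonglongrightarrow> Icut"
      using total[OF cut(1,2)] unfolding Xcut_def[abs_def] Icut_def .
    then have "(\<lambda>N. expectation (W N)) \<longlonglongrightarrow> (\<eta> + C * h + 2 * B * Icut + B * \<delta> + H)
        + C * (\<Sum>k\<le>m. 0) + B * 0 + (\<Sum>k<m. 0 + 0)"
      unfolding E by (intro tendsto_intros tA td) auto
    then show "(\<lambda>N. expectation (W N)) \<longlonglongrightarrow> 2 * H" by (simp add: H_def add.assoc)
  qed
  have "\<forall>\<^sub>F N in sequentially. 0 < N \<and> expectation (W N) < \<epsilon>"
    using order_tendstoD(2)[OF EW H] eventually_gt_at_top[of 0] by eventually_elim auto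
  then obtain N0 where N0: "\<And>N. N0 \<le> N \<Longrightarrow> 0 < N \<and> expectation (W N) < \<epsilon>"
    by (auto simp: eventually_sequentially)
  show "\<exists>no. \<forall>N\<ge>no. norm (expectation (\<lambda>\<omega>. \<bar>(\<Sum>i=1..N. f (v N i, Y N i \<omega>)) / real N - (LINT p|L. f p)\<bar>) - 0) < \<epsilon>"
  proof (intro exI allI impI)
    fix N assume "N0 \<le> N"
    then have N: "0 < N" "expectation (W N) < \<epsilon>" using N0 by auto
    have meas: "(\<lambda>\<omega>. \<bar>(\<Sum>i=1..N. f (v N i, Y N i \<omega>)) / real N - (LINT p|L. f p)\<bar>) \<in> borel_measurable M"
      by (intro borel_measurable_abs borel_measurable_diff borel_measurable_divide borel_measurable_sum
          borel_measurable_const f_meas)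
    have "expectation (\<lambda>\<omega>. \<bar>(\<Sum>i=1..N. f (v N i, Y N i \<omega>)) / real N - (LINT p|L. f p)\<bar>) \<le> expectation (W N)"
    proof (rule integral_mono_AE)
      show "integrable M (\<lambda>\<omega>. \<bar>(\<Sum>i=1..N. f (v N i, Y N i \<omega>)) / real N - (LINT p|L. f p)\<bar>)"
        by (rule Bochner_Integration.integrable_bound[OF W_int[of N]])
          (use meas dominated[OF N(1)] in \<open>auto elim!: eventually_mono\<close>)
    qed (use W_int dominated[OF N(1)] in auto)
    then show "norm (expectation (\<lambda>\<omega>. \<bar>(\<Sum>i=1..N. f (v N i, Y N i \<omega>)) / real N - (LINT p|L. f p)\<bar>) - 0) < \<epsilon>"
      using N(2) by simp
  qed
qed

section \<open>Change of variables along an antiderivative\<close>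

text \<open>The antiderivative of a positive density \<open>\<rho>\<close> need not be differentiable everywhere, so the change of
  variables is done on the level of measures.\<close>

locale time_change =
  fixes \<rho> F :: "real \<Rightarrow> real" and a b K :: real
  assumes ab: "a \<le> b"
    and \<rho>_meas: "\<rho> \<in> borel_measurable (lebesgue_on {a..<b})"
    and \<rho>_pos: "\<And>x. x \<in> {a..<b} \<Longrightarrow> 0 < \<rho> x" and \<rho>_le: "\<And>x. x \<in> {a..<b} \<Longrightarrow> \<rho> x \<le> K"
    and F_ge: "\<And>x. x \<in> {a..b} \<Longrightarrow> F a \<le> F x"
    and emeasure_F: "\<And>x. x \<in> {a..b} \<Longrightarrow>
          emeasure (density (lebesgue_on {a..<b}) \<rho>) {a..<x} = ennreal (F x - F a)"
begin

abbreviation "m \<equiv> density (lebesgue_on {a..<b}) \<rho>"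

lemma sets_m: "A \<in> sets borel \<Longrightarrow> A \<subseteq> {a..<b} \<Longrightarrow> A \<in> sets (lebesgue_on {a..<b})"
  by (subst sets_restrict_space_iff) auto

lemma emeasure_m_interval:
  assumes "x \<in> {a..b}" "x' \<in> {a..b}" "x \<le> x'"
  shows "emeasure m {x..<x'} = ennreal (F x' - F x)" and "F x \<le> F x'"
proof -
  have d: "{x..<x'} = {a..<x'} - {a..<x}" using assms by auto
  have sub: "{a..<x} \<subseteq> {a..<x'}" using assms by auto
  have s: "{a..<x} \<in> sets m" "{a..<x'} \<in> sets m" using assms by (auto intro!: sets_m)
  have "emeasure m {a..<x} \<le> emeasure m {a..<x'}" using sub s by (intro emeasure_mono) auto
  then show le: "F x \<le> F x'" using assms F_ge by (simp add: emeasure_F)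
  have "emeasure m ({a..<x'} - {a..<x}) = emeasure m {a..<x'} - emeasure m {a..<x}"
    using s sub assms by (intro emeasure_Diff) (auto simp: emeasure_F)
  then show "emeasure m {x..<x'} = ennreal (F x' - F x)"
    unfolding d using assms F_ge by (simp add: emeasure_F ennreal_minus)
qed

text \<open>The bound on the density controls the measure of an interval by its length; the
  resulting continuity lets the intermediate value theorem identify the image of F.\<close>

lemma F_Lipschitz:
  assumes "x \<in> {a..b}" "x' \<in> {a..b}" "x \<le> x'"
  shows "F x' - F x \<le> K * (x' - x)"
proof (cases "x = x'")
  case False
  then have K: "0 \<le> K" using \<rho>_pos[of x] \<rho>_le[of x] assms by auto
  have "emeasure m {x..<x'} = (\<integral>\<^sup>+z. ennreal (\<rho> z) * indicator {x..<x'} z \<partial>lebesgue_on {a..<b})"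
    using assms \<rho>_meas by (intro emeasure_density) (auto intro!: sets_m)
  also have "\<dots> \<le> (\<integral>\<^sup>+z. ennreal K * indicator {x..<x'} z \<partial>lebesgue_on {a..<b})"
    using \<rho>_le by (intro nn_integral_mono mult_right_mono ennreal_leI) auto
  also have "\<dots> = ennreal K * emeasure (lebesgue_on {a..<b}) {x..<x'}"
    using assms by (intro nn_integral_cmult_indicator) (auto intro!: sets_m)
  also have "emeasure (lebesgue_on {a..<b}) {x..<x'} = ennreal (x' - x)"
    using assms by (subst emeasure_restrict_space) auto
  also have "ennreal K * \<dots> = ennreal (K * (x' - x))"
    using K assms by (simp add: ennreal_mult)
  finally show ?thesis
    using K assms emeasure_m_interval[OF assms] by (simp add: ennreal_le_iff)
qed simp

text \<open>A flat stretch of F would be an interval of \<open>m\<close>-measure 0, hence a Lebesgue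
  null set because \<rho> is positive.\<close>

lemma F_strict_mono: "strict_mono_on {a..b} F"
proof (rule strict_mono_onI)
  fix x x' assume x: "x \<in> {a..b}" "x' \<in> {a..b}" "x < x'"
  have "emeasure m {x..<x'} \<noteq> 0"
  proof
    assume "emeasure m {x..<x'} = 0"
    then have "{x..<x'} \<in> null_sets m" using x by (intro null_setsI) (auto intro!: sets_m)
    then have "AE z in lebesgue_on {a..<b}. z \<in> {x..<x'} \<longrightarrow> ennreal (\<rho> z) = 0"
      using \<rho>_meas by (subst (asm) null_sets_density_iff) auto
    then have "AE z in lebesgue_on {a..<b}. z \<notin> {x..<x'}"
      by (rule AE_mp) (use \<rho>_pos in \<open>fastforce simp: ennreal_eq_0_iff\<close>)
    then have "{x..<x'} \<in> null_sets (lebesgue_on {a..<b})"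
      using x by (subst (asm) AE_iff_null_sets[symmetric]) (auto intro!: sets_m)
    then have "emeasure lebesgue {x..<x'} = 0"
      using x emeasure_restrict_space[of "{a..<b}" lebesgue "{x..<x'}"] by (auto simp: null_sets_def)
    then show False using x by simp
  qed
  then show "F x < F x'" using emeasure_m_interval[of x x'] x by (auto simp: ennreal_eq_0_iff)
qed

lemma F_less_iff: "x \<in> {a..b} \<Longrightarrow> x' \<in> {a..b} \<Longrightarrow> F x < F x' \<longleftrightarrow> x < x'"
  using F_strict_mono by (simp add: strict_mono_on_less)

lemma F_le_iff: "x \<in> {a..b} \<Longrightarrow> x' \<in> {a..b} \<Longrightarrow> F x \<le> F x' \<longleftrightarrow> x \<le> x'"
  using F_less_iff[of x' x] by (auto simp: not_less[symmetric])

lemma F_continuous: "continuous_on {a..b} F"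
proof -
  have "(max K 0)-lipschitz_on {a..b} F"
  proof (rule lipschitz_onI)
    have *: "\<bar>F x - F x'\<bar> \<le> max K 0 * \<bar>x - x'\<bar>" if "x \<in> {a..b}" "x' \<in> {a..b}" "x \<le> x'" for x x'
    proof -
      have "K * (x' - x) \<le> max K 0 * (x' - x)" using that by (intro mult_right_mono) auto
      then show ?thesis using F_Lipschitz[OF that] emeasure_m_interval(2)[OF that] that by simp
    qed
    fix x x' assume "x \<in> {a..b}" "x' \<in> {a..b}"
    then show "dist (F x) (F x') \<le> max K 0 * dist x x'"
      using *[of x x'] *[of x' x] by (cases "x \<le> x'") (auto simp: dist_real_def abs_minus_commute)
  qed simp
  then show ?thesis by (rule lipschitz_on_continuous_on)
qed

lemma F_image: "F ` {a..<b} = {F a..<F b}"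
proof
  show "F ` {a..<b} \<subseteq> {F a..<F b}" using F_less_iff F_le_iff ab by auto
  show "{F a..<F b} \<subseteq> F ` {a..<b}"
  proof
    fix y assume y: "y \<in> {F a..<F b}"
    then obtain x where x: "a \<le> x" "x \<le> b" "F x = y"
      using IVT'[of F a y b] F_continuous ab by auto
    moreover have "x \<noteq> b" using x y by auto
    ultimately show "y \<in> F ` {a..<b}" by auto
  qed
qed

lemma F_inj: "inj_on F {a..b}"
  using F_strict_mono by (rule strict_mono_on_imp_inj_on)

context
  fixes h :: "real \<Rightarrow> real"
  assumes h: "\<And>x. x \<in> {a..<b} \<Longrightarrow> h (F x) = x"
begin

lemma h_bounds: "y \<in> {F a..<F b} \<Longrightarrow> h y \<in> {a..<b} \<and> F (h y) = y"
  using h unfolding F_image[symmetric] by auto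

lemma h_le_iff: "y \<in> {F a..<F b} \<Longrightarrow> x \<in> {a..b} \<Longrightarrow> h y \<le> x \<longleftrightarrow> y \<le> F x"
  using F_le_iff[of "h y" x] h_bounds[of y] by auto

lemma h_vimage_greaterThan:
  "h -` {x<..} \<inter> {F a..<F b} = (if x < a then {F a..<F b} else if x < b then {F x<..<F b} else {})"
proof -
  consider "x < a" | "a \<le> x" "x < b" | "b \<le> x" by linarith
  then show ?thesis
  proof cases
    case 1
    then have "x < h y" if "y \<in> {F a..<F b}" for y using h_bounds[OF that] by auto
    then show ?thesis using 1 by auto
  next
    case 2
    have "y \<in> h -` {x<..} \<inter> {F a..<F b} \<longleftrightarrow> y \<in> {F x<..<F b}" for y
      using h_le_iff[of y x] F_ge[of x] 2 by (auto simp: not_le)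
    then have "h -` {x<..} \<inter> {F a..<F b} = {F x<..<F b}" by (rule set_eqI)
    then show ?thesis using 2 by simp
  next
    case 3
    then have "h y \<le> x" if "y \<in> {F a..<F b}" for y using h_bounds[OF that] by auto
    then have "h -` {x<..} \<inter> {F a..<F b} = {}" by (force simp: not_less[symmetric])
    then show ?thesis using 3 ab by simp
  qed
qed

lemma h_borel[measurable]: "h \<in> borel_measurable (lebesgue_on {F a..<F b})"
proof (rule borel_measurable_iff_greater[THEN iffD2], rule allI)
  fix x
  have "{w \<in> space (lebesgue_on {F a..<F b}). x < h w} = h -` {x<..} \<inter> {F a..<F b}" by auto
  also have "\<dots> \<in> sets (lebesgue_on {F a..<F b})"
    unfolding h_vimage_greaterThan using F_ge[of x]
    by (auto simp: sets_restrict_space_iff)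
  finally show "{w \<in> space (lebesgue_on {F a..<F b}). x < h w} \<in> sets (lebesgue_on {F a..<F b})" .
qed

text \<open>Both sides are determined by their finite values on half-lines. For x in {a..<b} the
  preimage of {x<..} under \<open>h\<close> runs from \<open>F x\<close> to \<open>F b\<close>, and
  its length is the \<open>m\<close>-measure of {x..<b} by the defining property of F.\<close>

lemma distr_h_borel: "distr (lebesgue_on {F a..<F b}) borel h = distr m borel (\<lambda>x. x)"
proof (rule measure_eqI_lessThan)
  have id[measurable]: "(\<lambda>x. x) \<in> m \<rightarrow>\<^sub>M borel"
    by (simp add: measurable_restrict_space1 measurable_completion)
  have Fab: "F a \<le> F b" using F_ge ab by auto
  have "emeasure (distr m borel (\<lambda>x. x)) {x<..}
      = (if x < a then ennreal (F b - F a) else if x < b then ennreal (F b - F x) else 0)" for x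
  proof -
    have "emeasure (distr m borel (\<lambda>x. x)) {x<..} = emeasure m ({x<..} \<inter> {a..<b})"
      by (subst emeasure_distr) auto
    also have "\<dots> = (if x < a then emeasure m {a..<b} else if x < b then emeasure m {x..<b} else 0)"
    proof -
      consider "x < a" | "a \<le> x" "x < b" | "b \<le> x" by linarith
      then show ?thesis
      proof cases
        case 1
        then have "{x<..} \<inter> {a..<b} = {a..<b}" by auto
        then show ?thesis using 1 by simp
      next
        case 2
        \<comment> \<open>The half-line is open at x, while the formula for \<open>m\<close> is for
          intervals closed on the left.\<close>
        have "AE z in lebesgue_on {a..<b}. z \<noteq> x"
          by (subst AE_restrict_space_iff) (auto intro: AE_mp[OF AE_completion[OF AE_lborel_singleton[of x]]])
        then have "AE z in m. z \<noteq> x" using \<rho>_meas by (subst AE_density) (auto elim: eventually_mono)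
        then have "emeasure m ({x<..} \<inter> {a..<b}) = emeasure m {x..<b}"
          using 2 by (intro emeasure_eq_AE) (auto intro!: sets_m elim!: eventually_mono)
        then show ?thesis using 2 by simp
      next
        case 3
        then have "{x<..} \<inter> {a..<b} = {}" by auto
        then show ?thesis using 3 ab by simp
      qed
    qed
    finally show ?thesis using emeasure_m_interval(1)[of a b] emeasure_m_interval(1)[of x b] ab by auto
  qed
  moreover have "emeasure (distr (lebesgue_on {F a..<F b}) borel h) {x<..}
      = (if x < a then ennreal (F b - F a) else if x < b then ennreal (F b - F x) else 0)" for x
  proof -
    have "emeasure (distr (lebesgue_on {F a..<F b}) borel h) {x<..}
        = emeasure lebesgue (h -` {x<..} \<inter> {F a..<F b})"
      by (subst emeasure_distr) (auto simp: emeasure_restrict_space)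
    then show ?thesis unfolding h_vimage_greaterThan using Fab emeasure_m_interval(2)[of x b] by auto
  qed
  ultimately show "emeasure (distr (lebesgue_on {F a..<F b}) borel h) {x<..} = emeasure (distr m borel (\<lambda>x. x)) {x<..}"
      "emeasure (distr (lebesgue_on {F a..<F b}) borel h) {x<..} < \<infinity>" for x
    by auto
qed auto

text \<open>A Lebesgue set is a Borel set up to a subset of a Borel null set \<open>N\<close>. Since
  \<open>m\<close> has a density, \<open>N\<close> is \<open>m\<close>-null on the interval, and by
  the Borel case its preimage under \<open>h\<close> is Lebesgue null; completeness then handles the
  subset. Borel measurability of \<open>h\<close> alone would not permit composition with functions
  that are only Lebesgue measurable.\<close>

lemma h_lebesgue: "h \<in> lebesgue_on {F a..<F b} \<rightarrow>\<^sub>M lebesgue_on {a..<b}"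
  and distr_h: "distr (lebesgue_on {F a..<F b}) (lebesgue_on {a..<b}) h = m"
proof -
  have id[measurable]: "(\<lambda>x. x) \<in> m \<rightarrow>\<^sub>M borel"
    by (simp add: measurable_restrict_space1 measurable_completion)
  have borel_eq: "emeasure lebesgue (h -` A \<inter> {F a..<F b}) = emeasure m (A \<inter> {a..<b})"
    if [measurable]: "A \<in> sets borel" for A
  proof -
    have "emeasure (distr (lebesgue_on {F a..<F b}) borel h) A = emeasure lebesgue (h -` A \<inter> {F a..<F b})"
      by (subst emeasure_distr) (auto simp: emeasure_restrict_space)
    moreover have "emeasure (distr m borel (\<lambda>x. x)) A = emeasure m (A \<inter> {a..<b})"
      by (subst emeasure_distr) auto
    ultimately show ?thesis by (simp add: distr_h_borel)
  qed
  have decomp: "h -` A \<inter> {F a..<F b} \<in> sets lebesgue \<and>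
      emeasure lebesgue (h -` A \<inter> {F a..<F b}) = emeasure m A"
    if A: "A \<in> sets lebesgue" "A \<subseteq> {a..<b}" for A
  proof -
    let ?B = "main_part lborel A" and ?N = "null_part lborel A"
    have AU: "A = ?B \<union> ?N" using main_part_null_part_Un[of A lborel] A by simp
    have B: "?B \<in> sets borel" using main_part_sets[of A lborel] A by simp
    obtain N where N: "N \<in> null_sets lborel" "?N \<subseteq> N" using null_part[of A lborel] A by auto
    have Nb: "N \<in> sets borel" using N by auto
    have mN: "N \<inter> {a..<b} \<in> null_sets m"
    proof -
      have "N \<in> null_sets lebesgue" using N(1) by (rule null_sets_completionI)
      then have "AE z in lebesgue. z \<notin> N" by (rule AE_not_in)
      then have "AE z in lebesgue_on {a..<b}. z \<notin> N" 
        by (subst AE_restrict_space_iff) (auto elim: eventually_mono)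
      then show ?thesis using \<rho>_meas Nb
        by (subst null_sets_density_iff) (auto intro!: sets_m elim: eventually_mono)
    qed
    have hN: "h -` N \<inter> {F a..<F b} \<in> null_sets lebesgue"
    proof -
      have "h -` N \<inter> {F a..<F b} \<in> sets (lebesgue_on {F a..<F b})"
        using measurable_sets[OF h_borel Nb] by simp
      then show ?thesis using borel_eq[OF Nb] mN by (auto simp: null_sets_def sets_restrict_space_iff)
    qed
    have hN': "h -` ?N \<inter> {F a..<F b} \<in> null_sets lebesgue"
      by (rule null_sets_completion_subset[OF _ hN]) (use N in auto)
    have hB: "h -` ?B \<inter> {F a..<F b} \<in> sets lebesgue"
      using measurable_sets[OF h_borel B] by (simp add: sets_restrict_space_iff)
    have hA: "h -` A \<inter> {F a..<F b} = (h -` ?B \<inter> {F a..<F b}) \<union> (h -` ?N \<inter> {F a..<F b})"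
      using AU by auto
    have "emeasure lebesgue (h -` A \<inter> {F a..<F b}) = emeasure m (?B \<inter> {a..<b})"
      unfolding hA using emeasure_Un_null_set[OF hB hN'] borel_eq[OF B] by simp
    also have "\<dots> = emeasure m A"
    proof (rule emeasure_eq_AE)
      show "AE x in m. (x \<in> ?B \<inter> {a..<b}) = (x \<in> A)"
        using AE_not_in[OF mN] by (rule AE_mp, intro AE_I2 impI) (use AU N(2) A(2) in blast)
      show "?B \<inter> {a..<b} \<in> sets m" using B by (auto intro!: sets_m)
      show "A \<in> sets m" using A by (simp add: sets_restrict_space_iff)
    qed
    finally show ?thesis unfolding hA using hB hN' by auto
  qed
  show meas: "h \<in> lebesgue_on {F a..<F b} \<rightarrow>\<^sub>M lebesgue_on {a..<b}"
    by (rule measurableI) (use decomp h_bounds in \<open>auto simp: sets_restrict_space_iff\<close>)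
  show "distr (lebesgue_on {F a..<F b}) (lebesgue_on {a..<b}) h = m"
  proof (rule measure_eqI)
    fix A assume "A \<in> sets (distr (lebesgue_on {F a..<F b}) (lebesgue_on {a..<b}) h)"
    then have A: "A \<in> sets (lebesgue_on {a..<b})" by simp
    then have "A \<in> sets lebesgue" "A \<subseteq> {a..<b}" by (auto simp: sets_restrict_space_iff)
    then show "emeasure (distr (lebesgue_on {F a..<F b}) (lebesgue_on {a..<b}) h) A = emeasure m A"
      using decomp[of A] A meas by (subst emeasure_distr) (auto simp: emeasure_restrict_space)
  qed simp
qed

end
end

section \<open>The limit distribution\<close>

lemma integral_lebesgue_on_subset:
  fixes f :: "real \<Rightarrow> real"
  assumes "S \<in> sets lebesgue" "T \<in> sets lebesgue" "S \<subseteq> T"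
  shows "(LINT z|lebesgue_on S. f z) = (LINT z|lebesgue_on T. indicator S z * f z)"
proof -
  have "(LINT z|lebesgue. indicator S z * f z) = (LINT z|lebesgue. indicator T z * (indicator S z * f z))"
    by (rule Bochner_Integration.integral_cong) (use assms(3) in \<open>auto simp: indicator_def\<close>)
  then show ?thesis using assms(1,2) by (simp add: integral_restrict_space)
qed

lemma nn_integral_lebesgue_on:
  fixes f :: "real \<Rightarrow> ennreal"
  assumes "S \<in> sets borel" "f \<in> borel_measurable borel"
  shows "(\<integral>\<^sup>+z. f z \<partial>lebesgue_on S) = (\<integral>\<^sup>+z. f z * indicator S z \<partial>lborel)"
proof -
  have "(\<integral>\<^sup>+z. f z \<partial>lebesgue_on S) = (\<integral>\<^sup>+z. f z * indicator S z \<partial>lebesgue)"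
    using assms by (intro nn_integral_restrict_space) auto
  also have "\<dots> = (\<integral>\<^sup>+z. f z * indicator S z \<partial>lborel)"
    by (rule nn_integral_completion)
  finally show ?thesis .
qed

lemma integral_lebesgue_on_borel:
  fixes f :: "real \<Rightarrow> real"
  assumes "S \<in> sets borel" "f \<in> borel_measurable borel"
  shows "(LINT z|lebesgue_on S. f z) = (LINT z|lborel. indicator S z * f z)"
proof -
  have "(LINT z|lebesgue_on S. f z) = (LINT z|lebesgue. indicator S z * f z)"
    using assms by (subst integral_restrict_space) auto
  also have "\<dots> = (LINT z|lborel. indicator S z * f z)"
    by (rule integral_completion) (use assms in measurable)
  finally show ?thesis .
qed

text \<open>The antiderivative -exp(-(v*a)) involves no division by v, so v = 0 is included. The
  value is the probability that a particle of rate v jumps within time s.\<close>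

lemma has_bochner_integral_size_biased_exp:
  fixes v s :: real
  assumes "0 \<le> v" "0 \<le> s"
  shows "has_bochner_integral lborel (\<lambda>a. indicator {0..<s} a * (v * exp (- (v * a)))) (1 - exp (- (v * s)))"
    and "(\<integral>\<^sup>+a. ennreal (v * exp (- (v * a))) * indicator {0..<s} a \<partial>lborel) = ennreal (1 - exp (- (v * s)))"
proof -
  have "has_bochner_integral lborel (\<lambda>a. (v * exp (- (v * a))) * indicator {0..s} a)
      ((- exp (- (v * s))) - (- exp (- (v * 0))))"
    by (rule has_bochner_integral_FTC_Icc_nonneg) (use assms in \<open>auto intro!: derivative_eq_intros\<close>)
  then have "has_bochner_integral lborel (\<lambda>a. (v * exp (- (v * a))) * indicator {0..s} a) (1 - exp (- (v * s)))"
    by simp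
  also have "?this \<longleftrightarrow> has_bochner_integral lborel (\<lambda>a. indicator {0..<s} a * (v * exp (- (v * a)))) (1 - exp (- (v * s)))"
  proof (rule has_bochner_integral_cong_AE)
    show "AE a in lborel. v * exp (- (v * a)) * indicator {0..s} a = indicator {0..<s} a * (v * exp (- (v * a)))"
      using AE_lborel_singleton[of s] by eventually_elim (auto simp: indicator_def)
  qed measurable
  finally show *: "has_bochner_integral lborel (\<lambda>a. indicator {0..<s} a * (v * exp (- (v * a)))) (1 - exp (- (v * s)))" .
  have "(\<integral>\<^sup>+a. ennreal (v * exp (- (v * a))) * indicator {0..<s} a \<partial>lborel)
      = (\<integral>\<^sup>+a. ennreal (indicator {0..<s} a * (v * exp (- (v * a)))) \<partial>lborel)"
    by (rule nn_integral_cong) (auto simp: indicator_def)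
  also have "\<dots> = ennreal (1 - exp (- (v * s)))"
    using * assms by (subst nn_integral_eq_integral)
      (auto simp: has_bochner_integral_iff indicator_def)
  finally show "(\<integral>\<^sup>+a. ennreal (v * exp (- (v * a))) * indicator {0..<s} a \<partial>lborel) = ennreal (1 - exp (- (v * s)))" .
qed

section \<open>Measurable kernels on the half-line\<close>

lemma id_borel_nonneg[measurable]: "(\<lambda>v. v) \<in> borel_nonneg \<rightarrow>\<^sub>M borel"
  by (simp add: measurable_restrict_space1)

text \<open>Provides a generator stable under intersection, on which measurability of a kernel may
  be checked.\<close>

lemma sets_borel_nonneg_eq: "sets borel_nonneg = sigma_sets {0..} (range (\<lambda>x. {0..x}))"
proof -
  have "sets borel_nonneg = (\<inter>) {0..} ` sigma_sets UNIV (range (\<lambda>x::real. {..x}))"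
    by (subst borel_eq_atMost) (simp add: sets_restrict_space sets_measure_of)
  also have "\<dots> = sigma_sets {0..} ((\<inter>) {0..} ` range (\<lambda>x::real. {..x}))"
  proof (rule sigma_sets_Int)
    have "{0::real..} \<in> sets (sigma UNIV (range (\<lambda>x. {..x})))"
      by (subst borel_eq_atMost[symmetric]) simp
    then show "{0..} \<in> sigma_sets UNIV (range (\<lambda>x::real. {..x}))" by (simp add: sets_measure_of)
  qed simp
  also have "(\<inter>) {0..} ` range (\<lambda>x::real. {..x}) = range (\<lambda>x. {0..x})"
    by (auto simp: image_image)
  finally show ?thesis .
qed

text \<open>Measurability is given only for integrals of bounded continuous functions; dominated
  convergence reaches the indicator of {0..x} through continuous ramps.\<close>

lemma kernel_borel_nonnegI:
  fixes \<kappa> :: "'b \<Rightarrow> real measure"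
  assumes prob: "\<And>y. y \<in> space N \<Longrightarrow> prob_space (\<kappa> y) \<and> sets (\<kappa> y) = sets borel_nonneg"
    and meas: "\<And>g :: real \<Rightarrow> real. continuous_on {0..} g \<Longrightarrow> bounded (g ` {0..}) \<Longrightarrow>
         (\<lambda>y. LINT v|\<kappa> y. g v) \<in> borel_measurable N"
  shows "\<kappa> \<in> N \<rightarrow>\<^sub>M subprob_algebra borel_nonneg"
proof (rule measurable_subprob_algebra_generated[OF sets_borel_nonneg_eq])
  have "{0..x} \<inter> {0..x'} = {0..min x x'}" for x x' :: real by auto
  then show "Int_stable (range (\<lambda>x::real. {0..x}))" by (auto simp: Int_stable_def)
  have sp: "space (\<kappa> y) = {0..}" if "y \<in> space N" for y
    using prob[OF that] by (auto dest: sets_eq_imp_space_eq)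
  have "emeasure (\<kappa> y) {0..} = 1" if "y \<in> space N" for y
    using prob_space.emeasure_space_1[of "\<kappa> y"] prob[OF that] sp[OF that] by simp
  then show "(\<lambda>y. emeasure (\<kappa> y) {0..}) \<in> borel_measurable N"
    by (subst measurable_cong[of _ _ "\<lambda>_. 1"]) auto
  fix A assume "A \<in> range (\<lambda>x::real. {0..x})"
  then obtain x where A: "A = {0..x}" by auto
  \<comment> \<open>For n > 0 the ramp is 1 up to x and falls to 0 at x + 1 / n.\<close>
  define g where "g n v = min 1 (max 0 (1 - real n * (v - x)))" for n :: nat and v :: real
  have g01: "\<bar>g n v\<bar> \<le> 1" for n v by (auto simp: g_def)
  have g_cont: "continuous_on {0..} (g n)" and g_bdd: "bounded (g n ` {0..})" for n
    using g01 unfolding g_def by (auto intro!: continuous_intros boundedI[of _ 1])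
  have lim: "(\<lambda>n. g n v) \<longlonglongrightarrow> indicator {..x} v" for v
  proof (cases "v \<le> x")
    case True
    have "g n v = 1" for n
    proof -
      have "real n * (v - x) \<le> 0" using True by (simp add: mult_nonneg_nonpos)
      then show ?thesis unfolding g_def by linarith
    qed
    then show ?thesis using True by simp
  next
    case False
    obtain m :: nat where m: "1 / (v - x) < m" using reals_Archimedean2 by blast
    have "g n v = 0" if "m \<le> n" for n
    proof -
      have "1 / (v - x) < n" using m that by linarith
      then show ?thesis using False by (simp add: g_def field_simps)
    qed
    then have "\<forall>\<^sub>F n in sequentially. g n v = 0" by (rule eventually_sequentiallyI)
    then show ?thesis using False by (simp add: tendsto_eventually)
  qed
  have "(\<lambda>n. LINT v|\<kappa> y. g n v) \<longlonglongrightarrow> measure (\<kappa> y) {0..x}" if y: "y \<in> space N" for y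
  proof -
    interpret \<kappa>: prob_space "\<kappa> y" using prob[OF y] by simp
    have [measurable_cong]: "sets (\<kappa> y) = sets borel_nonneg" using prob[OF y] by simp
    have [measurable]: "g n \<in> borel_measurable (\<kappa> y)" for n unfolding g_def by measurable
    have [measurable]: "indicator {..x} \<in> borel_measurable (\<kappa> y)" by measurable
    have "(\<lambda>n. LINT v|\<kappa> y. g n v) \<longlonglongrightarrow> (LINT v|\<kappa> y. indicator {..x} v)"
      by (rule integral_dominated_convergence[where w="\<lambda>_. 1"]) (use lim g01 in auto)
    also have "(LINT v|\<kappa> y. indicator {..x} v) = (LINT v|\<kappa> y. indicator {0..x} v)"
      by (rule Bochner_Integration.integral_cong) (use sp[OF y] in \<open>auto simp: indicator_def\<close>)
    also have "\<dots> = measure (\<kappa> y) {0..x}"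
      using sp[OF y] by (simp add: Int_absorb2)
    finally show ?thesis .
  qed
  then have "(\<lambda>y. measure (\<kappa> y) {0..x}) \<in> borel_measurable N"
    by (rule borel_measurable_LIMSEQ_real) (assumption, rule meas[OF g_cont g_bdd])
  then have "(\<lambda>y. ennreal (measure (\<kappa> y) {0..x})) \<in> borel_measurable N" by simp
  also have "?this \<longleftrightarrow> (\<lambda>y. emeasure (\<kappa> y) A) \<in> borel_measurable N"
    unfolding A
    by (rule measurable_cong) (use prob in \<open>auto simp: finite_measure.emeasure_eq_measure prob_space.finite_measure\<close>)
  finally show "(\<lambda>y. emeasure (\<kappa> y) A) \<in> borel_measurable N" .
qed (use prob in \<open>auto simp: prob_space_imp_subprob_space\<close>)

lemma prob_space_density:
  fixes f :: "'b \<Rightarrow> real"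
  assumes "integrable N f" "AE x in N. 0 \<le> f x" "(LINT x|N. f x) = c" "0 < c"
  shows "prob_space (density N (\<lambda>x. ennreal (f x / c)))"
proof
  have "emeasure (density N (\<lambda>x. ennreal (f x / c))) (space N) = (\<integral>\<^sup>+x. ennreal (f x / c) \<partial>N)"
    using assms by (subst emeasure_density) (auto intro!: nn_integral_cong)
  also have "\<dots> = ennreal (LINT x|N. f x / c)"
    using assms by (intro nn_integral_eq_integral) (auto elim: eventually_mono)
  finally show "emeasure (density N (\<lambda>x. ennreal (f x / c))) (space (density N (\<lambda>x. ennreal (f x / c)))) = 1"
    using assms by simp
qed

lemma size_biased_le:
  fixes v a :: real
  assumes "0 \<le> v" "0 \<le> a" shows "v * exp (- (v * a)) \<le> v"
  using assms by (intro mult_left_le) auto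

lemma prob_space_lebesgue_on_unit: "prob_space (lebesgue_on {0..<1::real})"
  by (rule prob_spaceI) (simp add: emeasure_restrict_space)

section \<open>The mixture of the rates and the densities of the two time changes\<close>

locale initial_kernel =
  fixes \<mu>0 :: "real \<Rightarrow> real measure"
  assumes kernel: "\<And>y. y \<in> {0..<1} \<Longrightarrow> prob_space (\<mu>0 y) \<and> sets (\<mu>0 y) = sets borel_nonneg"
    and kernel_measurable:
      "\<And>g :: real \<Rightarrow> real. continuous_on {0..} g \<Longrightarrow> bounded (g ` {0..}) \<Longrightarrow>
         (\<lambda>y. LINT v|\<mu>0 y. g v) \<in> borel_measurable (lebesgue_on {0..<1})"
    and finite_mean: "(\<integral>\<^sup>+ v. ennreal v \<partial>rate_dist \<mu>0) < \<infinity>"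
    and no_zero_rate: "emeasure (rate_dist \<mu>0) {0} = 0"
begin

abbreviation "U \<equiv> lebesgue_on {0..<1::real}"
abbreviation "\<Lambda> \<equiv> rate_dist \<mu>0"

sublocale U: prob_space U by (rule prob_space_lebesgue_on_unit)

lemma \<mu>0_kernel[measurable]: "\<mu>0 \<in> U \<rightarrow>\<^sub>M subprob_algebra borel_nonneg"
  by (rule kernel_borel_nonnegI) (use kernel kernel_measurable in auto)

lemma sets_\<Lambda>[simp, measurable_cong]: "sets \<Lambda> = sets borel_nonneg"
  unfolding rate_dist_def by (rule sets_bind[OF sets_kernel[OF \<mu>0_kernel]]) auto

lemma space_\<Lambda>[simp]: "space \<Lambda> = {0..}"
  using sets_eq_imp_space_eq[OF sets_\<Lambda>] by simp

sublocale \<Lambda>: prob_space \<Lambda>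
  unfolding rate_dist_def by (rule U.prob_space_bind[OF _ \<mu>0_kernel]) (use kernel in auto)

lemma prob_\<Lambda>[simp]: "\<Lambda>.prob {0..} = 1"
  using \<Lambda>.prob_space by simp

lemma \<mu>0_measurableI: "z \<in> {0..<1} \<Longrightarrow> (g :: real \<Rightarrow> real) \<in> borel_measurable borel_nonneg \<Longrightarrow> g \<in> borel_measurable (\<mu>0 z)"
  using kernel[of z] measurable_cong_sets[of "\<mu>0 z" borel_nonneg borel borel] by blast

lemma space_\<mu>0: "y \<in> {0..<1} \<Longrightarrow> space (\<mu>0 y) = {0..}"
  using kernel[of y] by (auto dest: sets_eq_imp_space_eq)

lemma integral_\<Lambda>:
  fixes g :: "real \<Rightarrow> real"
  assumes "g \<in> borel_measurable borel_nonneg" "\<And>v. 0 \<le> v \<Longrightarrow> \<bar>g v\<bar> \<le> B"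
  shows "(LINT v|\<Lambda>. g v) = (LINT z|U. LINT v|\<mu>0 z. g v)"
  unfolding rate_dist_def
proof (rule integral_bind[OF assms(1) _ \<mu>0_kernel, where B'=1])
  show "finite_measure U" by unfold_locales
  show "AE z in U. emeasure (\<mu>0 z) (space (\<mu>0 z)) \<le> ennreal 1"
    using kernel by (auto simp: prob_space.emeasure_space_1)
qed (use assms in auto)

lemma integral_\<mu>0_measurable:
  fixes g :: "real \<Rightarrow> real"
  assumes [measurable]: "g \<in> borel_measurable borel_nonneg"
  shows "(\<lambda>z. LINT v|\<mu>0 z. g v) \<in> borel_measurable U"
  using measurable_compose[OF \<mu>0_kernel integral_measurable_subprob_algebra[OF assms]] .

lemma AE_\<Lambda>_pos: "AE v in \<Lambda>. 0 < v"
proof -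
  have "{0} \<in> null_sets \<Lambda>"
    using no_zero_rate by (auto intro!: null_setsI simp: sets_restrict_space_iff)
  then have "AE v in \<Lambda>. v \<notin> {0}" by (rule AE_not_in)
  then show ?thesis by (rule AE_mp) (auto intro!: AE_I2)
qed

lemma integrable_\<Lambda>_id[simp]: "integrable \<Lambda> (\<lambda>v. v)"
proof (rule integrableI_bounded)
  have "(\<integral>\<^sup>+ v. ennreal (norm v) \<partial>\<Lambda>) = (\<integral>\<^sup>+ v. ennreal v \<partial>\<Lambda>)"
    by (rule nn_integral_cong) auto
  then show "(\<integral>\<^sup>+ v. ennreal (norm v) \<partial>\<Lambda>) < \<infinity>" using finite_mean by simp
qed simp

lemma integrable_\<Lambda>_size_biased[simp]:
  assumes "0 \<le> a" shows "integrable \<Lambda> (\<lambda>v. v * exp (- (v * a)))"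
proof (rule Bochner_Integration.integrable_bound[OF integrable_\<Lambda>_id])
  show "AE v in \<Lambda>. norm (v * exp (- (v * a))) \<le> norm v"
    using assms by (intro AE_I2) (auto simp: abs_mult size_biased_le)
qed simp

lemma integrable_\<Lambda>_exp[simp]:
  assumes "0 \<le> a" shows "integrable \<Lambda> (\<lambda>v. exp (- (v * a)))"
  by (rule \<Lambda>.integrable_const_bound[where B=1]) (use assms in auto)

text \<open>Formally the derivative of \<open>y_C\<close>, and at a = \<open>t_0 \<mu>0 y\<close>
  the normalising constant of the lower branch of \<open>limit_density\<close>.\<close>

definition \<rho>1 :: "real \<Rightarrow> real" where "\<rho>1 a = (LINT v|\<Lambda>. v * exp (- (v * a)))"

text \<open>Formally the derivative of \<open>y_C2\<close> in the position, and the normalising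
  constant of the upper branch of \<open>limit_density\<close>.\<close>

definition \<rho>2 :: "real \<Rightarrow> real \<Rightarrow> real" where "\<rho>2 t z = (LINT v|\<mu>0 z. exp (- (v * t)))"

text \<open>The integrand vanishes only at v = 0, which \<Lambda> does not charge.\<close>

lemma \<rho>1_pos:
  assumes "0 \<le> a" shows "0 < \<rho>1 a"
proof -
  have "AE v in \<Lambda>. 0 \<le> v * exp (- (v * a))" by (intro AE_I2) simp
  then have "0 \<le> \<rho>1 a" unfolding \<rho>1_def by (rule integral_nonneg_AE)
  moreover have "\<rho>1 a \<noteq> 0"
  proof
    assume "\<rho>1 a = 0"
    then have "AE v in \<Lambda>. v * exp (- (v * a)) = 0"
      unfolding \<rho>1_def using integrable_\<Lambda>_size_biased[OF assms]
      by (subst (asm) integral_nonneg_eq_0_iff_AE) auto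
    with AE_\<Lambda>_pos have "AE v in \<Lambda>. False" by eventually_elim auto
    then show False using \<Lambda>.AE_False by simp
  qed
  ultimately show ?thesis by simp
qed

lemma \<rho>1_le: "0 \<le> a \<Longrightarrow> \<rho>1 a \<le> (LINT v|\<Lambda>. v)"
  unfolding \<rho>1_def by (intro integral_mono) (auto simp: size_biased_le)

lemma \<rho>2_bounds:
  assumes z: "z \<in> {0..<1}" and t: "0 \<le> t"
  shows "0 < \<rho>2 t z" "\<rho>2 t z \<le> 1" "integrable (\<mu>0 z) (\<lambda>v. exp (- (v * t)))"
proof -
  interpret \<mu>: prob_space "\<mu>0 z" using kernel[OF z] by simp
  have [measurable]: "(\<lambda>v. exp (- (v * t))) \<in> borel_measurable (\<mu>0 z)"
    by (rule \<mu>0_measurableI[OF z]) measurable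
  show int: "integrable (\<mu>0 z) (\<lambda>v. exp (- (v * t)))"
    by (rule \<mu>.integrable_const_bound[where B=1]) (use t space_\<mu>0[OF z] in auto)
  show "\<rho>2 t z \<le> 1" unfolding \<rho>2_def
    by (rule \<mu>.integral_le_const[OF int]) (use t space_\<mu>0[OF z] in auto)
  have "0 \<le> \<rho>2 t z" unfolding \<rho>2_def by simp
  moreover have "\<rho>2 t z \<noteq> 0"
  proof
    assume "\<rho>2 t z = 0"
    then have "AE v in \<mu>0 z. exp (- (v * t)) = 0"
      unfolding \<rho>2_def using int by (subst (asm) integral_nonneg_eq_0_iff_AE) auto
    then have "AE v in \<mu>0 z. False" by eventually_elim auto
    then show False using \<mu>.AE_False by simp
  qed
  ultimately show "0 < \<rho>2 t z" by simp
qed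

text \<open>Allows joint measurability to be proved on the whole plane, although \<Lambda> lives on
  the half-line.\<close>

lemma measurable_borel_\<Lambda>:
  fixes f :: "real \<times> real \<Rightarrow> 'c :: topological_space"
  assumes "f \<in> borel_measurable (borel \<Otimes>\<^sub>M borel)"
  shows "f \<in> borel_measurable (borel \<Otimes>\<^sub>M \<Lambda>)"
proof -
  have "(\<lambda>v. v) \<in> \<Lambda> \<rightarrow>\<^sub>M borel"
    using id_borel_nonneg unfolding measurable_cong_sets[OF sets_\<Lambda> refl] .
  then have "(\<lambda>p. (fst p, snd p)) \<in> borel \<Otimes>\<^sub>M \<Lambda> \<rightarrow>\<^sub>M (borel \<Otimes>\<^sub>M borel :: (real \<times> real) measure)"
    by (intro measurable_Pair measurable_fst measurable_compose[OF measurable_snd])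
  from measurable_compose[OF this assms] show ?thesis by simp
qed

lemma \<rho>1_borel[measurable]: "\<rho>1 \<in> borel_measurable borel"
proof -
  have "(\<lambda>(a, v). v * exp (- (v * a))) \<in> borel_measurable (borel \<Otimes>\<^sub>M (borel :: real measure))"
    by measurable
  from \<Lambda>.borel_measurable_lebesgue_integral[OF measurable_borel_\<Lambda>[OF this]]
  show ?thesis unfolding \<rho>1_def[abs_def] by simp
qed

lemma \<rho>2_borel[measurable]: "\<rho>2 t \<in> borel_measurable U"
  unfolding \<rho>2_def[abs_def] by (rule integral_\<mu>0_measurable) measurable

lemma y_C_0: "y_C \<mu>0 0 = 0"
  by (simp add: y_C_def \<Lambda>.prob_space)

lemma y_C_eq: "0 \<le> x \<Longrightarrow> y_C \<mu>0 x = (LINT v|\<Lambda>. 1 - exp (- (v * x)))"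
  by (simp add: y_C_def \<Lambda>.prob_space)

lemma y_C2_0: "0 \<le> t \<Longrightarrow> y_C2 \<mu>0 0 t = y_C \<mu>0 t"
  using integral_\<Lambda>[of "\<lambda>v. exp (- (v * t))" 1] by (simp add: y_C_def y_C2_def)

lemma y_C2_1: "y_C2 \<mu>0 1 t = 1"
  by (simp add: y_C2_def)


section \<open>\<open>y_C\<close> and \<open>y_C2\<close> as time changes, and their
  inverses\<close>

text \<open>By Tonelli, integrating \<open>\<rho>1\<close> from 0 to x moves the integral of v *
  exp(-(v*a)) over a inside, where it equals 1 - exp(-(v*x)); averaging over \<Lambda> gives
  \<open>y_C\<close>. The finite mean serves as the bound on the density.\<close>

lemma time_change_y_C:
  assumes t: "0 \<le> t"
  shows "time_change \<rho>1 (y_C \<mu>0) 0 t (LINT v|\<Lambda>. v)"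
proof
  show "0 \<le> t" by (rule t)
  show meas: "\<rho>1 \<in> borel_measurable (lebesgue_on {0..<t})"
    by (intro measurable_restrict_space1 measurable_completion) simp
  show "0 < \<rho>1 x" "\<rho>1 x \<le> (LINT v|\<Lambda>. v)" if "x \<in> {0..<t}" for x
    using \<rho>1_pos \<rho>1_le that by auto
  fix x assume "x \<in> {0..t}"
  then have x: "0 \<le> x" "x \<le> t" by auto
  have int: "integrable \<Lambda> (\<lambda>v. 1 - exp (- (v * x)))" using x by simp
  show "y_C \<mu>0 0 \<le> y_C \<mu>0 x"
    unfolding y_C_0 y_C_eq[OF x(1)] using x by (intro integral_nonneg_AE) auto
  have pair[measurable]: "(\<lambda>(a, v). ennreal (v * exp (- (v * a))) * indicator {0..<x} a) \<in> borel_measurable (lborel \<Otimes>\<^sub>M \<Lambda>)"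
  proof -
    have "(\<lambda>(a, v). ennreal (v * exp (- (v * a))) * indicator {0..<x} a) \<in> borel_measurable (borel \<Otimes>\<^sub>M (borel :: real measure))"
      by measurable
    from measurable_borel_\<Lambda>[OF this] show ?thesis
      by (simp cong: measurable_cong_sets sets_pair_measure_cong)
  qed
  interpret P: pair_sigma_finite lborel \<Lambda> by unfold_locales
  have "emeasure (density (lebesgue_on {0..<t}) \<rho>1) {0..<x} = (\<integral>\<^sup>+a. ennreal (\<rho>1 a) * indicator {0..<x} a \<partial>lebesgue_on {0..<t})"
    using meas x by (intro emeasure_density) (auto simp: sets_restrict_space_iff)
  also have "\<dots> = (\<integral>\<^sup>+a. (ennreal (\<rho>1 a) * indicator {0..<x} a) * indicator {0..<t} a \<partial>lborel)"
    by (rule nn_integral_lebesgue_on) auto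
  also have "\<dots> = (\<integral>\<^sup>+a. (\<integral>\<^sup>+v. ennreal (v * exp (- (v * a))) * indicator {0..<x} a \<partial>\<Lambda>) \<partial>lborel)"
  proof (rule nn_integral_cong)
    fix a :: real
    show "(ennreal (\<rho>1 a) * indicator {0..<x} a) * indicator {0..<t} a
        = (\<integral>\<^sup>+v. ennreal (v * exp (- (v * a))) * indicator {0..<x} a \<partial>\<Lambda>)"
    proof (cases "a \<in> {0..<x}")
      case True
      then have "ennreal (\<rho>1 a) = (\<integral>\<^sup>+v. ennreal (v * exp (- (v * a))) \<partial>\<Lambda>)"
        unfolding \<rho>1_def by (intro nn_integral_eq_integral[symmetric]) auto
      then show ?thesis using True x by simp
    qed auto
  qed
  also have "\<dots> = (\<integral>\<^sup>+v. (\<integral>\<^sup>+a. ennreal (v * exp (- (v * a))) * indicator {0..<x} a \<partial>lborel) \<partial>\<Lambda>)"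
    using P.Fubini'[OF pair] by simp
  also have "\<dots> = (\<integral>\<^sup>+v. ennreal (1 - exp (- (v * x))) \<partial>\<Lambda>)"
    using x by (intro nn_integral_cong has_bochner_integral_size_biased_exp) auto
  also have "\<dots> = ennreal (y_C \<mu>0 x - y_C \<mu>0 0)"
    unfolding y_C_0 y_C_eq[OF x(1)] using x int by (subst nn_integral_eq_integral) auto
  finally show "emeasure (density (lebesgue_on {0..<t}) \<rho>1) {0..<x} = ennreal (y_C \<mu>0 x - y_C \<mu>0 0)" .
qed

lemma restrict_U: "0 \<le> a \<Longrightarrow> b \<le> 1 \<Longrightarrow> restrict_space U {a..<b} = lebesgue_on {a..<b}"
  by (subst restrict_restrict_space) (auto intro!: arg_cong[where f="restrict_space lebesgue"])

text \<open>The integral defining \<open>y_C2\<close> runs from the position up to 1, so its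
  increments are integrals of \<open>\<rho>2\<close>. The end b may lie below 1, because a segment
  that stops at the initial position z needs the change of variables on {0..<z}.\<close>

lemma time_change_y_C2:
  assumes t: "0 \<le> t" and b: "b \<in> {0..1}"
  shows "time_change (\<rho>2 t) (\<lambda>z. y_C2 \<mu>0 z t) 0 b 1"
proof
  show "0 \<le> b" using b by simp
  show meas: "\<rho>2 t \<in> borel_measurable (lebesgue_on {0..<b})"
    unfolding restrict_U[of 0 b, symmetric, OF order_refl atLeastAtMost_iff[THEN iffD1, THEN conjunct2, OF b]]
    by (rule measurable_restrict_space1) simp
  show "0 < \<rho>2 t x" "\<rho>2 t x \<le> 1" if "x \<in> {0..<b}" for x
    using \<rho>2_bounds[of x t] that b t by auto
  fix x assume "x \<in> {0..b}"
  then have x: "0 \<le> x" "x \<le> b" "b \<le> 1" using b by auto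
  have int: "integrable U (\<lambda>z. indicator S z * \<rho>2 t z)" if [measurable]: "S \<in> sets U" for S
    by (rule U.integrable_const_bound[where B=1])
      (use \<rho>2_bounds(1,2)[OF _ t] in \<open>auto intro!: AE_I2 simp: indicator_def less_imp_le\<close>)
  have S: "{a..<c} \<in> sets U" if "0 \<le> a" "c \<le> 1" for a c
    using that by (subst sets_restrict_space_iff) auto
  have eq: "y_C2 \<mu>0 x t - y_C2 \<mu>0 0 t = (LINT z|U. indicator {0..<x} z * \<rho>2 t z)"
  proof -
    have "y_C2 \<mu>0 x t - y_C2 \<mu>0 0 t = (LINT z|lebesgue_on {0..<1}. \<rho>2 t z) - (LINT z|lebesgue_on {x..<1}. \<rho>2 t z)"
      by (simp add: y_C2_def \<rho>2_def)
    also have "(LINT z|lebesgue_on {x..<1}. \<rho>2 t z) = (LINT z|U. indicator {x..<1} z * \<rho>2 t z)"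
      using x by (intro integral_lebesgue_on_subset) auto
    also have "(LINT z|lebesgue_on {0..<1}. \<rho>2 t z) = (LINT z|U. indicator {0..<x} z * \<rho>2 t z + indicator {x..<1} z * \<rho>2 t z)"
      by (rule Bochner_Integration.integral_cong) (use x in \<open>auto simp: indicator_def\<close>)
    also have "\<dots> = (LINT z|U. indicator {0..<x} z * \<rho>2 t z) + (LINT z|U. indicator {x..<1} z * \<rho>2 t z)"
      using x by (intro Bochner_Integration.integral_add int S) auto
    finally show ?thesis by simp
  qed
  have nonneg: "AE z in U. 0 \<le> indicator {0..<x} z * \<rho>2 t z"
    using \<rho>2_bounds(1)[OF _ t] by (intro AE_I2) (auto simp: indicator_def less_imp_le)
  then show "y_C2 \<mu>0 0 t \<le> y_C2 \<mu>0 x t" using integral_nonneg_AE[OF nonneg] eq by simp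
  have "emeasure (density (lebesgue_on {0..<b}) (\<rho>2 t)) {0..<x} = (\<integral>\<^sup>+a. ennreal (\<rho>2 t a) * indicator {0..<x} a \<partial>lebesgue_on {0..<b})"
    using meas x by (intro emeasure_density) (auto simp: sets_restrict_space_iff)
  also have "\<dots> = (\<integral>\<^sup>+a. ennreal (\<rho>2 t a) * indicator {0..<x} a * indicator {0..<b} a \<partial>U)"
    using S[of 0 b] x by (subst restrict_U[symmetric]) (auto intro!: nn_integral_restrict_space simp: Int_absorb2)
  also have "\<dots> = (\<integral>\<^sup>+a. ennreal (indicator {0..<x} a * \<rho>2 t a) \<partial>U)"
    using x by (intro nn_integral_cong) (auto simp: indicator_def)
  also have "\<dots> = ennreal (LINT z|U. indicator {0..<x} z * \<rho>2 t z)"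
    using x by (intro nn_integral_eq_integral int S nonneg) auto
  finally show "emeasure (density (lebesgue_on {0..<b}) (\<rho>2 t)) {0..<x} = ennreal (y_C2 \<mu>0 x t - y_C2 \<mu>0 0 t)"
    unfolding eq .
qed

lemma y_C_strict_mono: "strict_mono_on {0..} (y_C \<mu>0)"
proof (rule strict_mono_onI)
  fix s t :: real assume "s \<in> {0..}" "t \<in> {0..}" "s < t"
  then show "y_C \<mu>0 s < y_C \<mu>0 t"
    using time_change.F_less_iff[OF time_change_y_C[of t], of s t] by auto
qed

lemma t_0_y_C: "0 \<le> s \<Longrightarrow> t_0 \<mu>0 (y_C \<mu>0 s) = s"
  unfolding t_0_def using strict_mono_on_imp_inj_on[OF y_C_strict_mono] by (intro the_inv_into_f_f) auto

lemma y_hat_y_C2: "0 \<le> t \<Longrightarrow> z \<in> {0..<1} \<Longrightarrow> y_hat \<mu>0 (y_C2 \<mu>0 z t) t = z"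
  unfolding y_hat_def using time_change.F_inj[OF time_change_y_C2[of t 1]]
  by (intro the_inv_into_f_f) (auto intro: inj_on_subset)

text \<open>For the strict upper bound, \<open>y_C \<mu>0 t\<close> is the value at z = 0 of the
  strictly increasing \<open>y_C2 \<mu>0 z t\<close>, whose value at z = 1 is 1.\<close>

lemma y_C_bounds:
  assumes "0 \<le> t" shows "0 \<le> y_C \<mu>0 t" "y_C \<mu>0 t < 1"
proof -
  show "0 \<le> y_C \<mu>0 t" using time_change.F_ge[OF time_change_y_C[OF assms], of t] assms y_C_0 by simp
  show "y_C \<mu>0 t < 1"
    using time_change.F_less_iff[OF time_change_y_C2[OF assms, of 1], of 0 1] assms by (simp add: y_C2_0 y_C2_1)
qed


section \<open>The limit density as a probability kernel\<close>

text \<open>Describing the position by its time s removes the inverse function; the upper branch is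
  treated likewise, with the initial position z as parameter.\<close>

lemma limit_density_below:
  assumes "0 \<le> s" "s < t"
  shows "limit_density \<mu>0 (y_C \<mu>0 s) t = density \<Lambda> (\<lambda>v. ennreal (v * exp (- (v * s)) / \<rho>1 s))"
proof -
  have "y_C \<mu>0 s < y_C \<mu>0 t"
    using strict_mono_onD[OF y_C_strict_mono, of s t] assms by simp
  then show ?thesis
    using assms by (simp add: limit_density_def t_0_y_C \<rho>1_def)
qed

lemma y_C_less_y_C2:
  assumes "0 \<le> t" "z \<in> {0<..<1}" shows "y_C \<mu>0 t < y_C2 \<mu>0 z t"
  using time_change.F_less_iff[OF time_change_y_C2[OF assms(1), of 1], of 0 z] assms by (simp add: y_C2_0)

lemma limit_density_above:
  assumes "0 \<le> t" "z \<in> {0<..<1}"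
  shows "limit_density \<mu>0 (y_C2 \<mu>0 z t) t = density (\<mu>0 z) (\<lambda>v. ennreal (exp (- (v * t)) / \<rho>2 t z))"
  using y_C_less_y_C2[OF assms] assms by (simp add: limit_density_def y_hat_y_C2 \<rho>2_def)

lemma y_C_cases:
  assumes t: "0 \<le> t" and y: "y \<in> {0..<y_C \<mu>0 t}"
  obtains s where "s \<in> {0..<t}" "y = y_C \<mu>0 s"
proof -
  have "y \<in> y_C \<mu>0 ` {0..<t}" using time_change.F_image[OF time_change_y_C[OF t]] y by (simp add: y_C_0)
  then show ?thesis using that by blast
qed

lemma y_C2_cases:
  assumes t: "0 \<le> t" and y: "y \<in> {y_C \<mu>0 t..<1}"
  obtains z where "z \<in> {0..<1}" "y = y_C2 \<mu>0 z t"
proof -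
  have "y \<in> (\<lambda>z. y_C2 \<mu>0 z t) ` {0..<1}"
    using time_change.F_image[OF time_change_y_C2[OF t, of 1]] y t by (simp add: y_C2_0 y_C2_1)
  then show ?thesis using that by blast
qed

lemma limit_density_prob_space:
  assumes t: "0 \<le> t" and y: "y \<in> {0..<1}" "y \<noteq> y_C \<mu>0 t"
  shows "prob_space (limit_density \<mu>0 y t)" "sets (limit_density \<mu>0 y t) = sets borel_nonneg"
proof -
  consider "y \<in> {0..<y_C \<mu>0 t}" | "y \<in> {y_C \<mu>0 t..<1}" using y by force
  then have "prob_space (limit_density \<mu>0 y t) \<and> sets (limit_density \<mu>0 y t) = sets borel_nonneg"
  proof cases
    case 1
    then obtain s where s: "s \<in> {0..<t}" "y = y_C \<mu>0 s" using y_C_cases t by blast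
    have "prob_space (density \<Lambda> (\<lambda>v. ennreal (v * exp (- (v * s)) / \<rho>1 s)))"
      by (rule prob_space_density) (use s \<rho>1_pos in \<open>auto simp: \<rho>1_def\<close>)
    then show ?thesis using s by (simp add: limit_density_below)
  next
    case 2
    then obtain z where z: "z \<in> {0..<1}" "y = y_C2 \<mu>0 z t" using y_C2_cases t by blast
    \<comment> \<open>z = 0 would be the boundary point, where \<open>limit_density\<close> is
      unspecified.\<close>
    then have z': "z \<in> {0<..<1}" using y t by (cases "z = 0") (auto simp: y_C2_0)
    have "prob_space (density (\<mu>0 z) (\<lambda>v. ennreal (exp (- (v * t)) / \<rho>2 t z)))"
      by (rule prob_space_density) (use z \<rho>2_bounds[OF z(1) t] in \<open>auto simp: \<rho>2_def\<close>)
    then show ?thesis using z z' t kernel[OF z(1)] by (simp add: limit_density_above)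
  qed
  then show "prob_space (limit_density \<mu>0 y t)" "sets (limit_density \<mu>0 y t) = sets borel_nonneg" by auto
qed

text \<open>\<open>limit_density\<close> is an arbitrary measure at the boundary point; \<open>K\<close> makes it a kernel.\<close>

definition K :: "real \<Rightarrow> real \<Rightarrow> real measure" where
  "K t y = (if y = y_C \<mu>0 t then return borel_nonneg 0 else limit_density \<mu>0 y t)"

lemma K_prob_space:
  assumes "0 \<le> t" "y \<in> {0..<1}"
  shows "prob_space (K t y)" "sets (K t y) = sets borel_nonneg"
  using limit_density_prob_space[OF assms] by (auto simp: K_def intro!: prob_space_return)

lemma AE_K: "AE y in U. K t y = limit_density \<mu>0 y t"
proof -
  have "AE y in U. y \<noteq> y_C \<mu>0 t"
    by (subst AE_restrict_space_iff) (auto intro: AE_mp[OF AE_completion[OF AE_lborel_singleton[of "y_C \<mu>0 t"]]])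
  then show ?thesis by eventually_elim (simp add: K_def)
qed

lemma t_0_measurable: "0 \<le> t \<Longrightarrow> t_0 \<mu>0 \<in> lebesgue_on {0..<y_C \<mu>0 t} \<rightarrow>\<^sub>M lebesgue_on {0..<t}"
  using time_change.h_lebesgue[OF time_change_y_C, of t "t_0 \<mu>0"] t_0_y_C by (auto simp: y_C_0)

lemma y_hat_measurable:
  assumes t: "0 \<le> t" and b: "b \<in> {0..1}"
  shows "(\<lambda>y. y_hat \<mu>0 y t) \<in> lebesgue_on {y_C \<mu>0 t..<y_C2 \<mu>0 b t} \<rightarrow>\<^sub>M lebesgue_on {0..<b}"
  using time_change.h_lebesgue[OF time_change_y_C2[OF t b], of "\<lambda>y. y_hat \<mu>0 y t"] y_hat_y_C2[OF t] b t
  by (auto simp: y_C2_0)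

text \<open>The mass of a fixed set A is \<open>G1\<close> composed with \<open>t_0\<close> below
  the boundary and \<open>G2\<close> composed with \<open>y_hat\<close> above it. \<open>G2\<close>
  inherits only Lebesgue measurability from \<open>\<mu>0\<close>; here the preimages of Lebesgue
  sets under \<open>y_hat\<close> are needed.\<close>

lemma K_kernel[measurable]:
  assumes t: "0 \<le> t"
  shows "K t \<in> U \<rightarrow>\<^sub>M subprob_algebra borel_nonneg"
proof (rule measurable_subprob_algebra)
  show "subprob_space (K t y)" "sets (K t y) = sets borel_nonneg" if "y \<in> space U" for y
    using K_prob_space[OF t, of y] that by (auto intro: prob_space_imp_subprob_space)
  fix A assume A: "A \<in> sets borel_nonneg"
  note [measurable] = A
  let ?yC = "y_C \<mu>0 t"
  have yC: "0 \<le> ?yC" "?yC < 1" using y_C_bounds[OF t] by auto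
  define G1 where "G1 s = (\<integral>\<^sup>+v. ennreal (v * exp (- (v * s)) / \<rho>1 s) * indicator A v \<partial>\<Lambda>)" for s
  define G2 where "G2 z = (\<integral>\<^sup>+v. ennreal (exp (- (v * t)) / \<rho>2 t z) * indicator A v \<partial>\<mu>0 z)" for z
  have G1[measurable]: "G1 \<in> borel_measurable borel"
  proof -
    have "(\<lambda>p. ennreal (snd p * exp (- (snd p * fst p)) / \<rho>1 (fst p))) \<in> borel_measurable (borel \<Otimes>\<^sub>M (borel :: real measure))"
      by measurable
    then have "(\<lambda>p. ennreal (snd p * exp (- (snd p * fst p)) / \<rho>1 (fst p)) * indicator A (snd p)) \<in> borel_measurable (borel \<Otimes>\<^sub>M \<Lambda>)"
      by (rule borel_measurable_times_ennreal[OF measurable_borel_\<Lambda>])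
        (rule measurable_compose[OF measurable_snd borel_measurable_indicator], simp add: A)
    then have "(\<lambda>(s, v). ennreal (v * exp (- (v * s)) / \<rho>1 s) * indicator A v) \<in> borel_measurable (borel \<Otimes>\<^sub>M \<Lambda>)"
      by (simp add: case_prod_beta')
    from \<Lambda>.borel_measurable_nn_integral[OF this] show ?thesis
      unfolding G1_def[abs_def] by simp
  qed
  have G2[measurable]: "G2 \<in> borel_measurable U"
  proof -
    have "(\<lambda>(z, v). ennreal (exp (- (v * t)) / \<rho>2 t z) * indicator A v) \<in> borel_measurable (U \<Otimes>\<^sub>M borel_nonneg)"
      by measurable
    from nn_integral_measurable_subprob_algebra2[OF this \<mu>0_kernel] show ?thesis
      unfolding G2_def[abs_def] .
  qed
  have below: "emeasure (K t y) A = G1 (t_0 \<mu>0 y)" if "y \<in> {0..<?yC}" for y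
  proof -
    from y_C_cases[OF t that] obtain s where s: "s \<in> {0..<t}" "y = y_C \<mu>0 s" .
    have "emeasure (density \<Lambda> (\<lambda>v. ennreal (v * exp (- (v * s)) / \<rho>1 s))) A = G1 s"
      unfolding G1_def by (rule emeasure_density) (use A in auto)
    then show ?thesis using s that by (simp add: K_def limit_density_below t_0_y_C)
  qed
  have above: "emeasure (K t y) A = G2 (y_hat \<mu>0 y t)" if "y \<in> {?yC..<1}" "y \<noteq> ?yC" for y
  proof -
    from y_C2_cases[OF t that(1)] obtain z where z: "z \<in> {0..<1}" "y = y_C2 \<mu>0 z t" .
    then have z': "z \<in> {0<..<1}" using that(2) t by (cases "z = 0") (auto simp: y_C2_0)
    have "(\<lambda>v. ennreal (exp (- (v * t)) / \<rho>2 t z)) \<in> borel_measurable (\<mu>0 z)"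
      using \<mu>0_measurableI[OF z(1), of "\<lambda>v. exp (- (v * t)) / \<rho>2 t z"] by simp
    then have "emeasure (density (\<mu>0 z) (\<lambda>v. ennreal (exp (- (v * t)) / \<rho>2 t z))) A = G2 z"
      unfolding G2_def using A kernel[OF z(1)] by (intro emeasure_density) auto
    then show ?thesis using z z' that t by (simp add: K_def limit_density_above y_hat_y_C2)
  qed
  have 1: "(\<lambda>y. G1 (t_0 \<mu>0 y)) \<in> borel_measurable (restrict_space U {y. y < ?yC})"
  proof -
    have "restrict_space U {y. y < ?yC} = lebesgue_on {0..<?yC}"
      using yC by (subst restrict_restrict_space) (auto intro!: arg_cong[where f="restrict_space lebesgue"])
    moreover have "(\<lambda>y. G1 (t_0 \<mu>0 y)) \<in> borel_measurable (lebesgue_on {0..<?yC})"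
      by (rule measurable_compose[OF t_0_measurable[OF t]])
        (intro measurable_restrict_space1 measurable_completion, simp)
    ultimately show ?thesis by simp
  qed
  \<comment> \<open>The boundary point keeps its own value, a constant, so that measurability does
    not depend on what it is.\<close>
  have 2: "(\<lambda>y. if y = ?yC then emeasure (K t y) A else G2 (y_hat \<mu>0 y t)) \<in> borel_measurable (restrict_space U {y. \<not> y < ?yC})"
  proof -
    have restr: "restrict_space U {y. \<not> y < ?yC} = lebesgue_on {?yC..<1}"
      using yC by (subst restrict_restrict_space) (auto intro!: arg_cong[where f="restrict_space lebesgue"])
    have G2': "(\<lambda>y. G2 (y_hat \<mu>0 y t)) \<in> borel_measurable (lebesgue_on {?yC..<1})"
      using measurable_compose[OF y_hat_measurable[OF t, of 1] G2] by (simp add: y_C2_1)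
    have "(\<lambda>y. if y = ?yC then emeasure (K t ?yC) A else G2 (y_hat \<mu>0 y t)) \<in> borel_measurable (lebesgue_on {?yC..<1})"
    proof (rule measurable_If[OF measurable_const G2'])
      have "{y \<in> space (lebesgue_on {?yC..<1}). y = ?yC} = {?yC}" using yC by auto
      then show "{y \<in> space (lebesgue_on {?yC..<1}). y = ?yC} \<in> sets (lebesgue_on {?yC..<1})"
        using yC by (simp add: sets_restrict_space_iff)
    qed simp
    then have "(\<lambda>y. if y = ?yC then emeasure (K t y) A else G2 (y_hat \<mu>0 y t)) \<in> borel_measurable (lebesgue_on {?yC..<1})"
      by (rule measurable_cong[THEN iffD1, rotated]) auto
    then show ?thesis unfolding restr .
  qed
  have "(\<lambda>y. if y < ?yC then G1 (t_0 \<mu>0 y) else if y = ?yC then emeasure (K t y) A else G2 (y_hat \<mu>0 y t)) \<in> borel_measurable U"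
  proof (subst measurable_If_restrict_space_iff)
    have "{y \<in> space U. y < ?yC} = {0..<?yC}" using yC by auto
    then show "{y \<in> space U. y < ?yC} \<in> sets U" using yC by (simp add: sets_restrict_space_iff)
  qed (use 1 2 in simp)
  then show "(\<lambda>y. emeasure (K t y) A) \<in> borel_measurable U"
    by (rule measurable_cong[THEN iffD1, rotated]) (auto simp: below above)
qed

section \<open>Integrals against the kernel over initial intervals of positions\<close>

lemma integral_K_below:
  fixes g :: "real \<Rightarrow> real"
  assumes "g \<in> borel_measurable borel_nonneg" "0 \<le> s" "s < t"
  shows "(LINT v|K t (y_C \<mu>0 s). g v) = (LINT v|\<Lambda>. v * exp (- (v * s)) * g v) / \<rho>1 s"
proof -
  have "y_C \<mu>0 s \<noteq> y_C \<mu>0 t"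
    using strict_mono_onD[OF y_C_strict_mono, of s t] assms by simp
  then have "(LINT v|K t (y_C \<mu>0 s). g v) = (LINT v|density \<Lambda> (\<lambda>v. ennreal (v * exp (- (v * s)) / \<rho>1 s)). g v)"
    using assms by (simp add: K_def limit_density_below)
  also have "\<dots> = (LINT v|\<Lambda>. v * exp (- (v * s)) / \<rho>1 s * g v)"
  proof (rule integral_density[THEN trans])
    show "AE v in \<Lambda>. 0 \<le> v * exp (- (v * s)) / \<rho>1 s"
      using \<rho>1_pos[OF assms(2)] by (intro AE_I2) simp
  qed (use assms in \<open>auto simp: measurable_cong_sets[OF sets_\<Lambda> refl]\<close>)
  also have "\<dots> = (LINT v|\<Lambda>. v * exp (- (v * s)) * g v) / \<rho>1 s" by simp
  finally show ?thesis .
qed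

lemma integral_K_above:
  fixes g :: "real \<Rightarrow> real"
  assumes g: "g \<in> borel_measurable borel_nonneg" and t: "0 \<le> t" and z: "z \<in> {0<..<1}"
  shows "(LINT v|K t (y_C2 \<mu>0 z t). g v) = (LINT v|\<mu>0 z. exp (- (v * t)) * g v) / \<rho>2 t z"
proof -
  have z': "z \<in> {0..<1}" using z by auto
  have "(LINT v|K t (y_C2 \<mu>0 z t). g v) = (LINT v|density (\<mu>0 z) (\<lambda>v. ennreal (exp (- (v * t)) / \<rho>2 t z)). g v)"
    using y_C_less_y_C2[OF t z] t z by (simp add: K_def limit_density_above)
  also have "\<dots> = (LINT v|\<mu>0 z. exp (- (v * t)) / \<rho>2 t z * g v)"
  proof (rule integral_density[THEN trans])
    show "AE v in \<mu>0 z. 0 \<le> exp (- (v * t)) / \<rho>2 t z"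
      using \<rho>2_bounds(1)[OF z' t] by (intro AE_I2) simp
    show "(\<lambda>v. exp (- (v * t)) / \<rho>2 t z) \<in> borel_measurable (\<mu>0 z)"
      by (rule \<mu>0_measurableI[OF z']) measurable
    show "g \<in> borel_measurable (\<mu>0 z)" by (rule \<mu>0_measurableI[OF z' g])
  qed simp
  also have "\<dots> = (LINT v|\<mu>0 z. exp (- (v * t)) * g v) / \<rho>2 t z" by simp
  finally show ?thesis .
qed


lemma integral_K_measurable:
  fixes g :: "real \<Rightarrow> real"
  assumes "0 \<le> t" "g \<in> borel_measurable borel_nonneg"
  shows "(\<lambda>y. LINT v|K t y. g v) \<in> borel_measurable U"
  by (rule measurable_compose[OF K_kernel[OF assms(1)] integral_measurable_subprob_algebra[OF assms(2)]])

lemma integral_K_bound: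
  fixes g :: "real \<Rightarrow> real"
  assumes t: "0 \<le> t" and y: "y \<in> {0..<1}" and g: "g \<in> borel_measurable borel_nonneg" "\<And>v. 0 \<le> v \<Longrightarrow> \<bar>g v\<bar> \<le> B"
  shows "\<bar>LINT v|K t y. g v\<bar> \<le> B"
proof -
  interpret K: prob_space "K t y" by (rule K_prob_space[OF t y])
  have sp: "space (K t y) = {0..}"
    using K_prob_space(2)[OF t y] by (auto dest: sets_eq_imp_space_eq)
  have "g \<in> borel_measurable (K t y)"
    using g(1) K_prob_space(2)[OF t y] measurable_cong_sets[of "K t y" borel_nonneg borel borel] by blast
  then have int: "integrable (K t y) g"
    by (rule K.integrable_const_bound[rotated]) (use g(2) sp in auto)
  have "\<bar>LINT v|K t y. g v\<bar> \<le> (LINT v|K t y. \<bar>g v\<bar>)" by (rule integral_abs_bound)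
  also have "\<dots> \<le> B"
    by (rule K.integral_le_const) (use int g(2) sp in auto)
  finally show ?thesis .
qed

lemma measurable_pair_times:
  fixes f :: "real \<times> real \<Rightarrow> real" and g :: "real \<Rightarrow> real"
  assumes f: "f \<in> borel_measurable (borel \<Otimes>\<^sub>M borel)" and g: "g \<in> borel_measurable borel_nonneg"
  shows "(\<lambda>p. f p * g (snd p)) \<in> borel_measurable (borel \<Otimes>\<^sub>M \<Lambda>)"
proof (rule borel_measurable_times[OF measurable_borel_\<Lambda>[OF f]])
  have "g \<in> borel_measurable \<Lambda>"
    using g unfolding measurable_cong_sets[OF sets_\<Lambda> refl] .
  then show "(\<lambda>p. g (snd p)) \<in> borel_measurable (borel \<Otimes>\<^sub>M \<Lambda>)"
    by (rule measurable_compose[OF measurable_snd])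
qed

text \<open>g may change sign, so integrability comes first: the integrand is at most B * v in
  absolute value for a in {0..<s}, and \<Lambda> has finite mean. The inner integral over a is then
  explicit.\<close>

lemma Fubini_size_biased:
  fixes g :: "real \<Rightarrow> real"
  assumes g: "g \<in> borel_measurable borel_nonneg" "\<And>v. 0 \<le> v \<Longrightarrow> \<bar>g v\<bar> \<le> B" and s: "0 \<le> s"
  shows "(LINT a|lborel. indicator {0..<s} a * (LINT v|\<Lambda>. v * exp (- (v * a)) * g v))
       = (LINT v|\<Lambda>. g v * (1 - exp (- (v * s))))"
proof -
  interpret P: pair_sigma_finite lborel \<Lambda> by unfold_locales
  define f where "f a v = indicator {0..<s} a * (v * exp (- (v * a)) * g v)" for a v :: real
  have B: "0 \<le> B" using g(2)[of 0] by simp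
  have meas: "case_prod f \<in> borel_measurable (lborel \<Otimes>\<^sub>M \<Lambda>)"
  proof -
    have "(\<lambda>p. indicator {0..<s} (fst p) * (snd p * exp (- (snd p * fst p)))) \<in> borel_measurable (borel \<Otimes>\<^sub>M (borel :: real measure))"
      by measurable
    from measurable_pair_times[OF this g(1)] 
    have "case_prod f \<in> borel_measurable (borel \<Otimes>\<^sub>M \<Lambda>)"
      by (simp add: f_def case_prod_beta' mult.assoc)
    moreover have "sets (lborel \<Otimes>\<^sub>M \<Lambda>) = sets (borel \<Otimes>\<^sub>M \<Lambda>)" by (intro sets_pair_measure_cong) auto
    ultimately show ?thesis using measurable_cong_sets by blast
  qed
  have "(\<integral>\<^sup>+p. ennreal (norm (case_prod f p)) \<partial>(lborel \<Otimes>\<^sub>M \<Lambda>)) = (\<integral>\<^sup>+a. \<integral>\<^sup>+v. ennreal (norm (f a v)) \<partial>\<Lambda> \<partial>lborel)"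
    using meas by (subst \<Lambda>.nn_integral_fst[symmetric]) auto
  also have "\<dots> \<le> (\<integral>\<^sup>+a. (\<integral>\<^sup>+v. ennreal B * ennreal v \<partial>\<Lambda>) * indicator {0..<s} a \<partial>lborel)"
  proof (rule nn_integral_mono)
    fix a :: real
    show "(\<integral>\<^sup>+v. ennreal (norm (f a v)) \<partial>\<Lambda>) \<le> (\<integral>\<^sup>+v. ennreal B * ennreal v \<partial>\<Lambda>) * indicator {0..<s} a"
    proof (cases "a \<in> {0..<s}")
      case True
      have "norm (f a v) \<le> B * v" if "0 \<le> v" for v
      proof -
        have "norm (f a v) = (v * exp (- (v * a))) * \<bar>g v\<bar>" using True that by (simp add: f_def abs_mult)
        also have "\<dots> \<le> v * B" using True that g(2)[OF that] size_biased_le[of v a] by (intro mult_mono) auto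
        finally show ?thesis by (simp add: mult.commute)
      qed
      then have "ennreal (norm (f a v)) \<le> ennreal B * ennreal v" if "0 \<le> v" for v
        using that B by (simp add: ennreal_leI flip: ennreal_mult)
      then have "(\<integral>\<^sup>+v. ennreal (norm (f a v)) \<partial>\<Lambda>) \<le> (\<integral>\<^sup>+v. ennreal B * ennreal v \<partial>\<Lambda>)"
        by (intro nn_integral_mono) auto
      then show ?thesis using True by simp
    next
      case False
      then have "f a v = 0" for v by (auto simp: f_def)
      then show ?thesis by simp
    qed
  qed
  also have "\<dots> = (\<integral>\<^sup>+v. ennreal B * ennreal v \<partial>\<Lambda>) * emeasure lborel {0..<s}"
    by (rule nn_integral_cmult_indicator) simp
  also have "(\<integral>\<^sup>+v. ennreal B * ennreal v \<partial>\<Lambda>) = ennreal B * (\<integral>\<^sup>+v. ennreal v \<partial>\<Lambda>)"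
    by (rule nn_integral_cmult) simp
  also have "\<dots> * emeasure lborel {0..<s} < \<infinity>"
    using finite_mean s by (simp add: ennreal_mult_less_top)
  finally have int: "integrable (lborel \<Otimes>\<^sub>M \<Lambda>) (case_prod f)"
    using meas by (intro integrableI_bounded) auto
  have "(LINT a|lborel. indicator {0..<s} a * (LINT v|\<Lambda>. v * exp (- (v * a)) * g v)) = (LINT a|lborel. LINT v|\<Lambda>. f a v)"
    by (simp add: f_def)
  also have "\<dots> = (LINT v|\<Lambda>. LINT a|lborel. f a v)"
    using P.Fubini_integral[OF int] by simp
  also have "\<dots> = (LINT v|\<Lambda>. g v * (1 - exp (- (v * s))))"
  proof (rule Bochner_Integration.integral_cong)
    fix v assume "v \<in> space \<Lambda>"
    then have v: "0 \<le> v" by simp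
    have "(LINT a|lborel. f a v) = (LINT a|lborel. g v * (indicator {0..<s} a * (v * exp (- (v * a)))))"
      by (rule Bochner_Integration.integral_cong) (auto simp: f_def)
    then show "(LINT a|lborel. f a v) = g v * (1 - exp (- (v * s)))"
      using has_bochner_integral_size_biased_exp(1)[OF v s] by (simp add: has_bochner_integral_iff)
  qed simp
  finally show ?thesis .
qed

text \<open>Substituting y = \<open>y_C \<mu>0 a\<close> produces the factor
  \<open>\<rho>1 a\<close>, which cancels the normalisation of the kernel. What remains weights g
  with the probability of a jump within time s.\<close>

lemma marginal_below:
  fixes g :: "real \<Rightarrow> real"
  assumes g: "g \<in> borel_measurable borel_nonneg" "\<And>v. 0 \<le> v \<Longrightarrow> \<bar>g v\<bar> \<le> B" and s: "0 \<le> s" "s \<le> t"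
  shows "(LINT y|U. (LINT v|K t y. g v) * of_bool (y < y_C \<mu>0 s)) = (LINT v|\<Lambda>. g v * (1 - exp (- (v * s))))"
proof -
  let ?y = "y_C \<mu>0 s"
  have y: "0 \<le> ?y" "?y < 1" using y_C_bounds s by auto
  define \<Gamma> where "\<Gamma> a = (LINT v|\<Lambda>. v * exp (- (v * a)) * g v) / \<rho>1 a" for a
  have \<Gamma>_borel: "\<Gamma> \<in> borel_measurable borel"
  proof -
    have "(\<lambda>p. snd p * exp (- (snd p * fst p))) \<in> borel_measurable (borel \<Otimes>\<^sub>M (borel :: real measure))"
      by measurable
    from measurable_pair_times[OF this g(1)]
    have "(\<lambda>(a, v). v * exp (- (v * a)) * g v) \<in> borel_measurable (borel \<Otimes>\<^sub>M \<Lambda>)"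
      by (simp add: case_prod_beta')
    from \<Lambda>.borel_measurable_lebesgue_integral[OF this] show ?thesis
      unfolding \<Gamma>_def[abs_def] by (intro borel_measurable_divide \<rho>1_borel) simp
  qed
  have \<Gamma>_meas: "\<Gamma> \<in> borel_measurable (lebesgue_on {0..<s})" and \<rho>1_meas: "\<rho>1 \<in> borel_measurable (lebesgue_on {0..<s})"
    using \<Gamma>_borel by (auto intro!: measurable_restrict_space1 measurable_completion)
  have "(LINT y|U. (LINT v|K t y. g v) * of_bool (y < ?y)) = (LINT y|U. indicator {0..<?y} y * (LINT v|K t y. g v))"
    by (rule Bochner_Integration.integral_cong) (auto simp: indicator_def)
  also have "\<dots> = (LINT y|lebesgue_on {0..<?y}. (LINT v|K t y. g v))"
    using y by (intro integral_lebesgue_on_subset[symmetric]) auto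
  also have "\<dots> = (LINT y|lebesgue_on {0..<?y}. \<Gamma> (t_0 \<mu>0 y))"
  proof (rule Bochner_Integration.integral_cong)
    fix y assume "y \<in> space (lebesgue_on {0..<?y})"
    then obtain a where "a \<in> {0..<s}" "y = y_C \<mu>0 a" using y_C_cases[OF s(1), of y] by auto
    then show "(LINT v|K t y. g v) = \<Gamma> (t_0 \<mu>0 y)"
      using s by (simp add: integral_K_below[OF g(1)] \<Gamma>_def t_0_y_C)
  qed simp
  also have "\<dots> = (LINT a|distr (lebesgue_on {0..<?y}) (lebesgue_on {0..<s}) (t_0 \<mu>0). \<Gamma> a)"
    by (rule integral_distr[symmetric, OF t_0_measurable[OF s(1)] \<Gamma>_meas])
  also have "distr (lebesgue_on {0..<?y}) (lebesgue_on {0..<s}) (t_0 \<mu>0) = density (lebesgue_on {0..<s}) \<rho>1"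
    using time_change.distr_h[OF time_change_y_C[OF s(1)], of "t_0 \<mu>0"] t_0_y_C by (simp add: y_C_0)
  also have "(LINT a|density (lebesgue_on {0..<s}) \<rho>1. \<Gamma> a) = (LINT a|lebesgue_on {0..<s}. \<rho>1 a * \<Gamma> a)"
  proof (rule integral_density[THEN trans])
    show "AE a in lebesgue_on {0..<s}. 0 \<le> \<rho>1 a"
      using \<rho>1_pos by (intro AE_I2) (auto simp: less_imp_le)
  qed (use \<Gamma>_meas \<rho>1_meas in auto)
  also have "\<dots> = (LINT a|lborel. indicator {0..<s} a * (\<rho>1 a * \<Gamma> a))"
    using \<Gamma>_borel by (intro integral_lebesgue_on_borel) auto
  also have "\<dots> = (LINT a|lborel. indicator {0..<s} a * (LINT v|\<Lambda>. v * exp (- (v * a)) * g v))"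
  proof (rule Bochner_Integration.integral_cong)
    fix a :: real
    show "indicator {0..<s} a * (\<rho>1 a * \<Gamma> a) = indicator {0..<s} a * (LINT v|\<Lambda>. v * exp (- (v * a)) * g v)"
      using \<rho>1_pos[of a] by (cases "a \<in> {0..<s}") (auto simp: \<Gamma>_def)
  qed simp
  also have "\<dots> = (LINT v|\<Lambda>. g v * (1 - exp (- (v * s))))"
    by (rule Fubini_size_biased[OF g s(1)])
  finally show ?thesis .
qed

text \<open>Positions below \<open>y_C \<mu>0 t\<close> are the case s = t of the previous formula.
  On the rest, substituting the initial position u cancels \<open>\<rho>2 t u\<close> and leaves g
  weighted with the probability exp(-(v*t)) of no jump up to t.\<close>

lemma marginal_above:
  fixes g :: "real \<Rightarrow> real"
  assumes g: "g \<in> borel_measurable borel_nonneg" "\<And>v. 0 \<le> v \<Longrightarrow> \<bar>g v\<bar> \<le> B" and t: "0 \<le> t" and z: "z \<in> {0..1}"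
  shows "(LINT y|U. (LINT v|K t y. g v) * of_bool (y < y_C2 \<mu>0 z t))
       = (LINT v|\<Lambda>. g v * (1 - exp (- (v * t)))) + (LINT u|lebesgue_on {0..<z}. LINT v|\<mu>0 u. exp (- (v * t)) * g v)"
proof -
  let ?y = "y_C2 \<mu>0 z t" and ?c = "y_C \<mu>0 t"
  have c: "0 \<le> ?c" "?c < 1" using y_C_bounds t by auto
  have y: "?c \<le> ?y" "?y \<le> 1"
    using time_change.F_le_iff[OF time_change_y_C2[OF t, of 1], of 0 z] 
      time_change.F_le_iff[OF time_change_y_C2[OF t, of 1], of z 1] z t by (auto simp: y_C2_0 y_C2_1)
  define \<Gamma> where "\<Gamma> u = (LINT v|\<mu>0 u. exp (- (v * t)) * g v) / \<rho>2 t u" for u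
  have eg: "(\<lambda>v. exp (- (v * t)) * g v) \<in> borel_measurable borel_nonneg"
    by (rule borel_measurable_times[OF _ g(1)]) measurable
  have \<Gamma>_U: "\<Gamma> \<in> borel_measurable U"
    unfolding \<Gamma>_def[abs_def] by (intro borel_measurable_divide \<rho>2_borel integral_\<mu>0_measurable eg)
  have restr: "lebesgue_on {0..<z} = restrict_space U {0..<z}" using z by (simp add: restrict_U)
  have \<Gamma>_meas: "\<Gamma> \<in> borel_measurable (lebesgue_on {0..<z})"
    and \<rho>2_meas: "\<rho>2 t \<in> borel_measurable (lebesgue_on {0..<z})"
    unfolding restr by (rule measurable_restrict_space1[OF \<Gamma>_U] measurable_restrict_space1[OF \<rho>2_borel])+
  have h_U: "(\<lambda>y. LINT v|K t y. g v) \<in> borel_measurable U" by (rule integral_K_measurable[OF t g(1)])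
  have int: "integrable U (\<lambda>y. (LINT v|K t y. g v) * indicator S y)" if S: "S \<in> sets borel" for S
  proof (rule U.integrable_const_bound[where B=B])
    have B: "0 \<le> B" using g(2)[of 0] by simp
    show "AE y in U. norm ((LINT v|K t y. g v) * indicator S y) \<le> B"
      using integral_K_bound[OF t _ g] B by (intro AE_I2) (auto simp: indicator_def)
    have "S \<inter> {0..<1} \<in> sets U" using S by (simp add: sets_restrict_space_iff)
    then have "(\<lambda>y. (LINT v|K t y. g v) * indicator (S \<inter> {0..<1}) y) \<in> borel_measurable U"
      using h_U by (intro borel_measurable_times borel_measurable_indicator)
    also have "?this \<longleftrightarrow> (\<lambda>y. (LINT v|K t y. g v) * indicator S y) \<in> borel_measurable U"
      by (rule measurable_cong) (auto simp: indicator_def)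
    finally show "(\<lambda>y. (LINT v|K t y. g v) * indicator S y) \<in> borel_measurable U" .
  qed
  have "(LINT y|U. (LINT v|K t y. g v) * of_bool (y < ?y))
      = (LINT y|U. (LINT v|K t y. g v) * indicator {..<?c} y + (LINT v|K t y. g v) * indicator {?c..<?y} y)"
    by (rule Bochner_Integration.integral_cong) (use y in \<open>auto simp: indicator_def\<close>)
  also have "\<dots> = (LINT y|U. (LINT v|K t y. g v) * indicator {..<?c} y) + (LINT y|U. (LINT v|K t y. g v) * indicator {?c..<?y} y)"
    by (intro Bochner_Integration.integral_add int) auto
  also have "(LINT y|U. (LINT v|K t y. g v) * indicator {..<?c} y) = (LINT y|U. (LINT v|K t y. g v) * of_bool (y < ?c))"
    by (rule Bochner_Integration.integral_cong) (auto simp: indicator_def)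
  also have "\<dots> = (LINT v|\<Lambda>. g v * (1 - exp (- (v * t))))"
    by (rule marginal_below[OF g t order_refl])
  also have "(LINT y|U. (LINT v|K t y. g v) * indicator {?c..<?y} y) = (LINT y|lebesgue_on {?c..<?y}. (LINT v|K t y. g v))"
    using c y integral_lebesgue_on_subset[of "{?c..<?y}" "{0..<1}" "\<lambda>y. LINT v|K t y. g v"]
    by (simp add: mult.commute)
  also have "\<dots> = (LINT y|lebesgue_on {?c..<?y}. \<Gamma> (y_hat \<mu>0 y t))"
  \<comment> \<open>At the single point \<open>?c\<close> the kernel is a placeholder, so equality
    is claimed only almost everywhere.\<close>
  proof (rule integral_cong_AE)
    show "(\<lambda>y. LINT v|K t y. g v) \<in> borel_measurable (lebesgue_on {?c..<?y})"
      unfolding restrict_U[OF c(1) y(2), symmetric] by (rule measurable_restrict_space1[OF h_U])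
    show "(\<lambda>y. \<Gamma> (y_hat \<mu>0 y t)) \<in> borel_measurable (lebesgue_on {?c..<?y})"
      by (rule measurable_compose[OF y_hat_measurable[OF t z] \<Gamma>_meas])
    have "AE y in lebesgue_on {?c..<?y}. y \<noteq> ?c"
      by (subst AE_restrict_space_iff) (auto intro: AE_mp[OF AE_completion[OF AE_lborel_singleton[of ?c]]])
    then show "AE y in lebesgue_on {?c..<?y}. (LINT v|K t y. g v) = \<Gamma> (y_hat \<mu>0 y t)"
    proof (rule AE_mp, intro AE_I2 impI)
      fix y assume "y \<in> space (lebesgue_on {?c..<?y})" "y \<noteq> ?c"
      then have y': "y \<in> {?c..<1}" "y \<noteq> ?c" using y by auto
      from y_C2_cases[OF t y'(1)] obtain u where u: "u \<in> {0..<1}" "y = y_C2 \<mu>0 u t" .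
      then have "u \<in> {0<..<1}" using y'(2) t by (cases "u = 0") (auto simp: y_C2_0)
      then show "(LINT v|K t y. g v) = \<Gamma> (y_hat \<mu>0 y t)"
        using u t by (simp add: integral_K_above[OF g(1)] \<Gamma>_def y_hat_y_C2)
    qed
  qed
  also have "\<dots> = (LINT u|distr (lebesgue_on {?c..<?y}) (lebesgue_on {0..<z}) (\<lambda>y. y_hat \<mu>0 y t). \<Gamma> u)"
    by (rule integral_distr[symmetric, OF y_hat_measurable[OF t z] \<Gamma>_meas])
  also have "distr (lebesgue_on {?c..<?y}) (lebesgue_on {0..<z}) (\<lambda>y. y_hat \<mu>0 y t) = density (lebesgue_on {0..<z}) (\<rho>2 t)"
    using time_change.distr_h[OF time_change_y_C2[OF t z], of "\<lambda>y. y_hat \<mu>0 y t"] y_hat_y_C2[OF t] z t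
    by (simp add: y_C2_0)
  also have "(LINT u|density (lebesgue_on {0..<z}) (\<rho>2 t). \<Gamma> u) = (LINT u|lebesgue_on {0..<z}. \<rho>2 t u * \<Gamma> u)"
  proof (rule integral_density[THEN trans])
    show "AE u in lebesgue_on {0..<z}. 0 \<le> \<rho>2 t u"
      using \<rho>2_bounds(1)[OF _ t] z by (intro AE_I2) (auto simp: less_imp_le)
  qed (use \<Gamma>_meas \<rho>2_meas in auto)
  also have "\<dots> = (LINT u|lebesgue_on {0..<z}. LINT v|\<mu>0 u. exp (- (v * t)) * g v)"
  proof (rule Bochner_Integration.integral_cong)
    fix u assume "u \<in> space (lebesgue_on {0..<z})"
    then show "\<rho>2 t u * \<Gamma> u = (LINT v|\<mu>0 u. exp (- (v * t)) * g v)"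
      using \<rho>2_bounds(1)[of u t] z t by (auto simp: \<Gamma>_def)
  qed simp
  finally show ?thesis .
qed


section \<open>The joint limit law of rate and position\<close>

abbreviation "strip \<equiv> borel_nonneg \<Otimes>\<^sub>M borel_unit"

text \<open>The limit law as a mixture over a uniform position. It is built from \<open>K\<close>,
  because a measurable kernel must take values in the subprobability measures at every position, the
  boundary point included.\<close>

definition L :: "real \<Rightarrow> (real \<times> real) measure" where
  "L t = Giry_Monad.bind U (\<lambda>y. distr (K t y) strip (\<lambda>v. (v, y)))"

lemma id_U_borel_unit: "(\<lambda>y. y) \<in> U \<rightarrow>\<^sub>M borel_unit"
  by (rule measurable_restrict_space3) (auto intro: measurable_completion)

lemma L_kernel:
  assumes t: "0 \<le> t"
  shows "(\<lambda>y. distr (K t y) strip (\<lambda>v. (v, y))) \<in> U \<rightarrow>\<^sub>M subprob_algebra strip"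
proof (rule measurable_distr2[OF _ K_kernel[OF t]])
  have "(\<lambda>p. (snd p, fst p)) \<in> U \<Otimes>\<^sub>M borel_nonneg \<rightarrow>\<^sub>M strip"
    by (intro measurable_Pair measurable_snd measurable_compose[OF measurable_fst id_U_borel_unit])
  then show "(\<lambda>(y, v). (v, y)) \<in> U \<Otimes>\<^sub>M borel_nonneg \<rightarrow>\<^sub>M strip"
    by (simp add: case_prod_beta')
qed

lemma section_measurable:
  assumes "0 \<le> t" "y \<in> {0..<1}"
  shows "(\<lambda>v. (v, y)) \<in> K t y \<rightarrow>\<^sub>M strip"
proof -
  have "(\<lambda>v. (v, y)) \<in> borel_nonneg \<rightarrow>\<^sub>M strip"
    using assms(2) by (intro measurable_Pair measurable_ident measurable_const) (auto simp: space_restrict_space)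
  then show ?thesis
    using measurable_cong_sets[OF K_prob_space(2)[OF assms] refl, of strip] by blast
qed

lemma sets_L: "0 \<le> t \<Longrightarrow> sets (L t) = sets strip"
  unfolding L_def by (rule sets_bind[OF sets_kernel[OF L_kernel]]) auto

lemma space_L: "0 \<le> t \<Longrightarrow> space (L t) = {0..} \<times> {0..<1}"
  using sets_eq_imp_space_eq[OF sets_L] by (simp add: space_strip)

lemma prob_space_L:
  assumes t: "0 \<le> t" shows "prob_space (L t)"
  unfolding L_def
proof (rule U.prob_space_bind[OF _ L_kernel[OF t]])
  show "AE y in U. prob_space (distr (K t y) strip (\<lambda>v. (v, y)))"
    using K_prob_space(1)[OF t] section_measurable[OF t]
    by (intro AE_I2 prob_space.prob_space_distr) auto
qed

lemma emeasure_L: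
  assumes t: "0 \<le> t" and A: "A \<in> sets borel_nonneg" and B: "B \<in> sets borel_unit"
  shows "emeasure (L t) (A \<times> B) = (\<integral>\<^sup>+y. emeasure (limit_density \<mu>0 y t) A * indicator B y \<partial>U)"
proof -
  have AB: "A \<times> B \<in> sets strip" using A B by simp
  have "emeasure (L t) (A \<times> B) = (\<integral>\<^sup>+y. emeasure (distr (K t y) strip (\<lambda>v. (v, y))) (A \<times> B) \<partial>U)"
    unfolding L_def by (rule emeasure_bind[OF _ L_kernel[OF t] AB]) simp
  also have "\<dots> = (\<integral>\<^sup>+y. emeasure (limit_density \<mu>0 y t) A * indicator B y \<partial>U)"
  proof (rule nn_integral_cong_AE, rule AE_mp[OF AE_K[of t]], intro AE_I2 impI)
    fix y assume y: "y \<in> space U" and K: "K t y = limit_density \<mu>0 y t"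
    have "emeasure (distr (K t y) strip (\<lambda>v. (v, y))) (A \<times> B) = emeasure (K t y) ((\<lambda>v. (v, y)) -` (A \<times> B) \<inter> space (K t y))"
      using y by (intro emeasure_distr section_measurable t AB) auto
    also have "(\<lambda>v. (v, y)) -` (A \<times> B) \<inter> space (K t y) = (if y \<in> B then A else {})"
      using sets.sets_into_space[of A "K t y"] A K_prob_space(2)[OF t, of y] y by auto
    finally show "emeasure (distr (K t y) strip (\<lambda>v. (v, y))) (A \<times> B) = emeasure (limit_density \<mu>0 y t) A * indicator B y"
      using K by simp
  qed
  finally show ?thesis .
qed

text \<open>The mass of {0..} \<times> N is an integral over N, which vanishes because a Borel null
  set is also null for the completed measure.\<close>

lemma absolutely_continuous_L:
  assumes t: "0 \<le> t"
  shows "absolutely_continuous (restrict_space lborel {0..<1}) (distr (L t) borel_unit snd)"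
  unfolding absolutely_continuous_def
proof
  fix N assume N: "N \<in> null_sets (restrict_space lborel {0..<1::real})"
  then have Ns: "N \<in> sets borel_unit" and N0: "N \<in> null_sets lborel"
    by (auto simp: null_sets_restrict_space) (auto simp: null_sets_def sets_restrict_space_iff)
  have "snd \<in> L t \<rightarrow>\<^sub>M borel_unit"
    using measurable_snd[of borel_nonneg borel_unit] measurable_cong_sets[OF sets_L[OF t] refl] by blast
  then have "emeasure (distr (L t) borel_unit snd) N = emeasure (L t) (snd -` N \<inter> space (L t))"
    using Ns by (rule emeasure_distr)
  also have "snd -` N \<inter> space (L t) = {0..} \<times> N"
    using sets.sets_into_space[OF Ns] by (auto simp: space_L[OF t] space_restrict_space)
  also have "emeasure (L t) ({0..} \<times> N) = (\<integral>\<^sup>+y. emeasure (limit_density \<mu>0 y t) {0..} * indicator N y \<partial>U)"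
    using Ns by (intro emeasure_L t) (auto simp: sets_restrict_space)
  also have "\<dots> = (\<integral>\<^sup>+y. 0 \<partial>U)"
  proof (rule nn_integral_cong_AE)
    have "AE y in lebesgue. y \<notin> N" using N0 by (intro AE_completion AE_not_in)
    then show "AE y in U. emeasure (limit_density \<mu>0 y t) {0..} * indicator N y = 0"
      by (subst AE_restrict_space_iff) (auto elim: eventually_mono)
  qed
  finally show "N \<in> null_sets (distr (L t) borel_unit snd)"
    using Ns by (intro null_setsI) auto
qed

lemma integral_L_K:
  fixes f :: "real \<times> real \<Rightarrow> real"
  assumes t: "0 \<le> t" and f: "f \<in> borel_measurable strip" and B: "\<And>p. p \<in> {0..} \<times> {0..<1} \<Longrightarrow> \<bar>f p\<bar> \<le> B"
  shows "(LINT p|L t. f p) = (LINT y|U. LINT v|K t y. f (v, y))"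
    and "(\<lambda>y. LINT v|K t y. f (v, y)) \<in> borel_measurable U"
proof -
  have eq: "(LINT p|distr (K t y) strip (\<lambda>v. (v, y)). f p) = (LINT v|K t y. f (v, y))" if "y \<in> {0..<1}" for y
    by (rule integral_distr[OF section_measurable[OF t that] f])
  have "(LINT p|L t. f p) = (LINT y|U. LINT p|distr (K t y) strip (\<lambda>v. (v, y)). f p)"
    unfolding L_def
  proof (rule integral_bind[OF f _ L_kernel[OF t], where B'=1])
    show "finite_measure U" by unfold_locales
    show "AE y in U. emeasure (distr (K t y) strip (\<lambda>v. (v, y))) (space (distr (K t y) strip (\<lambda>v. (v, y)))) \<le> ennreal 1"
    proof (rule AE_I2)
      fix y assume "y \<in> space U"
      then interpret D: prob_space "distr (K t y) strip (\<lambda>v. (v, y))"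
        using K_prob_space(1)[OF t] section_measurable[OF t] by (intro prob_space.prob_space_distr) auto
      show "emeasure (distr (K t y) strip (\<lambda>v. (v, y))) (space (distr (K t y) strip (\<lambda>v. (v, y)))) \<le> ennreal 1"
        using D.emeasure_space_1 by simp
    qed
  qed (use B in \<open>auto simp: space_strip\<close>)
  also have "\<dots> = (LINT y|U. LINT v|K t y. f (v, y))"
    by (rule Bochner_Integration.integral_cong) (auto simp: eq)
  finally show "(LINT p|L t. f p) = (LINT y|U. LINT v|K t y. f (v, y))" .
  have "(\<lambda>y. LINT p|distr (K t y) strip (\<lambda>v. (v, y)). f p) \<in> borel_measurable U"
    by (rule measurable_compose[OF L_kernel[OF t] integral_measurable_subprob_algebra[OF f]])
  also have "?this \<longleftrightarrow> (\<lambda>y. LINT v|K t y. f (v, y)) \<in> borel_measurable U"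
    by (rule measurable_cong) (auto simp: eq)
  finally show "(\<lambda>y. LINT v|K t y. f (v, y)) \<in> borel_measurable U" .
qed

lemma integral_L:
  fixes f :: "real \<times> real \<Rightarrow> real"
  assumes t: "0 \<le> t" and f: "f \<in> borel_measurable strip" and B: "\<And>p. p \<in> {0..} \<times> {0..<1} \<Longrightarrow> \<bar>f p\<bar> \<le> B"
  shows "(LINT p|L t. f p) = (LINT y|U. LINT v|limit_density \<mu>0 y t. f (v, y))"
proof -
  note K = integral_L_K[OF assms]
  have "(LINT y|U. LINT v|K t y. f (v, y)) = (LINT y|U. LINT v|limit_density \<mu>0 y t. f (v, y))"
  proof (rule integral_cong_AE[OF K(2)])
    show "AE y in U. (LINT v|K t y. f (v, y)) = (LINT v|limit_density \<mu>0 y t. f (v, y))"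
      using AE_K[of t] by eventually_elim simp
    \<comment> \<open>\<open>integral_cong_AE\<close> asks for measurability on both sides, so the
      integrand with \<open>limit_density\<close> is exhibited as the one with \<open>K\<close>
      altered at one point.\<close>
    have "{y \<in> space U. y = y_C \<mu>0 t} = {y_C \<mu>0 t}" using y_C_bounds[OF t] by auto
    moreover have "{y_C \<mu>0 t} \<in> sets U" using y_C_bounds[OF t] by (simp add: sets_restrict_space_iff)
    ultimately have "(\<lambda>y. if y = y_C \<mu>0 t then (LINT v|limit_density \<mu>0 (y_C \<mu>0 t) t. f (v, y_C \<mu>0 t)) else (LINT v|K t y. f (v, y)))
        \<in> borel_measurable U"
      using K(2) by (intro measurable_If) auto
    then show "(\<lambda>y. LINT v|limit_density \<mu>0 y t. f (v, y)) \<in> borel_measurable U"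
      by (rule measurable_cong[THEN iffD1, rotated]) (auto simp: K_def)
  qed
  then show ?thesis using K(1) by simp
qed

lemma integral_L_marginal:
  fixes g :: "real \<Rightarrow> real"
  assumes t: "0 \<le> t" and g: "g \<in> borel_measurable borel_nonneg" "\<And>v. 0 \<le> v \<Longrightarrow> \<bar>g v\<bar> \<le> B"
  shows "(LINT p|L t. g (fst p) * of_bool (snd p < y)) = (LINT y'|U. (LINT v|K t y'. g v) * of_bool (y' < y))"
proof -
  have "(\<lambda>p. g (fst p)) \<in> borel_measurable strip"
    by (rule measurable_compose[OF measurable_fst g(1)])
  moreover have "(\<lambda>p. of_bool (snd p < y) :: real) \<in> borel_measurable strip"
  proof -
    have "(\<lambda>x. of_bool (x < y) :: real) \<in> borel_measurable borel_unit"
      by (rule measurable_restrict_space1) measurable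
    then show ?thesis by (rule measurable_compose[OF measurable_snd])
  qed
  ultimately have "(\<lambda>p. g (fst p) * of_bool (snd p < y)) \<in> borel_measurable strip"
    by (rule borel_measurable_times)
  moreover have "\<bar>g (fst p) * of_bool (snd p < y)\<bar> \<le> B" if "p \<in> {0..} \<times> {0..<1}" for p
    using g(2)[of "fst p"] that by (auto simp: abs_mult)
  ultimately show ?thesis by (subst integral_L_K(1)[OF t, where B=B]) auto
qed

lemma integral_L_below:
  fixes g :: "real \<Rightarrow> real"
  assumes "g \<in> borel_measurable borel_nonneg" "\<And>v. 0 \<le> v \<Longrightarrow> \<bar>g v\<bar> \<le> B" "0 \<le> s" "s \<le> t"
  shows "(LINT p|L t. g (fst p) * of_bool (snd p < y_C \<mu>0 s)) = (LINT v|\<Lambda>. g v * (1 - exp (- (v * s))))"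
  using integral_L_marginal[of t g B] marginal_below[OF assms] assms by simp

lemma integral_L_above:
  fixes g :: "real \<Rightarrow> real"
  assumes "g \<in> borel_measurable borel_nonneg" "\<And>v. 0 \<le> v \<Longrightarrow> \<bar>g v\<bar> \<le> B" "0 \<le> t" "z \<in> {0..1}"
  shows "(LINT p|L t. g (fst p) * of_bool (snd p < y_C2 \<mu>0 z t)) = (LINT v|\<Lambda>. g v * (1 - exp (- (v * t))))
    + (LINT u|lebesgue_on {0..<z}. LINT v|\<mu>0 u. exp (- (v * t)) * g v)"
  using integral_L_marginal[of t g B] marginal_above[OF assms] assms by simp

text \<open>At z = 1 the segment is the whole strip, and the weights 1 - exp(-(v*t)) and exp(-(v*t))
  of particles that have and have not jumped recombine to 1.\<close>

lemma integral_L_fst: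
  fixes g :: "real \<Rightarrow> real"
  assumes g: "g \<in> borel_measurable borel_nonneg" "\<And>v. 0 \<le> v \<Longrightarrow> \<bar>g v\<bar> \<le> B" and t: "0 \<le> t"
  shows "(LINT p|L t. g (fst p)) = (LINT v|\<Lambda>. g v)"
proof -
  have eg: "(\<lambda>v. exp (- (v * t)) * g v) \<in> borel_measurable borel_nonneg"
    by (rule borel_measurable_times[OF _ g(1)]) measurable
  have eg_le: "\<bar>exp (- (v * t)) * g v\<bar> \<le> B" if "0 \<le> v" for v
    using mult_mono[of "exp (- (v * t))" 1 "\<bar>g v\<bar>" B] g(2)[OF that] that t by (simp add: abs_mult)
  have int: "integrable \<Lambda> h" if "h \<in> borel_measurable borel_nonneg" "\<And>v. 0 \<le> v \<Longrightarrow> \<bar>h v\<bar> \<le> B" for h :: "real \<Rightarrow> real"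
  proof (rule \<Lambda>.integrable_const_bound)
    show "AE v in \<Lambda>. norm (h v) \<le> B" using that by auto
    show "h \<in> borel_measurable \<Lambda>" using that(1) unfolding measurable_cong_sets[OF sets_\<Lambda> refl] .
  qed
  have "(LINT p|L t. g (fst p)) = (LINT p|L t. g (fst p) * of_bool (snd p < y_C2 \<mu>0 1 t))"
    by (rule Bochner_Integration.integral_cong) (auto simp: space_L[OF t] y_C2_1)
  also have "\<dots> = (LINT v|\<Lambda>. g v * (1 - exp (- (v * t)))) + (LINT u|U. LINT v|\<mu>0 u. exp (- (v * t)) * g v)"
    by (rule integral_L_above[OF g t]) auto
  also have "(LINT u|U. LINT v|\<mu>0 u. exp (- (v * t)) * g v) = (LINT v|\<Lambda>. exp (- (v * t)) * g v)"
    by (rule integral_\<Lambda>[symmetric, OF eg eg_le])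
  also have "(LINT v|\<Lambda>. g v * (1 - exp (- (v * t)))) = (LINT v|\<Lambda>. g v - exp (- (v * t)) * g v)"
    by (rule Bochner_Integration.integral_cong) (auto simp: algebra_simps)
  also have "\<dots> = (LINT v|\<Lambda>. g v) - (LINT v|\<Lambda>. exp (- (v * t)) * g v)"
    by (intro Bochner_Integration.integral_diff int g eg eg_le)
  finally show ?thesis by simp
qed

lemma integral_L_uniform:
  assumes t: "0 \<le> t" and y: "y \<in> {0..<1}"
  shows "(LINT p|L t. of_bool (snd p < y)) = y"
proof -
  have "(LINT p|L t. (1::real) * of_bool (snd p < y)) = (LINT y'|U. (LINT v|K t y'. 1) * of_bool (y' < y))"
    by (rule integral_L_marginal[OF t, where g="\<lambda>_. 1" and B=1]) auto
  then have "(LINT p|L t. of_bool (snd p < y) :: real) = (LINT y'|U. (LINT v|K t y'. 1) * of_bool (y' < y))"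
    by (simp only: mult_1_left)
  also have "\<dots> = (LINT y'|U. indicator {0..<y} y')"
    by (rule Bochner_Integration.integral_cong)
      (use K_prob_space(1)[OF t] in \<open>auto simp: prob_space.prob_space indicator_def\<close>)
  also have "\<dots> = measure U {0..<y}" using y by (simp add: Int_absorb2)
  also have "\<dots> = y" using y by (subst measure_restrict_space) auto
  finally show ?thesis .
qed

end

section \<open>Law of large numbers for the ranking process\<close>

context initial_kernel
begin

lemma integral_\<mu>0_bound:
  fixes g :: "real \<Rightarrow> real"
  assumes z: "z \<in> {0..<1}" and g: "g \<in> borel_measurable borel_nonneg" "\<And>v. 0 \<le> v \<Longrightarrow> \<bar>g v\<bar> \<le> B"
  shows "\<bar>LINT v|\<mu>0 z. g v\<bar> \<le> B"
proof -
  interpret \<mu>: prob_space "\<mu>0 z" using kernel[OF z] by simp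
  have int: "integrable (\<mu>0 z) g"
    by (rule \<mu>.integrable_const_bound[OF _ \<mu>0_measurableI[OF z g(1)]]) (use g(2) space_\<mu>0[OF z] in auto)
  have "\<bar>LINT v|\<mu>0 z. g v\<bar> \<le> (LINT v|\<mu>0 z. \<bar>g v\<bar>)" by (rule integral_abs_bound)
  also have "\<dots> \<le> B"
    by (rule \<mu>.integral_le_const) (use int g(2) space_\<mu>0[OF z] in auto)
  finally show ?thesis .
qed

text \<open>Prepares the use of the initial convergence: a bound that makes its supremum one over a
  bounded set, the mass missing beyond y < 1, and the passage from its closed intervals to the
  half-open ones of the change of variables.\<close>

lemma integral_position_bounds:
  fixes g :: "real \<Rightarrow> real"
  assumes g: "g \<in> borel_measurable borel_nonneg" "\<And>v. 0 \<le> v \<Longrightarrow> \<bar>g v\<bar> \<le> B" and y: "y \<in> {0..<1}"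
  shows "\<bar>LINT z|lebesgue_on {0..y}. LINT v|\<mu>0 z. g v\<bar> \<le> B"
    and "\<bar>(LINT z|lebesgue_on {0..y}. LINT v|\<mu>0 z. g v) - (LINT v|\<Lambda>. g v)\<bar> \<le> B * (1 - y)"
    and "(LINT z|lebesgue_on {0..<y}. LINT v|\<mu>0 z. g v) = (LINT z|lebesgue_on {0..y}. LINT v|\<mu>0 z. g v)"
proof -
  let ?h = "\<lambda>z. LINT v|\<mu>0 z. g v"
  have B: "0 \<le> B" using g(2)[of 0] by simp
  have h: "?h \<in> borel_measurable U" by (rule integral_\<mu>0_measurable[OF g(1)])
  have S: "S \<in> sets U" if "S \<in> sets borel" "S \<subseteq> {0..<1}" for S
    using that by (simp add: sets_restrict_space_iff)
  have bnd: "\<bar>indicator S z * ?h z\<bar> \<le> B * indicator S z" if "z \<in> {0..<1}" for S z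
    using integral_\<mu>0_bound[OF that g] by (auto simp: indicator_def)
  have bnd': "\<bar>indicator S z * ?h z\<bar> \<le> B" if "z \<in> {0..<1}" for S z
    using integral_\<mu>0_bound[OF that g] B by (auto simp: indicator_def)
  have int: "integrable U (\<lambda>z. indicator S z * ?h z)" if "S \<in> sets borel" "S \<subseteq> {0..<1}" for S
    by (rule U.integrable_const_bound[where B=B])
      (use bnd' S[OF that] h in \<open>auto intro!: borel_measurable_times borel_measurable_indicator\<close>)
  have sub: "{0..y} \<subseteq> {0..<1}" "{y<..<1} \<subseteq> {0..<1}" "{0..<y} \<subseteq> {0..<1}" using y by auto
  have eq: "(LINT z|lebesgue_on S. ?h z) = (LINT z|U. indicator S z * ?h z)" if "S \<in> sets borel" "S \<subseteq> {0..<1}" for S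
    using that by (intro integral_lebesgue_on_subset) auto
  have le: "\<bar>LINT z|U. indicator S z * ?h z\<bar> \<le> B * measure lebesgue S" if "S \<in> sets borel" "S \<subseteq> {0..<1}" for S
  proof -
    have "\<bar>LINT z|U. indicator S z * ?h z\<bar> \<le> (LINT z|U. \<bar>indicator S z * ?h z\<bar>)" by (rule integral_abs_bound)
    also have "\<dots> \<le> (LINT z|U. B * indicator S z)"
      using S[OF that] int[OF that] bnd
      by (intro integral_mono integrable_mult_right integrable_real_indicator)
        (auto simp: U.emeasure_eq_measure intro!: integrable_abs)
    also have "\<dots> = B * measure U S"
      using S[OF that] that by (simp add: Int_absorb2)
    also have "measure U S = measure lebesgue S"
      using that by (intro measure_restrict_space) auto
    finally show ?thesis .
  qed
  have "measure lebesgue {0..y} \<le> 1" using y by simp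
  then show "\<bar>LINT z|lebesgue_on {0..y}. ?h z\<bar> \<le> B"
    using le[OF _ sub(1)] B eq[OF _ sub(1)] mult_left_le[of "measure lebesgue {0..y}" B] by (simp del: measure_lborel_Icc)
  have "(LINT v|\<Lambda>. g v) = (LINT z|U. ?h z)" by (rule integral_\<Lambda>[OF g])
  also have "\<dots> = (LINT z|U. indicator {0..y} z * ?h z + indicator {y<..<1} z * ?h z)"
    by (rule Bochner_Integration.integral_cong) (use y in \<open>auto simp: indicator_def\<close>)
  also have "\<dots> = (LINT z|U. indicator {0..y} z * ?h z) + (LINT z|U. indicator {y<..<1} z * ?h z)"
    using sub by (intro Bochner_Integration.integral_add int) auto
  finally show "\<bar>(LINT z|lebesgue_on {0..y}. ?h z) - (LINT v|\<Lambda>. g v)\<bar> \<le> B * (1 - y)"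
    using eq[OF _ sub(1)] le[OF _ sub(2)] y by simp
  show "(LINT z|lebesgue_on {0..<y}. ?h z) = (LINT z|lebesgue_on {0..y}. ?h z)"
    unfolding eq[OF atLeastLessThan_borel sub(3)] eq[OF atLeastAtMost_borel sub(1)]
  proof (rule integral_cong_AE)
    have "AE z in U. z \<noteq> y"
      by (subst AE_restrict_space_iff) (auto intro: AE_mp[OF AE_completion[OF AE_lborel_singleton[of y]]])
    then show "AE z in U. indicator {0..<y} z * ?h z = indicator {0..y} z * ?h z"
      by eventually_elim (auto simp: indicator_def)
  qed (use int[OF _ sub(1)] int[OF _ sub(3)] in auto)
qed

end

section \<open>Averages over the deterministic rates\<close>

locale ranking_limit = stochastic_ranking_process M w x0 \<tau> + initial_kernel \<mu>0
  for M :: "'a measure" and w x0 \<tau> \<mu>0 +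
  assumes initial_convergence:
      "\<And>g :: real \<Rightarrow> real. continuous_on {0..} g \<Longrightarrow> bounded (g ` {0..}) \<Longrightarrow>
         (\<lambda>N. SUP y\<in>{0..<1}.
            \<bar>(1 / real N) * (\<Sum>i=1..N. g (w N i) * of_bool (scaled_initial N (x0 N) i \<le> y))
             - (LINT z|lebesgue_on {0..y}. LINT v|\<mu>0 z. g v)\<bar>) \<longlonglongrightarrow> 0"
begin

lemma initial_rank: "i \<in> {1..N} \<Longrightarrow> x0 N i \<in> {1..N}"
  using initial_perm[of N] by (auto simp: bij_betw_def)

text \<open>The point may move with N because the hypothesis is uniform in y; this is used for
  points tending to 1. A real supremum dominates its members only if they are bounded, whence the
  bound 2 * B.\<close>

lemma initial_average_uniform:
  fixes g :: "real \<Rightarrow> real"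
  assumes g: "continuous_on {0..} g" "bounded (g ` {0..})" and y: "\<And>N. y N \<in> {0..<1}"
  shows "(\<lambda>N. (\<Sum>i=1..N. g (w N i) * of_bool (scaled_initial N (x0 N) i \<le> y N)) / real N
             - (LINT z|lebesgue_on {0..y N}. LINT v|\<mu>0 z. g v)) \<longlonglongrightarrow> 0"
proof -
  obtain B where B: "\<And>v. 0 \<le> v \<Longrightarrow> \<bar>g v\<bar> \<le> B" using g(2) unfolding bounded_iff by auto
  have B0: "0 \<le> B" using B[of 0] by simp
  have gm: "g \<in> borel_measurable borel_nonneg" by (rule borel_measurable_continuous_on_restrict[OF g(1)])
  let ?e = "\<lambda>N y. \<bar>(1 / real N) * (\<Sum>i=1..N. g (w N i) * of_bool (scaled_initial N (x0 N) i \<le> y))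
             - (LINT z|lebesgue_on {0..y}. LINT v|\<mu>0 z. g v)\<bar>"
  have bnd: "?e N y \<le> 2 * B" if "y \<in> {0..<1}" for N y
  proof -
    have "\<bar>(1 / real N) * (\<Sum>i=1..N. g (w N i) * of_bool (scaled_initial N (x0 N) i \<le> y))\<bar>
        \<le> (1 / real N) * (\<Sum>i=1..N. B)"
      unfolding abs_mult
    proof (rule mult_mono)
      show "\<bar>\<Sum>i=1..N. g (w N i) * of_bool (scaled_initial N (x0 N) i \<le> y)\<bar> \<le> (\<Sum>i=1..N. B)"
        using B rate_pos B0 by (intro order_trans[OF sum_abs sum_mono]) (auto simp: less_imp_le)
    qed auto
    also have "\<dots> \<le> B" using B0 by simp
    finally show ?thesis using integral_position_bounds(1)[OF gm B that] by linarith
  qed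
  have "?e N (y N) \<le> (SUP y\<in>{0..<1}. ?e N y)" for N
    by (rule cSUP_upper[OF y]) (use bnd in \<open>auto intro!: bdd_aboveI2[where M="2*B"]\<close>)
  then have "(\<lambda>N. ?e N (y N)) \<longlonglongrightarrow> 0"
    by (intro tendsto_sandwich[OF _ _ tendsto_const initial_convergence[OF g]] always_eventually allI) auto
  then show ?thesis by (simp add: tendsto_rabs_zero_iff)
qed

text \<open>The hypothesis speaks of y < 1 only. The last scaled initial position is 1 - 1 / N, so a
  point moving with N catches every particle, and the integral beyond it is at most B / N.\<close>

lemma average_converges:
  fixes g :: "real \<Rightarrow> real"
  assumes g: "continuous_on {0..} g" "bounded (g ` {0..})"
  shows "(\<lambda>N. (\<Sum>i=1..N. g (w N i)) / real N) \<longlonglongrightarrow> (LINT v|\<Lambda>. g v)"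
proof -
  obtain B where B: "\<And>v. 0 \<le> v \<Longrightarrow> \<bar>g v\<bar> \<le> B" using g(2) unfolding bounded_iff by auto
  have gm: "g \<in> borel_measurable borel_nonneg" by (rule borel_measurable_continuous_on_restrict[OF g(1)])
  \<comment> \<open>\<open>max 1 N\<close> keeps the point in the unit interval also at N =
    0.\<close>
  define y where "y N = 1 - 1 / real (max 1 N)" for N
  have y: "y N \<in> {0..<1}" for N by (auto simp: y_def)
  let ?I = "\<lambda>N. LINT z|lebesgue_on {0..y N}. LINT v|\<mu>0 z. g v"
  have "scaled_initial N (x0 N) i \<le> y N" if "i \<in> {1..N}" for N i
  proof -
    have "real (x0 N i) \<le> real N" "0 < N" using initial_rank[OF that] that by auto
    then show ?thesis by (simp add: scaled_initial_def y_def field_simps)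
  qed
  then have sum: "(\<Sum>i=1..N. g (w N i) * of_bool (scaled_initial N (x0 N) i \<le> y N)) = (\<Sum>i=1..N. g (w N i))" for N
    by (intro sum.cong) auto
  have 1: "(\<lambda>N. (\<Sum>i=1..N. g (w N i)) / real N - ?I N) \<longlonglongrightarrow> 0"
    using initial_average_uniform[where y=y, OF g y] by (simp only: sum)
  have "(\<lambda>N. ?I N - (LINT v|\<Lambda>. g v)) \<longlonglongrightarrow> 0"
  proof (rule Lim_null_comparison)
    show "\<forall>\<^sub>F N in sequentially. norm (?I N - (LINT v|\<Lambda>. g v)) \<le> B * (1 - y N)"
      using integral_position_bounds(2)[OF gm B y] by simp
    have "(\<lambda>N. 1 / real N) \<longlonglongrightarrow> 0" by (rule lim_1_over_n)
    moreover have "\<forall>\<^sub>F N in sequentially. 1 / real N = 1 - y N"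
      using eventually_gt_at_top[of 0] by eventually_elim (simp add: y_def max_def)
    ultimately have "(\<lambda>N. 1 - y N) \<longlonglongrightarrow> 0" by (rule Lim_transform_eventually)
    from tendsto_mult_right_zero[OF this, of B] show "(\<lambda>N. B * (1 - y N)) \<longlonglongrightarrow> 0" .
  qed
  from tendsto_add[OF 1 this] have "(\<lambda>N. (\<Sum>i=1..N. g (w N i)) / real N - (LINT v|\<Lambda>. g v)) \<longlonglongrightarrow> 0" by simp
  then show ?thesis by (rule LIM_zero_cancel)
qed

end

section \<open>An L1 law of large numbers and a counting criterion for segments\<close>

text \<open>The error splits into fluctuation and bias: the former is at most 2 * B / sqrt N in mean
  by orthogonality, the latter is deterministic.\<close>

lemma (in prob_space) average_converges_L1:
  fixes X :: "nat \<Rightarrow> nat \<Rightarrow> 'a \<Rightarrow> real"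
  assumes indep: "\<And>N. indep_vars (\<lambda>_. borel) (X N) {1..N}" and B: "0 \<le> B"
    and bd: "\<And>N i \<omega>. i \<in> {1..N} \<Longrightarrow> \<omega> \<in> space M \<Longrightarrow> \<bar>X N i \<omega>\<bar> \<le> B"
    and lim: "(\<lambda>N. (\<Sum>i=1..N. expectation (X N i)) / real N) \<longlonglongrightarrow> c"
  shows "(\<lambda>N. expectation (\<lambda>\<omega>. \<bar>(\<Sum>i=1..N. X N i \<omega>) / real N - c\<bar>)) \<longlonglongrightarrow> 0"
proof (rule Lim_null_comparison)
  let ?E = "\<lambda>N. \<Sum>i=1..N. expectation (X N i)" and ?S = "\<lambda>N \<omega>. \<Sum>i=1..N. X N i \<omega>"
  have rv: "random_variable borel (X N i)" if "i \<in> {1..N}" for N i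
    using indep[of N] that by (simp add: indep_vars_def)
  have S: "random_variable borel (?S N)" for N
    by (intro borel_measurable_sum rv)
  have S_bd: "\<bar>?S N \<omega>\<bar> \<le> B * N" if "\<omega> \<in> space M" for N \<omega>
  proof -
    have "\<bar>?S N \<omega>\<bar> \<le> (\<Sum>i=1..N. B)" by (intro order_trans[OF sum_abs sum_mono] bd that)
    then show ?thesis by (simp add: mult.commute)
  qed
  have S_int: "integrable M (?S N)" for N
    by (rule integrable_const_bound[OF _ S]) (use S_bd in auto)
  show "\<forall>\<^sub>F N in sequentially. norm (expectation (\<lambda>\<omega>. \<bar>?S N \<omega> / real N - c\<bar>)) \<le> 2 * B / sqrt N + \<bar>?E N / real N - c\<bar>"
    using eventually_gt_at_top[of 0]
  proof eventually_elim
    fix N :: nat assume N: "0 < N"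
    have "expectation (\<lambda>\<omega>. \<bar>?S N \<omega> / real N - c\<bar>) \<le> expectation (\<lambda>\<omega>. \<bar>?S N \<omega> - ?E N\<bar> / N + \<bar>?E N / real N - c\<bar>)"
    proof (rule integral_mono)
      fix \<omega> assume "\<omega> \<in> space M"
      have "?S N \<omega> / real N - c = (?S N \<omega> - ?E N) / N + (?E N / real N - c)" by (simp add: diff_divide_distrib)
      then have "\<bar>?S N \<omega> / real N - c\<bar> \<le> \<bar>(?S N \<omega> - ?E N) / N\<bar> + \<bar>?E N / real N - c\<bar>" by linarith
      then show "\<bar>?S N \<omega> / real N - c\<bar> \<le> \<bar>?S N \<omega> - ?E N\<bar> / N + \<bar>?E N / real N - c\<bar>" by simp
    qed (use S_int in auto)
    also have "\<dots> = expectation (\<lambda>\<omega>. \<bar>?S N \<omega> - ?E N\<bar>) / N + \<bar>?E N / real N - c\<bar>"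
      using S_int by (simp add: prob_space)
    also have "expectation (\<lambda>\<omega>. \<bar>?S N \<omega> - ?E N\<bar>) / N \<le> (2 * B * sqrt N) / N"
      using expectation_abs_sum_indep_le[OF indep _ B bd, of N] by (intro divide_right_mono) auto
    also have "\<dots> = 2 * B / sqrt N" using N by (simp add: field_simps)
    finally show "norm (expectation (\<lambda>\<omega>. \<bar>?S N \<omega> / real N - c\<bar>)) \<le> 2 * B / sqrt N + \<bar>?E N / real N - c\<bar>"
      by simp
  qed
  have "(\<lambda>N. 2 * B / sqrt N) \<longlonglongrightarrow> 0"
    by (intro tendsto_divide_0[OF tendsto_const] filterlim_compose[OF filterlim_at_top_imp_at_infinity[OF sqrt_at_top]] 
        filterlim_real_sequentially filterlim_at_top_imp_at_infinity)
  moreover have "(\<lambda>N. \<bar>?E N / real N - c\<bar>) \<longlonglongrightarrow> 0"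
    using lim by (intro tendsto_rabs_zero) (simp add: LIM_zero)
  ultimately show "(\<lambda>N. 2 * B / sqrt N + \<bar>?E N / real N - c\<bar>) \<longlonglongrightarrow> 0"
    using tendsto_add[of _ 0 _ _ 0] by simp
qed

text \<open>Read \<open>P j i\<close> as: j precedes i. The predecessors of a member lie in S and
  omit the member itself, whereas an outsider is preceded by all of S.\<close>

lemma card_less_segment:
  assumes "finite I" "S \<subseteq> I" "i \<in> I" "\<not> P i i"
    and "i \<in> S \<Longrightarrow> \<forall>j\<in>I. P j i \<longrightarrow> j \<in> S" "i \<notin> S \<Longrightarrow> \<forall>j\<in>S. P j i"
  shows "i \<in> S \<longleftrightarrow> card {j \<in> I. P j i} < card S"
proof
  assume i: "i \<in> S"
  have "finite S" using assms(1,2) finite_subset by blast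
  moreover have "{j \<in> I. P j i} \<subset> S" using assms i by auto
  ultimately show "card {j \<in> I. P j i} < card S" by (rule psubset_card_mono)
next
  assume less: "card {j \<in> I. P j i} < card S"
  show "i \<in> S"
  proof (rule ccontr)
    assume "i \<notin> S"
    then have "S \<subseteq> {j \<in> I. P j i}" using assms by auto
    then have "card S \<le> card {j \<in> I. P j i}" using assms(1) by (intro card_mono) auto
    then show False using less by simp
  qed
qed

section \<open>Laws of the jump times and measurability of the ranking\<close>

context ranking_limit
begin

lemma jump_measurable: "i \<in> {1..N} \<Longrightarrow> random_variable (Pi\<^sub>M UNIV (\<lambda>_. borel)) (\<lambda>\<omega> j. \<tau> N i j \<omega>)"
  using particles_indep[of N] by (simp add: indep_vars_def)

lemma \<tau>_measurable: "i \<in> {1..N} \<Longrightarrow> random_variable borel (\<tau> N i j)"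
  using measurable_compose[OF jump_measurable measurable_component_singleton[of j UNIV]] by simp

lemma increment_exponential:
  assumes i: "i \<in> {1..N}"
  shows "distributed M lborel (\<lambda>\<omega>. \<tau> N i (Suc j) \<omega> - \<tau> N i j \<omega>) (exponential_density (w N i))"
  unfolding exponential_distributed_iff[OF rate_pos[OF i]]
proof (intro conjI allI impI)
  have meas: "random_variable borel (\<lambda>\<omega>. \<tau> N i (Suc j) \<omega> - \<tau> N i j \<omega>)" for j
    by (intro borel_measurable_diff \<tau>_measurable[OF i])
  then show "random_variable borel (\<lambda>\<omega>. \<tau> N i (Suc j) \<omega> - \<tau> N i j \<omega>)" .
  fix a :: real assume a: "0 \<le> a"
  have distr: "measure (distr M borel (\<lambda>\<omega>. \<tau> N i (Suc j) \<omega> - \<tau> N i j \<omega>)) {..a}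
      = prob {\<omega> \<in> space M. \<tau> N i (Suc j) \<omega> - \<tau> N i j \<omega> \<le> a}" for j
    by (subst measure_distr[OF meas]) (auto intro!: arg_cong[where f=prob])
  have "prob {\<omega> \<in> space M. \<tau> N i (Suc j) \<omega> - \<tau> N i j \<omega> \<le> a} = prob {\<omega> \<in> space M. \<tau> N i 1 \<omega> - \<tau> N i 0 \<omega> \<le> a}"
    using distr[of j] distr[of 0] increments_identically_distributed[OF i, of j] by simp
  also have "{\<omega> \<in> space M. \<tau> N i 1 \<omega> - \<tau> N i 0 \<omega> \<le> a} = {\<omega> \<in> space M. \<tau> N i 1 \<omega> \<le> a}"
    using jump_0[OF i] by auto
  also have "prob \<dots> = 1 - exp (- a * w N i)"
    using first_jump_exponential[OF i a] by (simp add: mult.commute)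
  finally show "prob {\<omega> \<in> space M. \<tau> N i (Suc j) \<omega> - \<tau> N i j \<omega> \<le> a} = 1 - exp (- a * w N i)" .
qed

text \<open>The rank uses a jump time with a random index, so it is treated for each fixed index and
  composed over the countably many values of the \<open>LEAST\<close>. Ranks carry the discrete
  \<sigma>-algebra, so h may be arbitrary; this matters because test functions are continuous on the
  strip only.\<close>

lemma scaled_ranking_measurable:
  assumes i: "i \<in> {1..N}"
  shows "(\<lambda>\<omega>. (h :: real \<Rightarrow> real) (scaled_ranking N (x0 N) (\<lambda>i j. \<tau> N i j \<omega>) i t)) \<in> borel_measurable M"
proof -
  define R where "R n \<omega> = (if n = 0
      then x0 N i + (\<Sum>i'=1..N. if x0 N i' > x0 N i \<and> \<tau> N i' 1 \<omega> \<le> t then 1 else 0)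
      else 1 + (\<Sum>i'=1..N. if \<exists>j'\<in>{1..}. \<tau> N i n \<omega> < \<tau> N i' j' \<omega> \<and> \<tau> N i' j' \<omega> \<le> t then 1 else 0))" for n \<omega>
  note [measurable] = \<tau>_measurable
  have R: "R n \<in> M \<rightarrow>\<^sub>M count_space UNIV" for n
    unfolding R_def[abs_def] using i by measurable
  have least: "(\<lambda>\<omega>. LEAST j. t < \<tau> N i (Suc j) \<omega>) \<in> M \<rightarrow>\<^sub>M count_space UNIV"
    using i by measurable
  have card_eq: "card {i' \<in> {1..N}. P i'} = (\<Sum>i'=1..N. if P i' then 1 else 0)" for P
    by (simp add: sum.If_cases Int_def)
  have "ranking N (x0 N) (\<lambda>i j. \<tau> N i j \<omega>) i t = R (LEAST j. t < \<tau> N i (Suc j) \<omega>) \<omega>" for \<omega>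
    unfolding ranking_def R_def Let_def card_eq Bex_def atLeast_iff ..
  moreover have "(\<lambda>\<omega>. R (LEAST j. t < \<tau> N i (Suc j) \<omega>) \<omega>) \<in> M \<rightarrow>\<^sub>M count_space UNIV"
    by (rule measurable_compose_countable[OF R least])
  ultimately have "(\<lambda>\<omega>. ranking N (x0 N) (\<lambda>i j. \<tau> N i j \<omega>) i t) \<in> M \<rightarrow>\<^sub>M count_space UNIV" by simp
  from measurable_compose[OF this, of "\<lambda>n. h ((real n - 1) / real N)" borel]
  show ?thesis by (simp add: scaled_ranking_def)
qed

section \<open>Initial segments of the ranking at a fixed time\<close>

context
  fixes t :: real
  assumes t: "0 \<le> t"
begin

definition J :: "nat \<Rightarrow> nat \<Rightarrow> 'a \<Rightarrow> real" where
  "J N i \<omega> = last_jump (\<lambda>j. \<tau> N i j \<omega>) t"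

abbreviation Y :: "nat \<Rightarrow> nat \<Rightarrow> 'a \<Rightarrow> real" where
  "Y N i \<omega> \<equiv> scaled_ranking N (x0 N) (\<lambda>i j. \<tau> N i j \<omega>) i t"

lemma J_indep: "indep_vars (\<lambda>_. borel) (J N) {1..N}"
  unfolding J_def[abs_def]
  by (rule indep_vars_compose2[OF particles_indep measurable_last_jump])

lemma J_measurable: "i \<in> {1..N} \<Longrightarrow> random_variable borel (J N i)"
  using J_indep[of N] by (simp add: indep_vars_def)

lemma AE_regular: "AE \<omega> in M. \<forall>i\<in>{1..N}. regular_jumps (\<lambda>j. \<tau> N i j \<omega>) t"
proof (rule AE_finite_allI)
  fix i assume i: "i \<in> {1..N}"
  show "AE \<omega> in M. regular_jumps (\<lambda>j. \<tau> N i j \<omega>) t"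
    by (rule AE_regular_jumps[OF rate_pos[OF i] jump_0[OF i] \<tau>_measurable[OF i] increments_indep[OF i]
          increment_exponential[OF i] t])
qed simp

lemma prob_J_le:
  assumes i: "i \<in> {1..N}" and s: "0 \<le> s" "s \<le> t"
  shows "prob {\<omega> \<in> space M. J N i \<omega> \<le> s} = exp (- (w N i * (t - s)))"
  unfolding J_def
  by (rule prob_last_jump_le[OF rate_pos[OF i] jump_0[OF i] \<tau>_measurable[OF i] increments_indep[OF i]
        increment_exponential[OF i] t s])

text \<open>The particles expected on the positions below y: those that jumped during the last
  \<open>t_0 \<mu>0 y\<close> units of time or, from the boundary on, all that jumped together with
  those starting at most at \<open>y_hat \<mu>0 y t\<close>. The conjunct 0 < y empties the segment
  at y = 0 for every outcome; at t = 0 the second branch would otherwise keep the particle of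
  initial rank 1.\<close>

definition D :: "nat \<Rightarrow> real \<Rightarrow> nat \<Rightarrow> 'a \<Rightarrow> bool" where
  "D N y i \<omega> \<longleftrightarrow> 0 < y \<and> (if y < y_C \<mu>0 t then t - t_0 \<mu>0 y < J N i \<omega>
      else 0 < J N i \<omega> \<or> scaled_initial N (x0 N) i \<le> y_hat \<mu>0 y t)"

text \<open>Replaces the inverse functions by the parameters s and z; since s < t, the threshold t -
  s is positive.\<close>

lemma D_cases:
  assumes "y \<in> {0<..<1}"
  obtains (below) s where "s \<in> {0..<t}" "y = y_C \<mu>0 s" "\<And>N i \<omega>. D N y i \<omega> \<longleftrightarrow> t - s < J N i \<omega>"
  | (above) z where "z \<in> {0..<1}" "y = y_C2 \<mu>0 z t"
      "\<And>N i \<omega>. D N y i \<omega> \<longleftrightarrow> 0 < J N i \<omega> \<or> scaled_initial N (x0 N) i \<le> z"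
proof (cases "y < y_C \<mu>0 t")
  case True
  then obtain s where "s \<in> {0..<t}" "y = y_C \<mu>0 s" using y_C_cases[OF t, of y] assms by auto
  then show ?thesis using below[of s] True assms by (simp add: D_def t_0_y_C)
next
  case False
  then obtain z where "z \<in> {0..<1}" "y = y_C2 \<mu>0 z t" using y_C2_cases[OF t, of y] assms by auto
  then show ?thesis using above[of z] False assms t by (simp add: D_def y_hat_y_C2)
qed

lemma D_measurable:
  assumes "i \<in> {1..N}" shows "Measurable.pred M (D N y i)"
  using J_measurable[OF assms] unfolding D_def[abs_def] by measurable

lemma D_mono:
  assumes y: "0 \<le> y" "y \<le> y'" "y' < 1" and D: "D N y i \<omega>"
  shows "D N y' i \<omega>"
proof -
  have y0: "y \<in> {0<..<1}" "y' \<in> {0<..<1}" using D y by (auto simp: D_def)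
  show ?thesis
    using y0(1)
  proof (cases rule: D_cases)
    case (below s)
    show ?thesis
      using y0(2)
    proof (cases rule: D_cases)
      case below': (below s')
      have "\<not> s' < s"
        using strict_mono_onD[OF y_C_strict_mono, of s' s] below below' y by auto
      then show ?thesis using below(3) below'(3) D by (meson diff_left_mono leI le_less_trans)
    next
      case (above z)
      then show ?thesis using below D by (auto intro: le_less_trans[of 0 "t - s"])
    qed
  next
    case (above z)
    show ?thesis
      using y0(2)
    proof (cases rule: D_cases)
      case (below s)
      \<comment> \<open>This combination is impossible: y' would lie below the boundary and y at or
        above it.\<close>
      have "y_C \<mu>0 s < y_C \<mu>0 t" using strict_mono_onD[OF y_C_strict_mono, of s t] below t by auto
      moreover have "y_C \<mu>0 t \<le> y"
        using above time_change.F_ge[OF time_change_y_C2[OF t, of 1], of z] t by (simp add: y_C2_0)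
      ultimately show ?thesis using below y by simp
    next
      case above': (above z')
      have "z \<le> z'"
        using time_change.F_le_iff[OF time_change_y_C2[OF t, of 1], of z z'] above above' y by auto
      then show ?thesis using above(3) above'(3) D by auto
    qed
  qed
qed

text \<open>Dividing the comparison of counts in \<open>card_less_segment\<close> by N turns it into
  one of positions. The random proportion on the right is the only place where the other particles
  enter.\<close>

lemma D_segment:
  "AE \<omega> in M. \<forall>i\<in>{1..N}. Y N i \<omega> \<in> {0..<1} \<and>
     (\<forall>y\<in>{0..<1}. D N y i \<omega> \<longleftrightarrow> Y N i \<omega> < (\<Sum>i=1..N. of_bool (D N y i \<omega>)) / real N)"
proof (rule AE_mp[OF AE_regular[of N]], intro AE_I2 impI ballI)
  fix \<omega> i assume reg: "\<forall>i\<in>{1..N}. regular_jumps (\<lambda>j. \<tau> N i j \<omega>) t" and i: "i \<in> {1..N}"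
  define pre where "pre i' i \<longleftrightarrow> J N i \<omega> < J N i' \<omega> \<or> J N i \<omega> = 0 \<and> x0 N i' < x0 N i" for i' i
  have J0: "0 \<le> J N i \<omega>" if "i \<in> {1..N}" for i
    unfolding J_def using reg that t by (intro last_jump_nonneg) auto
  have Y: "Y N i \<omega> = card {i' \<in> {1..N}. pre i' i} / real N"
    unfolding scaled_ranking_def pre_def J_def
    by (subst ranking_eq_card[OF _ t initial_perm i]) (use reg in auto)
  have N: "0 < N" using i by auto
  \<comment> \<open>No particle precedes itself, so there are at most N - 1 predecessors and the
    position stays below 1.\<close>
  have "{i' \<in> {1..N}. pre i' i} \<subseteq> {1..N} - {i}" by (auto simp: pre_def)
  then have "card {i' \<in> {1..N}. pre i' i} \<le> card ({1..N} - {i})" by (intro card_mono) auto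
  also have "card ({1..N} - {i}) = N - 1" using i by simp
  finally have "card {i' \<in> {1..N}. pre i' i} < N" using N by linarith
  then have Y01: "Y N i \<omega> \<in> {0..<1}" using N unfolding Y by simp
  have seg: "D N y i \<omega> \<longleftrightarrow> Y N i \<omega> < (\<Sum>i=1..N. of_bool (D N y i \<omega>)) / real N" if y: "y \<in> {0..<1}" for y
  proof (cases "y = 0")
    case True
    then show ?thesis using Y01 by (simp add: D_def)
  next
    case False
    then have y0: "y \<in> {0<..<1}" using y by auto
    have "i \<in> {i \<in> {1..N}. D N y i \<omega>} \<longleftrightarrow> card {i' \<in> {1..N}. pre i' i} < card {i \<in> {1..N}. D N y i \<omega>}"
      using y0
    proof (cases rule: D_cases)
      case (below s)
      show ?thesis
      proof (rule card_less_segment)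
        show "\<forall>j\<in>{1..N}. pre j i \<longrightarrow> j \<in> {i \<in> {1..N}. D N y i \<omega>}" if "i \<in> {i \<in> {1..N}. D N y i \<omega>}"
          using that below by (auto simp: pre_def)
        show "\<forall>j\<in>{i \<in> {1..N}. D N y i \<omega>}. pre j i" if "i \<notin> {i \<in> {1..N}. D N y i \<omega>}"
          using that i below by (auto simp: pre_def)
      qed (use i in \<open>auto simp: pre_def\<close>)
    next
      case (above z)
      have mono: "scaled_initial N (x0 N) j \<le> z" if "x0 N j \<le> x0 N k" "scaled_initial N (x0 N) k \<le> z" for j k
      proof -
        have "scaled_initial N (x0 N) j \<le> scaled_initial N (x0 N) k"
          using that N unfolding scaled_initial_def by (intro divide_right_mono) auto
        then show ?thesis using that by simp
      qed
      show ?thesis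
      proof (rule card_less_segment)
        show "\<forall>j\<in>{1..N}. pre j i \<longrightarrow> j \<in> {i \<in> {1..N}. D N y i \<omega>}" if "i \<in> {i \<in> {1..N}. D N y i \<omega>}"
          using that above J0[OF i] mono[of _ i] by (auto simp: pre_def)
        \<comment> \<open>An outsider never jumped and starts beyond z, so its last jump is 0 by
          \<open>J0\<close>; a member has jumped or starts at most at z, hence strictly ahead of
          it.\<close>
        show "\<forall>j\<in>{i \<in> {1..N}. D N y i \<omega>}. pre j i" if "i \<notin> {i \<in> {1..N}. D N y i \<omega>}"
          using that i above J0[OF i] mono[of i] by (force simp: pre_def not_le not_less)
      qed (use i in \<open>auto simp: pre_def\<close>)
    qed
    moreover have "(\<Sum>i=1..N. of_bool (D N y i \<omega>)) = real (card {i \<in> {1..N}. D N y i \<omega>})"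
      by (simp add: of_bool_def sum.If_cases Int_def)
    ultimately show ?thesis using i N unfolding Y by (simp add: divide_less_cancel)
  qed
  show "Y N i \<omega> \<in> {0..<1} \<and>
     (\<forall>y\<in>{0..<1}. D N y i \<omega> \<longleftrightarrow> Y N i \<omega> < (\<Sum>i=1..N. of_bool (D N y i \<omega>)) / real N)"
    using Y01 seg by auto
qed

end

section \<open>Convergence of the segments and of the empirical distribution\<close>

context
  fixes t :: real
  assumes t: "0 \<le> t"
begin

lemma expectation_J_greater:
  assumes i: "i \<in> {1..N}" and r: "0 \<le> r" "r \<le> t"
  shows "expectation (\<lambda>\<omega>. of_bool (r < J t N i \<omega>)) = 1 - exp (- (w N i * (t - r)))"
proof -
  have [measurable]: "random_variable borel (J t N i)" by (rule J_measurable[OF t i])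
  have "expectation (\<lambda>\<omega>. of_bool (r < J t N i \<omega>)) = expectation (indicator {\<omega> \<in> space M. r < J t N i \<omega>})"
    by (rule Bochner_Integration.integral_cong) (auto simp: indicator_def)
  also have "\<dots> = prob {\<omega> \<in> space M. r < J t N i \<omega>}" by simp
  also have "{\<omega> \<in> space M. r < J t N i \<omega>} = space M - {\<omega> \<in> space M. J t N i \<omega> \<le> r}" by auto
  also have "prob \<dots> = 1 - exp (- (w N i * (t - r)))"
    using prob_J_le[OF t i r] by (subst prob_compl) auto
  finally show ?thesis .
qed

text \<open>By the L1 law of large numbers only the means of the segment indicators matter: 1 -
  exp(-(v*s)) for rate v in the lower case, and in the upper case this value at s = t plus
  exp(-(v*t)) for the particles starting at most at z. Multiplied by g they stay bounded and
  continuous in the rate, so the initial convergence applies, and the limits are the integrals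
  computed for \<open>L\<close>.\<close>

lemma D_average_converges:
  fixes g :: "real \<Rightarrow> real"
  assumes g: "continuous_on {0..} g" "bounded (g ` {0..})" and y: "y \<in> {0..<1}"
  shows "(\<lambda>N. expectation (\<lambda>\<omega>. \<bar>(\<Sum>i=1..N. g (w N i) * of_bool (D t N y i \<omega>)) / real N
           - (LINT p|L t. g (fst p) * of_bool (snd p < y))\<bar>)) \<longlonglongrightarrow> 0"
proof (cases "y = 0")
  case True
  have "(LINT p|L t. g (fst p) * of_bool (snd p < 0)) = (LINT p|L t. 0)"
    by (rule Bochner_Integration.integral_cong) (auto simp: space_L[OF t])
  then show ?thesis using True by (simp add: D_def[OF t])
next
  case False
  then have y0: "y \<in> {0<..<1}" using y by auto
  obtain B where B: "\<And>v. 0 \<le> v \<Longrightarrow> \<bar>g v\<bar> \<le> B" using g(2) unfolding bounded_iff by auto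
  have B0: "0 \<le> B" using B[of 0] by simp
  have gm: "g \<in> borel_measurable borel_nonneg" by (rule borel_measurable_continuous_on_restrict[OF g(1)])
  have w0: "0 \<le> w N i" if "i \<in> {1..N}" for N i using rate_pos[OF that] by simp
  have bd: "\<bar>g (w N i) * of_bool P\<bar> \<le> B" if "i \<in> {1..N}" for N i P
    using B[OF w0[OF that]] B0 by (cases P) auto
  have g_exp: "continuous_on {0..} (\<lambda>v. exp (- (v * s)) * g v)" "bounded ((\<lambda>v. exp (- (v * s)) * g v) ` {0..})"
    and g_diff: "continuous_on {0..} (\<lambda>v. g v * (1 - exp (- (v * s))))" "bounded ((\<lambda>v. g v * (1 - exp (- (v * s)))) ` {0..})"
    if s: "0 \<le> s" for s
  proof -
    have "\<bar>exp (- (v * s)) * g v\<bar> \<le> 1 * B" "\<bar>g v * (1 - exp (- (v * s)))\<bar> \<le> B * 1" if "0 \<le> v" for v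
      unfolding abs_mult using that s B[OF that] B0 by (intro mult_mono; auto)+
    then show "bounded ((\<lambda>v. exp (- (v * s)) * g v) ` {0..})" "bounded ((\<lambda>v. g v * (1 - exp (- (v * s)))) ` {0..})"
      by (auto intro!: boundedI[of _ B])
    show "continuous_on {0..} (\<lambda>v. exp (- (v * s)) * g v)" "continuous_on {0..} (\<lambda>v. g v * (1 - exp (- (v * s))))"
      using g(1) by (auto intro!: continuous_intros)
  qed
  show ?thesis
    using t y0
  proof (cases rule: D_cases)
    case (below s)
    have s: "0 \<le> s" "s \<le> t" using below by auto
    have E: "expectation (\<lambda>\<omega>. g (w N i) * of_bool (t - s < J t N i \<omega>)) = g (w N i) * (1 - exp (- (w N i * s)))"
      if "i \<in> {1..N}" for N i
      using expectation_J_greater[OF that, of "t - s"] s by simp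
    have "(\<lambda>N. expectation (\<lambda>\<omega>. \<bar>(\<Sum>i=1..N. g (w N i) * of_bool (t - s < J t N i \<omega>)) / real N
           - (LINT v|\<Lambda>. g v * (1 - exp (- (v * s))))\<bar>)) \<longlonglongrightarrow> 0"
    proof (rule average_converges_L1[OF _ B0])
      show "indep_vars (\<lambda>_. borel) (\<lambda>i \<omega>. g (w N i) * of_bool (t - s < J t N i \<omega>)) {1..N}" for N
        by (rule indep_vars_compose2[OF J_indep[OF t]]) measurable
      have "(\<lambda>N. (\<Sum>i=1..N. g (w N i) * (1 - exp (- (w N i * s)))) / real N) \<longlonglongrightarrow> (LINT v|\<Lambda>. g v * (1 - exp (- (v * s))))"
        by (rule average_converges[OF g_diff[OF s(1)]])
      then show "(\<lambda>N. (\<Sum>i=1..N. expectation (\<lambda>\<omega>. g (w N i) * of_bool (t - s < J t N i \<omega>))) / real N) \<longlonglongrightarrow> (LINT v|\<Lambda>. g v * (1 - exp (- (v * s))))"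
        by (simp only: E cong: sum.cong)
    qed (rule bd, assumption)
    moreover have "(LINT p|L t. g (fst p) * of_bool (snd p < y_C \<mu>0 s)) = (LINT v|\<Lambda>. g v * (1 - exp (- (v * s))))"
      by (rule integral_L_below[OF gm B s])
    ultimately show ?thesis unfolding below(3) unfolding below(2) by simp
  next
    case (above z)
    have z: "z \<in> {0..1}" using above by auto
    let ?c = "\<lambda>N i. scaled_initial N (x0 N) i \<le> z"
    let ?lim = "(LINT v|\<Lambda>. g v * (1 - exp (- (v * t)))) + (LINT u|lebesgue_on {0..<z}. LINT v|\<mu>0 u. exp (- (v * t)) * g v)"
    \<comment> \<open>A particle starting at most at z belongs to the segment in any case; the two
      terms split this certainty according to whether it has jumped.\<close>
    have E: "expectation (\<lambda>\<omega>. g (w N i) * of_bool (0 < J t N i \<omega> \<or> ?c N i))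
        = g (w N i) * (1 - exp (- (w N i * t))) + exp (- (w N i * t)) * g (w N i) * of_bool (?c N i)"
      if i: "i \<in> {1..N}" for N i
    proof (cases "?c N i")
      case True
      then show ?thesis by (simp add: prob_space algebra_simps)
    next
      case False
      then show ?thesis using expectation_J_greater[OF i, of 0] t by simp
    qed
    have "(\<lambda>N. expectation (\<lambda>\<omega>. \<bar>(\<Sum>i=1..N. g (w N i) * of_bool (0 < J t N i \<omega> \<or> ?c N i)) / real N - ?lim\<bar>)) \<longlonglongrightarrow> 0"
    proof (rule average_converges_L1[OF _ B0])
      show "indep_vars (\<lambda>_. borel) (\<lambda>i \<omega>. g (w N i) * of_bool (0 < J t N i \<omega> \<or> ?c N i)) {1..N}" for N
        by (rule indep_vars_compose2[OF J_indep[OF t]]) measurable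
      have egm: "(\<lambda>v. exp (- (v * t)) * g v) \<in> borel_measurable borel_nonneg"
        by (rule borel_measurable_continuous_on_restrict[OF g_exp(1)[OF t]])
      obtain B' where B': "\<And>v. 0 \<le> v \<Longrightarrow> \<bar>exp (- (v * t)) * g v\<bar> \<le> B'"
        using g_exp(2)[OF t] unfolding bounded_iff by auto
      have "(\<lambda>N. (\<Sum>i=1..N. exp (- (w N i * t)) * g (w N i) * of_bool (?c N i)) / real N) \<longlonglongrightarrow>
          (LINT u|lebesgue_on {0..z}. LINT v|\<mu>0 u. exp (- (v * t)) * g v)"
        by (rule LIM_zero_cancel[OF initial_average_uniform[where y="\<lambda>_. z", OF g_exp[OF t] above(1)]])
      moreover have "(LINT u|lebesgue_on {0..<z}. LINT v|\<mu>0 u. exp (- (v * t)) * g v) =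
          (LINT u|lebesgue_on {0..z}. LINT v|\<mu>0 u. exp (- (v * t)) * g v)"
        by (rule integral_position_bounds(3)[OF egm B' above(1)])
      ultimately have "(\<lambda>N. (\<Sum>i=1..N. exp (- (w N i * t)) * g (w N i) * of_bool (?c N i)) / real N) \<longlonglongrightarrow>
          (LINT u|lebesgue_on {0..<z}. LINT v|\<mu>0 u. exp (- (v * t)) * g v)" by simp
      from tendsto_add[OF average_converges[OF g_diff[OF t]] this]
      show "(\<lambda>N. (\<Sum>i=1..N. expectation (\<lambda>\<omega>. g (w N i) * of_bool (0 < J t N i \<omega> \<or> ?c N i))) / real N) \<longlonglongrightarrow> ?lim"
        by (simp only: E sum.distrib add_divide_distrib cong: sum.cong)
    qed (rule bd, assumption)
    moreover have "(LINT p|L t. g (fst p) * of_bool (snd p < y_C2 \<mu>0 z t)) = ?lim"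
      by (rule integral_L_above[OF gm B t z])
    ultimately show ?thesis unfolding above(3) unfolding above(2) by simp
  qed
qed

lemma empirical_distribution_converges:
  fixes f :: "real \<times> real \<Rightarrow> real"
  assumes f: "continuous_on ({0..} \<times> {0..<1}) f" "bounded (f ` ({0..} \<times> {0..<1}))"
  shows "(\<lambda>N. expectation (\<lambda>\<omega>. \<bar>(\<Sum>i=1..N. f (w N i, Y t N i \<omega>)) / real N - (LINT p|L t. f p)\<bar>)) \<longlonglongrightarrow> 0"
proof (rule empirical_distribution_converges_L1[where D="D t"])
  show "prob_space (L t)" by (rule prob_space_L[OF t])
  show "sets (L t) = sets strip" by (rule sets_L[OF t])
  show "0 \<le> w N i" if "i \<in> {1..N}" for N i using rate_pos[OF that] by simp
  show "Measurable.pred M (D t N y i)" if "i \<in> {1..N}" for N y i by (rule D_measurable[OF t that])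
  show "\<not> D t N 0 i \<omega>" for N i \<omega> by (simp add: D_def[OF t])
  show "D t N y' i \<omega>" if "0 \<le> y" "y \<le> y'" "y' < 1" "D t N y i \<omega>" for N i y y' \<omega>
    by (rule D_mono[OF t that])
  show "AE \<omega> in M. \<forall>i\<in>{1..N}. Y t N i \<omega> \<in> {0..<1} \<and>
      (\<forall>y\<in>{0..<1}. D t N y i \<omega> = (Y t N i \<omega> < (\<Sum>i = 1..N. of_bool (D t N y i \<omega>)) / real N))" for N
    by (rule D_segment[OF t])
  show "(\<lambda>N. expectation (\<lambda>\<omega>. \<bar>(\<Sum>i=1..N. g (w N i) * of_bool (D t N y i \<omega>)) / real N
           - (LINT p|L t. g (fst p) * of_bool (snd p < y))\<bar>)) \<longlonglongrightarrow> 0"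
    if "continuous_on {0..} g" "bounded (g ` {0..})" "y \<in> {0..<1}" for g :: "real \<Rightarrow> real" and y
    by (rule D_average_converges[OF that])
  show "(\<lambda>N. (\<Sum>i=1..N. g (w N i)) / real N) \<longlonglongrightarrow> (LINT p|L t. g (fst p))"
    if g: "continuous_on {0..} g" "bounded (g ` {0..})" for g :: "real \<Rightarrow> real"
  proof -
    obtain B where B: "\<And>v. 0 \<le> v \<Longrightarrow> \<bar>g v\<bar> \<le> B" using g(2) unfolding bounded_iff by auto
    show ?thesis
      using average_converges[OF g] integral_L_fst[OF borel_measurable_continuous_on_restrict[OF g(1)] B t] by simp
  qed
  show "(LINT p|L t. of_bool (snd p < y)) = y" if "y \<in> {0..<1}" for y
    by (rule integral_L_uniform[OF t that])
  show "(\<lambda>\<omega>. f (w N i, Y t N i \<omega>)) \<in> borel_measurable M" if "i \<in> {1..N}" for N i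
    by (rule scaled_ranking_measurable[OF that])
qed (fact f)+

text \<open>Markov's inequality applied to the L1 convergence. Integrability of the error rests on
  positions lying in {0..<1} almost surely, since f is bounded on the strip only.\<close>

lemma empirical_distribution_tendsto_in_probability:
  fixes f :: "real \<times> real \<Rightarrow> real"
  assumes f: "continuous_on ({0..} \<times> {0..<1}) f" "bounded (f ` ({0..} \<times> {0..<1}))"
  shows "tendsto_in_probability M (\<lambda>N \<omega>. (1 / real N) * (\<Sum>i=1..N. f (w N i, Y t N i \<omega>))) (LINT p|L t. f p)"
  unfolding tendsto_in_probability_def
proof (intro conjI allI impI)
  let ?Z = "\<lambda>N \<omega>. (1 / real N) * (\<Sum>i=1..N. f (w N i, Y t N i \<omega>))" and ?c = "LINT p|L t. f p"
  show meas: "?Z N \<in> borel_measurable M" for N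
    by (intro borel_measurable_times borel_measurable_const borel_measurable_sum scaled_ranking_measurable)
  obtain B where B: "\<And>p. p \<in> {0..} \<times> {0..<1} \<Longrightarrow> \<bar>f p\<bar> \<le> B"
    using f(2) unfolding bounded_iff by auto
  have int: "integrable M (\<lambda>\<omega>. \<bar>?Z N \<omega> - ?c\<bar>)" for N
  proof (rule integrable_const_bound)
    show "AE \<omega> in M. norm \<bar>?Z N \<omega> - ?c\<bar> \<le> (1 / real N) * (\<Sum>i=1..N. B) + \<bar>?c\<bar>"
      using D_segment[OF t, of N]
    proof eventually_elim
      case (elim \<omega>)
      have "\<bar>f (w N i, Y t N i \<omega>)\<bar> \<le> B" if "i \<in> {1..N}" for i
        using elim that rate_pos[OF that] by (intro B) auto
      then have "\<bar>\<Sum>i=1..N. f (w N i, Y t N i \<omega>)\<bar> \<le> (\<Sum>i=1..N. B)"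
        by (intro order_trans[OF sum_abs sum_mono])
      then have "\<bar>?Z N \<omega>\<bar> \<le> (1 / real N) * (\<Sum>i=1..N. B)"
        unfolding abs_mult by (intro mult_mono) auto
      then have "\<bar>?Z N \<omega> - ?c\<bar> \<le> (1 / real N) * (\<Sum>i=1..N. B) + \<bar>?c\<bar>" by linarith
      then show ?case by (simp only: real_norm_def abs_abs)
    qed
    show "(\<lambda>\<omega>. \<bar>?Z N \<omega> - ?c\<bar>) \<in> borel_measurable M"
      using meas by (intro borel_measurable_abs borel_measurable_diff borel_measurable_const)
  qed
  fix \<epsilon> :: real assume \<epsilon>: "0 < \<epsilon>"
  show "(\<lambda>N. prob {\<omega> \<in> space M. \<bar>?Z N \<omega> - ?c\<bar> > \<epsilon>}) \<longlonglongrightarrow> 0"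
  proof (rule Lim_null_comparison)
    have "prob {\<omega> \<in> space M. \<bar>?Z N \<omega> - ?c\<bar> > \<epsilon>} \<le> expectation (\<lambda>\<omega>. \<bar>?Z N \<omega> - ?c\<bar>) / \<epsilon>" for N
    proof -
      have "prob {\<omega> \<in> space M. \<bar>?Z N \<omega> - ?c\<bar> > \<epsilon>} \<le> prob {\<omega> \<in> space M. \<epsilon> \<le> \<bar>?Z N \<omega> - ?c\<bar>}"
      proof (rule finite_measure_mono)
        have "(\<lambda>\<omega>. \<bar>?Z N \<omega> - ?c\<bar>) \<in> borel_measurable M" using int[of N] by (rule borel_measurable_integrable)
        then show "{\<omega> \<in> space M. \<epsilon> \<le> \<bar>?Z N \<omega> - ?c\<bar>} \<in> events" by measurable
      qed auto
      also have "\<dots> \<le> expectation (\<lambda>\<omega>. \<bar>?Z N \<omega> - ?c\<bar>) / \<epsilon>"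
        by (rule integral_Markov_inequality_measure[OF int sets.top _ \<epsilon>]) simp
      finally show ?thesis .
    qed
    then show "\<forall>\<^sub>F N in sequentially. norm (prob {\<omega> \<in> space M. \<bar>?Z N \<omega> - ?c\<bar> > \<epsilon>}) \<le> expectation (\<lambda>\<omega>. \<bar>?Z N \<omega> - ?c\<bar>) / \<epsilon>"
      by simp
    have "(\<lambda>N. expectation (\<lambda>\<omega>. \<bar>?Z N \<omega> - ?c\<bar>)) \<longlonglongrightarrow> 0"
      using empirical_distribution_converges[OF f] by simp
    from tendsto_divide_zero[OF this] show "(\<lambda>N. expectation (\<lambda>\<omega>. \<bar>?Z N \<omega> - ?c\<bar>) / \<epsilon>) \<longlonglongrightarrow> 0" .
  qed
qed

end
end

theorem theorem6:
  fixes M :: "'a measure"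
    and w :: "nat \<Rightarrow> nat \<Rightarrow> real"
    and x0 :: "nat \<Rightarrow> nat \<Rightarrow> nat"
    and \<tau> :: "nat \<Rightarrow> nat \<Rightarrow> nat \<Rightarrow> 'a \<Rightarrow> real"
    and \<mu>0 :: "real \<Rightarrow> real measure"
  assumes process: "stochastic_ranking_process M w x0 \<tau>"
    and kernel: "\<And>y. y \<in> {0..<1} \<Longrightarrow> prob_space (\<mu>0 y) \<and> sets (\<mu>0 y) = sets borel_nonneg"
    and kernel_measurable:
      "\<And>g :: real \<Rightarrow> real. continuous_on {0..} g \<Longrightarrow> bounded (g ` {0..}) \<Longrightarrow>
         (\<lambda>y. LINT v|\<mu>0 y. g v) \<in> borel_measurable (lebesgue_on {0..<1})"
    and initial_convergence:
      "\<And>g :: real \<Rightarrow> real. continuous_on {0..} g \<Longrightarrow> bounded (g ` {0..}) \<Longrightarrow>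
         (\<lambda>N. SUP y\<in>{0..<1}.
            \<bar>(1 / real N) * (\<Sum>i=1..N. g (w N i) * of_bool (scaled_initial N (x0 N) i \<le> y))
             - (LINT z|lebesgue_on {0..y}. LINT v|\<mu>0 z. g v)\<bar>) \<longlonglongrightarrow> 0"
    and finite_mean: "(\<integral>\<^sup>+ v. ennreal v \<partial>rate_dist \<mu>0) < \<infinity>"
    and no_zero_rate: "emeasure (rate_dist \<mu>0) {0} = 0"
  shows "\<forall>t\<ge>0.
    (\<forall>y\<in>{0..<1}. y \<noteq> y_C \<mu>0 t \<longrightarrow>
        prob_space (limit_density \<mu>0 y t) \<and> sets (limit_density \<mu>0 y t) = sets borel_nonneg) \<and>
    (\<exists>L :: (real \<times> real) measure.
        prob_space L \<and> sets L = sets (borel_nonneg \<Otimes>\<^sub>M borel_unit) \<and>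
        absolutely_continuous (restrict_space lborel {0..<1}) (distr L borel_unit snd) \<and>
        (\<forall>A \<in> sets borel_nonneg. \<forall>B \<in> sets borel_unit.
           emeasure L (A \<times> B)
             = (\<integral>\<^sup>+ y. emeasure (limit_density \<mu>0 y t) A * indicator B y \<partial>lebesgue_on {0..<1})) \<and>
        (\<forall>f :: real \<times> real \<Rightarrow> real.
           continuous_on ({0..} \<times> {0..<1}) f \<longrightarrow> bounded (f ` ({0..} \<times> {0..<1})) \<longrightarrow>
             (LINT p|L. f p)
               = (LINT y|lebesgue_on {0..<1}. LINT v|limit_density \<mu>0 y t. f (v, y)) \<and>
             tendsto_in_probability M
               (\<lambda>N \<omega>. (1 / real N) *
                  (\<Sum>i=1..N. f (w N i, scaled_ranking N (x0 N) (\<lambda>i j. \<tau> N i j \<omega>) i t)))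
               (LINT y|lebesgue_on {0..<1}. LINT v|limit_density \<mu>0 y t. f (v, y))))"
proof (intro allI impI)
  fix t :: real assume t: "0 \<le> t"
  interpret stochastic_ranking_process M w x0 \<tau> by (rule process)
  interpret ranking_limit M w x0 \<tau> \<mu>0
    by unfold_locales (use kernel kernel_measurable finite_mean no_zero_rate initial_convergence in auto)
  have f: "(LINT p|L t. f p) = (LINT y|lebesgue_on {0..<1}. LINT v|limit_density \<mu>0 y t. f (v, y)) \<and>
      tendsto_in_probability M
        (\<lambda>N \<omega>. (1 / real N) * (\<Sum>i=1..N. f (w N i, scaled_ranking N (x0 N) (\<lambda>i j. \<tau> N i j \<omega>) i t)))
        (LINT y|lebesgue_on {0..<1}. LINT v|limit_density \<mu>0 y t. f (v, y))"
    if f: "continuous_on ({0..} \<times> {0..<1}) f" "bounded (f ` ({0..} \<times> {0..<1}))" for f :: "real \<times> real \<Rightarrow> real"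
  proof -
    obtain B where "\<And>p. p \<in> {0..} \<times> {0..<1} \<Longrightarrow> \<bar>f p\<bar> \<le> B" using f(2) unfolding bounded_iff by auto
    from integral_L[OF t continuous_on_strip_measurable[OF f(1)] this]
    show ?thesis using empirical_distribution_tendsto_in_probability[OF t f] by metis
  qed
  show "(\<forall>y\<in>{0..<1}. y \<noteq> y_C \<mu>0 t \<longrightarrow>
        prob_space (limit_density \<mu>0 y t) \<and> sets (limit_density \<mu>0 y t) = sets borel_nonneg) \<and>
    (\<exists>L :: (real \<times> real) measure.
        prob_space L \<and> sets L = sets (borel_nonneg \<Otimes>\<^sub>M borel_unit) \<and>
        absolutely_continuous (restrict_space lborel {0..<1}) (distr L borel_unit snd) \<and>
        (\<forall>A \<in> sets borel_nonneg. \<forall>B \<in> sets borel_unit.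
           emeasure L (A \<times> B)
             = (\<integral>\<^sup>+ y. emeasure (limit_density \<mu>0 y t) A * indicator B y \<partial>lebesgue_on {0..<1})) \<and>
        (\<forall>f :: real \<times> real \<Rightarrow> real.
           continuous_on ({0..} \<times> {0..<1}) f \<longrightarrow> bounded (f ` ({0..} \<times> {0..<1})) \<longrightarrow>
             (LINT p|L. f p)
               = (LINT y|lebesgue_on {0..<1}. LINT v|limit_density \<mu>0 y t. f (v, y)) \<and>
             tendsto_in_probability M
               (\<lambda>N \<omega>. (1 / real N) *
                  (\<Sum>i=1..N. f (w N i, scaled_ranking N (x0 N) (\<lambda>i j. \<tau> N i j \<omega>) i t)))
               (LINT y|lebesgue_on {0..<1}. LINT v|limit_density \<mu>0 y t. f (v, y))))"
    using limit_density_prob_space[OF t] prob_space_L[OF t] sets_L[OF t] absolutely_continuous_L[OF t]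
      emeasure_L[OF t] f
    by (intro conjI exI[of _ "L t"] ballI allI impI) simp_all
qed

end
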